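(* Let $m\ge 1$ and $T\in(0,\infty)$ be fixed, and let $K,\beta,\gamma>0$. Suppose $G\in\mathcal{G}_{K,\beta,\gamma}$. Then there is a constant $c=c(K,\beta,\gamma)<\infty$ (depending on $G$ only through $K,\beta,\gamma$, with $m,T$ fixed) such that, for any $\varepsilon>0$, if sets $G',G''\in\mathcal{G}$ are such that $G\subset G'\subset G^{(\varepsilon)}$ and $G\subset G''\subset G^{(\varepsilon)}$, then $$|P(G')-P(G'')|<c\,\varepsilon.$$
   Context: $\mathbf{W}=\{\mathbf{W}_t\}_{t\ge 0}$ is the standard $m$-dimensional Brownian motion with $\mathbf{W}_0=\mathbf{0}$. For a set $H\subset[0,T]\times\mathbb{R}^m$ (first component is time), $P(H):=\mathbb{P}\big((t,\mathbf{W}_t)\in H,\ t\in(0,T)\big)$, i.e. the probability that $(t,\mathbf{W}_t)\in H$ for all $t\in(0,T)$, and $H_t:=\{\mathbf{x}\in\mathbb{R}^m:(t,\mathbf{x})\in H\}$ is the time-$t$ section of $H$. $\mathcal{G}$ is the class of open sets $G\subset(0,T)\times\mathbb{R}^m$ with $(0,\mathbf{0})\in\partial G$. $\|\cdot\|$ is the Euclidean norm, $\rho(\mathbf{x},A):=\inf_{\mathbf{y}\in A}\|\mathbf{x}-\mathbf{y}\|$, $A^c$ is the complement of $A$, and $B_r(\mathbf{x}):=\{\mathbf{y}\in\mathbb{R}^m:\|\mathbf{x}-\mathbf{y}\|<r\}$. For $A\subset\mathbb{R}^m$ and $v>0$, $A^{(v)}:=\{\mathbf{x}\in\mathbb{R}^m:\rho(\mathbf{x},A)<v\}$.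 For $H\subset[0,T]\times\mathbb{R}^m$ and $v>0$, $H^{(v)}:=\{(t,\mathbf{x}):t\in[0,T],\ \mathbf{x}\in (H_t)^{(v)}\}$. For $A,\widetilde A\subset\mathbb{R}^m$: $\rho_h(A,\widetilde A):=\inf\{\varepsilon>0: A\subset\widetilde A^{(\varepsilon)}\text{ and }\widetilde A\subset A^{(\varepsilon)}\}$ and $\rho_H(A,\widetilde A):=\max\{\rho_h(A,\widetilde A),\rho_h(A^c,\widetilde A^c)\}$. $\mathcal{G}_{K,\beta,\gamma}$ is the class of sets $G\in\mathcal{G}$ satisfying the following three conditions: (1) $\rho_H(G_s,G_t)\le K(t-s)$ for all $0<s<t<T$; (2) for any $t\in(0,T)$ and $\mathbf{g}\in\partial G_t$ (boundary of the section $G_t$ in $\mathbb{R}^m$), there exists a ball $B_\beta(\mathbf{y})\subset G_t^c$ with $\mathbf{g}\in\partial B_\beta(\mathbf{y})$; (3) for any $t\in(0,T)$ there exists $v_0>0$ such that $\mathbb{E}\big(1+\|\mathbf{W}_t\|;\ 0<\rho(\mathbf{W}_t,G_t^c)<v\big)<\gamma v$ for all $0<v<v_0$, where $\mathbb{E}(X;A):=\mathbb{E}(X\mathbf{1}_A)$. *)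

theory Defs
  imports "HOL-Probability.Probability"
begin

text \<open>Paths are required to be continuous for every \<omega>, not just almost surely. This makes
  the event that the path stays in an open set measurable without completing M.\<close>

locale std_brownian_motion = prob_space M
  for M :: "'w measure" +
  fixes W :: "real \<Rightarrow> 'w \<Rightarrow> real ^ 'm"
  assumes W_measurable: "\<And>t. 0 \<le> t \<Longrightarrow> random_variable borel (W t)"
    and W_start: "\<And>\<omega>. \<omega> \<in> space M \<Longrightarrow> W 0 \<omega> = 0"
    and W_indep_increments:
      "\<And>(n::nat) \<tau>. 0 \<le> \<tau> 0 \<Longrightarrow> (\<And>i. i < n \<Longrightarrow> \<tau> i < \<tau> (Suc i)) \<Longrightarrow>
        indep_vars (\<lambda>_. borel) (\<lambda>i \<omega>. W (\<tau> (Suc i)) \<omega> - W (\<tau> i) \<omega>) {..<n}"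
    and W_gaussian_increments:
      "\<And>s t. 0 \<le> s \<Longrightarrow> s < t \<Longrightarrow>
        distributed M lborel (\<lambda>\<omega>. W t \<omega> - W s \<omega>)
          (\<lambda>x. ennreal (\<Prod>i\<in>UNIV. normal_density 0 (sqrt (t - s)) (x $ i)))"
    and W_continuous: "\<And>\<omega>. \<omega> \<in> space M \<Longrightarrow> continuous_on {0..} (\<lambda>t. W t \<omega>)"

definition stay_prob ::
    "'w measure \<Rightarrow> (real \<Rightarrow> 'w \<Rightarrow> (real ^ 'm)) \<Rightarrow> real \<Rightarrow> (real \<times> (real ^ 'm)) set \<Rightarrow> real" where
  "stay_prob M W T H = measure M {\<omega> \<in> space M. \<forall>t\<in>{0<..<T}. (t, W t \<omega>) \<in> H}"

definition time_section :: "(real \<times> 'a) set \<Rightarrow> real \<Rightarrow> 'a set" where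
  "time_section H t = {x. (t, x) \<in> H}"

text \<open>Distances are extended reals, so that the infimum over the empty set is \<infinity>.
  The library's \<open>infdist x {}\<close> is 0, which would make every neighbourhood of the empty set
  the whole space.\<close>

definition set_dist :: "'a::metric_space \<Rightarrow> 'a set \<Rightarrow> ereal" where
  "set_dist x A = (INF y\<in>A. ereal (dist x y))"

definition nbhd :: "'a::metric_space set \<Rightarrow> real \<Rightarrow> 'a set" where
  "nbhd A v = {x. set_dist x A < ereal v}"

definition space_nbhd ::
    "real \<Rightarrow> (real \<times> 'a::metric_space) set \<Rightarrow> real \<Rightarrow> (real \<times> 'a) set" where
  "space_nbhd T H v = {(t, x). t \<in> {0..T} \<and> x \<in> nbhd (time_section H t) v}"

definition hausdorff_h :: "'a::metric_space set \<Rightarrow> 'a set \<Rightarrow> ereal" where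
  "hausdorff_h A B = Inf {ereal e | e. 0 < e \<and> A \<subseteq> nbhd B e \<and> B \<subseteq> nbhd A e}"

definition hausdorff_H :: "'a::metric_space set \<Rightarrow> 'a set \<Rightarrow> ereal" where
  "hausdorff_H A B = max (hausdorff_h A B) (hausdorff_h (- A) (- B))"

definition class_G :: "real \<Rightarrow> (real \<times> (real ^ 'm)) set set" where
  "class_G T = {G. open G \<and> G \<subseteq> {0<..<T} \<times> UNIV \<and> (0, 0) \<in> frontier G}"

definition class_GK ::
    "'w measure \<Rightarrow> (real \<Rightarrow> 'w \<Rightarrow> (real ^ 'm)) \<Rightarrow> real \<Rightarrow> real \<Rightarrow> real \<Rightarrow> real
      \<Rightarrow> (real \<times> (real ^ 'm)) set set" where
  "class_GK M W T K \<beta> \<gamma> = {G \<in> class_G T.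
     (\<forall>s t. 0 < s \<and> s < t \<and> t < T \<longrightarrow>
        hausdorff_H (time_section G s) (time_section G t) \<le> ereal (K * (t - s))) \<and>
     (\<forall>t\<in>{0<..<T}. \<forall>g\<in>frontier (time_section G t).
        \<exists>y. ball y \<beta> \<subseteq> - time_section G t \<and> g \<in> frontier (ball y \<beta>)) \<and>
     (\<forall>t\<in>{0<..<T}. \<exists>v0>0. \<forall>v. 0 < v \<and> v < v0 \<longrightarrow>
        (LINT \<omega>:{\<omega> \<in> space M. 0 < set_dist (W t \<omega>) (- time_section G t) \<and>
                             set_dist (W t \<omega>) (- time_section G t) < ereal v}|M.
           1 + norm (W t \<omega>)) < \<gamma> * v)}"

end

theory Submission
  imports Defs
begin

text \<open>All the sets compared lie between G and its \<epsilon>-neighbourhood, so it suffices to bound the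
  probability that the path leaves G and still stays in the neighbourhood. At the first exit time \<tau> the
  path touches an exterior ball of G of radius \<beta>. Since the sections move with speed at most K, the
  ball shrunk at speed K stays outside G, so that the path must avoid a slightly smaller shrinking
  ball during the remaining time, which has probability O(\<epsilon> / sqrt (T - \<tau>)).

  It remains to see that \<tau> has a bounded density on (T/2, T). Reversing time, staying in G up to time t
  and ending at x at distance r from the complement means avoiding a shrinking ball backwards, which
  has probability O(r (1 + |x|)); the factor 1 + |x| is the drift of the Brownian bridge. Leaving G
  during (t, t + h) from there costs a factor exp(- r^2 / (32 h)), and the third condition on
  G turns the integral of the product into O(h).

  The avoidance estimates are proved for the walk sampled on a time grid, with an explicit supersolution
  whose Gaussian averages are computable; hence no stochastic calculus and no strong Markov
  property is needed.\<close>

section \<open>Gaussian densities\<close>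

text \<open>The singularity at T shapes the proof. The factor \<epsilon> / sqrt (T - \<tau>) is
  unbounded but integrable at T, so a density bound for \<tau> is needed only near T; before T / 2
  the factor itself is bounded. This is fortunate, since the backward argument spends a time window
  before t and divides by the elapsed time, so it would degenerate at 0.

  The density bound is a balance of scales. At distance of order sqrt h from the boundary, the
  backward avoidance gives a factor sqrt h and the third condition a probability of order \<gamma>
  sqrt h; together this is O(h). The weight 1 + |x| in the third condition is consumed by the drift.

  A moving ball and the drift of the bridge leave no explicit hitting probability. The barrier is
  built from exp (- lam |z - y|^2) because a Gaussian step maps this function to one of the same
  type, so that the one-step inequality is plain algebra. The parameter lam only has to dominate all
  first-order terms, and the avoidance bound is linear in lam; a drift of size 1 + |x| therefore
  costs just that factor.\<close>

definition gauss_density :: "real \<Rightarrow> real ^ 'm \<Rightarrow> real" where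
  "gauss_density v x = (\<Prod>i\<in>UNIV. normal_density 0 (sqrt v) (x $ i))"

lemma gauss_density_nonneg [simp]: "0 \<le> gauss_density v x"
  by (simp add: gauss_density_def prod_nonneg)

lemma borel_measurable_gauss_density [measurable]: "gauss_density v \<in> borel_measurable borel"
  unfolding gauss_density_def by measurable

lemma gauss_density_exp:
  fixes x :: "real ^ 'm"
  assumes "0 < v"
  shows "gauss_density v x = (1 / sqrt (2 * pi * v)) ^ CARD('m) * exp (- (norm x)\<^sup>2 / (2 * v))"
proof -
  have "(norm x)\<^sup>2 = (\<Sum>i\<in>UNIV. (x $ i)\<^sup>2)"
    unfolding norm_vec_def L2_set_def by (simp add: sum_nonneg)
  then show ?thesis
    using assms
    by (simp add: gauss_density_def normal_density_def prod.distrib exp_sum [symmetric] sum_divide_distrib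
        sum_negf prod_constant power_divide prod_dividef del: real_sqrt_mult)
qed

lemma nn_integral_gauss_density:
  assumes "0 < v"
  shows "(\<integral>\<^sup>+ x. ennreal (gauss_density v (x :: real ^ 'm)) \<partial>lborel) = 1"
proof -
  have bas: "(\<Prod>b\<in>Basis. ennreal (normal_density 0 (sqrt v) (x \<bullet> b))) =
      (\<Prod>i\<in>UNIV. ennreal (normal_density 0 (sqrt v) (x $ i)))" for x :: "real ^ 'm"
    by (simp add: Basis_vec_def UNION_singleton_eq_range prod.reindex inj_on_def axis_eq_axis
        inner_axis)
  have "(\<integral>\<^sup>+ x. ennreal (gauss_density v (x :: real ^ 'm)) \<partial>lborel) =
      (\<integral>\<^sup>+ x. (\<Prod>b\<in>Basis. ennreal (normal_density 0 (sqrt v) (x \<bullet> b))) \<partial>(lborel :: (real ^ 'm) measure))"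
    unfolding bas by (simp add: gauss_density_def prod_ennreal)
  also have "\<dots> = (\<Prod>b\<in>(Basis::(real^'m) set). (\<integral>\<^sup>+ x. ennreal (normal_density 0 (sqrt v) x) \<partial>lborel))"
    by (rule nn_integral_lborel_prod) auto
  also have "(\<integral>\<^sup>+ x. ennreal (normal_density 0 (sqrt v) x) \<partial>lborel) = 1"
    using assms by (subst nn_integral_eq_integral) auto
  finally show ?thesis by simp
qed

lemma nn_integral_lborel_shift:
  fixes c :: "'a :: euclidean_space"
  assumes [measurable]: "f \<in> borel_measurable borel"
  shows "(\<integral>\<^sup>+ x. f (c + x) \<partial>lborel) = (\<integral>\<^sup>+ x. f x \<partial>lborel)"
proof -
  have "(\<integral>\<^sup>+ x. f x \<partial>lborel) = (\<integral>\<^sup>+ x. f x \<partial>distr lborel borel ((+) c))"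
    by (simp add: lborel_distr_plus)
  also have "\<dots> = (\<integral>\<^sup>+ x. f (c + x) \<partial>lborel)"
    by (rule nn_integral_distr) auto
  finally show ?thesis ..
qed

text \<open>Completing the square: the product is a multiple of a Gaussian density of variance
  \<open>v / (1 + 2 * l * v)\<close> with shifted centre. The rate \<open>l\<close> may be negative;
  \<open>l = - 1 / (4 * h)\<close> yields the exponential moments of the squared norm.\<close>

lemma nn_integral_gauss_density_exp:
  fixes z :: "real ^ 'm"
  assumes v: "0 < v" and l: "0 < 1 + 2 * l * v"
  shows "(\<integral>\<^sup>+ x. ennreal (exp (- l * (norm (z + x))\<^sup>2)) * ennreal (gauss_density v x) \<partial>lborel) =
    ennreal ((1 / sqrt (1 + 2 * l * v)) ^ CARD('m) * exp (- l * (norm z)\<^sup>2 / (1 + 2 * l * v)))"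
proof -
  define k where "k = 1 + 2 * l * v"
  define w where "w = v / k"
  define c where "c = (2 * l * v / k) *\<^sub>R z"
  have k: "0 < k" "0 < w" using v l by (auto simp: k_def w_def)
  have lk: "l = (k - 1) / (2 * v)" using v by (simp add: k_def)
  have key: "exp (- l * (norm (z + x))\<^sup>2) * gauss_density v x
      = ((1 / sqrt k) ^ CARD('m) * exp (- l * (norm z)\<^sup>2 / k)) * gauss_density w (c + x)" for x
  proof -
    have s: "sqrt (2 * pi * v) = sqrt k * sqrt (2 * pi * w)"
      using k v by (simp add: w_def real_sqrt_mult [symmetric])
    have c': "c = ((k - 1) / k) *\<^sub>R z" using v by (simp add: c_def k_def)
    have e: "- l * (norm (z + x))\<^sup>2 + - (norm x)\<^sup>2 / (2 * v)
        = - l * (norm z)\<^sup>2 / k + - (norm (c + x))\<^sup>2 / (2 * w)"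
      unfolding c' w_def power2_norm_eq_inner lk using k v
      by (simp add: inner_add_left inner_add_right inner_commute field_simps power2_eq_square)
    show ?thesis
      unfolding gauss_density_exp [OF v] gauss_density_exp [OF k(2)] s
      using e by (simp add: power_divide power_mult_distrib mult_exp_exp)
  qed
  have "(\<integral>\<^sup>+ x. ennreal (exp (- l * (norm (z + x))\<^sup>2)) * ennreal (gauss_density v x) \<partial>lborel)
     = (\<integral>\<^sup>+ x. ennreal ((1 / sqrt k) ^ CARD('m) * exp (- l * (norm z)\<^sup>2 / k)) * ennreal (gauss_density w (c + x)) \<partial>lborel)"
    unfolding ennreal_mult [symmetric, OF exp_ge_zero gauss_density_nonneg] key
    using k by (intro nn_integral_cong ennreal_mult) auto
  also have "\<dots> = ennreal ((1 / sqrt k) ^ CARD('m) * exp (- l * (norm z)\<^sup>2 / k)) *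
      (\<integral>\<^sup>+ x. ennreal (gauss_density w (c + x)) \<partial>lborel)"
    by (rule nn_integral_cmult) auto
  also have "(\<integral>\<^sup>+ x. ennreal (gauss_density w (c + x)) \<partial>lborel) = 1"
    using nn_integral_lborel_shift[of "\<lambda>x. ennreal (gauss_density w x)" c] nn_integral_gauss_density[OF k(2)]
    by simp
  finally show ?thesis by (simp add: k_def)
qed

text \<open>Bayes' formula: the backward transition kernel of Brownian motion is again Gaussian.\<close>
lemma gauss_density_reverse:
  fixes x z :: "real ^ 'm"
  assumes s: "0 < s" and h: "0 < h"
  shows "gauss_density s z * gauss_density h (x - z) =
    gauss_density (s + h) x * gauss_density (h * (s / (s + h))) (z - (s / (s + h)) *\<^sub>R x)"
proof -
  define v where "v = h * (s / (s + h))"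
  have v: "0 < v" "0 < s + h" using s h by (auto simp: v_def)
  have sq: "sqrt (2 * pi * s) * sqrt (2 * pi * h) = sqrt (2 * pi * (s + h)) * sqrt (2 * pi * v)"
    unfolding real_sqrt_mult [symmetric] v_def using v by simp
  have e: "(norm z)\<^sup>2 / (2 * s) + (norm (x - z))\<^sup>2 / (2 * h)
     = (norm x)\<^sup>2 / (2 * (s + h)) + (norm (z - (s / (s + h)) *\<^sub>R x))\<^sup>2 / (2 * v)"
  proof -
    define r where "r = s + h"
    have r: "r > 0" "h = r - s" using s h by (auto simp: r_def)
    show ?thesis
      unfolding v_def r_def[symmetric] power2_norm_eq_inner
      using s h r(1)
      apply (simp add: inner_diff_left inner_diff_right inner_commute field_simps power2_eq_square)
      unfolding r(2) by algebra
  qed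
  have sq': "(1 / sqrt (2 * pi * s)) ^ CARD('m) * (1 / sqrt (2 * pi * h)) ^ CARD('m)
    = (1 / sqrt (2 * pi * (s + h))) ^ CARD('m) * (1 / sqrt (2 * pi * v)) ^ CARD('m)"
    unfolding power_mult_distrib [symmetric] times_divide_times_eq sq by simp
  have "gauss_density s z * gauss_density h (x - z)
     = ((1 / sqrt (2 * pi * s)) ^ CARD('m) * (1 / sqrt (2 * pi * h)) ^ CARD('m)) *
       exp (- ((norm z)\<^sup>2 / (2 * s) + (norm (x - z))\<^sup>2 / (2 * h)))"
    unfolding gauss_density_exp[OF s] gauss_density_exp[OF h]
    by (simp add: exp_add [symmetric] mult.assoc mult.left_commute exp_diff exp_minus field_simps del: real_sqrt_mult)
  also have "\<dots> = ((1 / sqrt (2 * pi * (s + h))) ^ CARD('m) * (1 / sqrt (2 * pi * v)) ^ CARD('m)) *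
       exp (- ((norm x)\<^sup>2 / (2 * (s + h)) + (norm (z - (s / (s + h)) *\<^sub>R x))\<^sup>2 / (2 * v)))"
    unfolding e sq' ..
  also have "\<dots> = gauss_density (s + h) x * gauss_density v (z - (s / (s + h)) *\<^sub>R x)"
    unfolding gauss_density_exp[OF v(1)] gauss_density_exp[OF v(2)]
    by (simp add: exp_add [symmetric] mult.assoc mult.left_commute exp_diff exp_minus field_simps del: real_sqrt_mult)
  finally show ?thesis by (simp add: v_def)
qed

definition gauss_measure :: "real \<Rightarrow> (real ^ 'm) measure" where
  "gauss_measure v = density lborel (\<lambda>x. ennreal (gauss_density v x))"

lemma sets_gauss_measure [simp, measurable_cong]: "sets (gauss_measure v) = sets borel"
  by (simp add: gauss_measure_def)

lemma space_gauss_measure [simp]: "space (gauss_measure v) = UNIV"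
  by (simp add: gauss_measure_def)

lemma prob_space_gauss_measure:
  assumes "0 < v"
  shows "prob_space (gauss_measure v :: (real ^ 'm) measure)"
  using nn_integral_gauss_density[OF assms, where 'm = 'm]
  by (intro prob_spaceI) (simp add: gauss_measure_def emeasure_density)

lemma nn_integral_gauss_measure:
  assumes [measurable]: "f \<in> borel_measurable borel"
  shows "(\<integral>\<^sup>+ x. f x \<partial>gauss_measure v) = (\<integral>\<^sup>+ x. f x * ennreal (gauss_density v x) \<partial>lborel)"
  unfolding gauss_measure_def by (subst nn_integral_density) (auto simp: mult.commute)

lemma nn_integral_gauss_measure_exp:
  fixes z :: "real ^ 'm"
  assumes "0 < v" "0 < 1 + 2 * l * v"
  shows "(\<integral>\<^sup>+ x. ennreal (exp (- l * (norm (z + x))\<^sup>2)) \<partial>gauss_measure v) =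
    ennreal ((1 / sqrt (1 + 2 * l * v)) ^ CARD('m) * exp (- l * (norm z)\<^sup>2 / (1 + 2 * l * v)))"
  by (subst nn_integral_gauss_measure) (simp_all add: nn_integral_gauss_density_exp [OF assms, simplified] assms)

text \<open>The rate \<open>1 / (4 * h)\<close> is half the critical rate for variance
  \<open>h\<close>, so \<open>1 - v / (2 * h)\<close> is at least 1/2 and each coordinate costs at
  most a factor \<open>sqrt 2\<close>.\<close>

lemma nn_integral_gauss_measure_exp_sq:
  assumes "0 < v" "v \<le> h"
  shows "(\<integral>\<^sup>+ x. ennreal (exp ((norm (x :: real ^ 'm))\<^sup>2 / (4 * h))) \<partial>gauss_measure v) \<le> ennreal (sqrt 2 ^ CARD('m))"
proof -
  have h: "0 < h" using assms by simp
  have g: "1 / 2 \<le> 1 - v / (2 * h)" using assms h by (simp add: field_simps)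
  have "(\<integral>\<^sup>+ x. ennreal (exp ((norm (x :: real ^ 'm))\<^sup>2 / (4 * h))) \<partial>gauss_measure v) =
      ennreal ((1 / sqrt (1 - v / (2 * h))) ^ CARD('m))"
    using nn_integral_gauss_measure_exp[of v "- 1 / (4 * h)" "0 :: real ^ 'm"] assms g by simp
  also have "\<dots> \<le> ennreal (sqrt 2 ^ CARD('m))"
  proof (intro ennreal_leI power_mono)
    have "1 / sqrt (1 - v / (2 * h)) \<le> 1 / sqrt (1 / 2)"
      using g by (intro divide_left_mono mult_pos_pos real_sqrt_le_mono) auto
    then show "1 / sqrt (1 - v / (2 * h)) \<le> sqrt 2" by (simp add: real_sqrt_divide)
  qed (use g in auto)
  finally show ?thesis .
qed

text \<open>Exponential Chebyshev inequality at the rate \<open>1 / (4 * h)\<close>.\<close>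

lemma gauss_measure_tail:
  fixes h :: real
  assumes v: "0 < v" "v \<le> h" and r: "0 \<le> r"
  shows "emeasure (gauss_measure v) {x :: real ^ 'm. r \<le> norm x} \<le> ennreal (sqrt 2 ^ CARD('m) * exp (- r\<^sup>2 / (4 * h)))"
proof -
  have h: "0 < h" using v by simp
  have "emeasure (gauss_measure v) {x :: real ^ 'm. r \<le> norm x} =
      (\<integral>\<^sup>+ x. indicator {x :: real ^ 'm. r \<le> norm x} x \<partial>gauss_measure v)"
    by (subst nn_integral_indicator) auto
  also have "\<dots> \<le> (\<integral>\<^sup>+ x. ennreal (exp (- r\<^sup>2 / (4 * h))) * ennreal (exp ((norm (x :: real ^ 'm))\<^sup>2 / (4 * h))) \<partial>gauss_measure v)"
  proof (intro nn_integral_mono)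
    fix x :: "real ^ 'm"
    show "(indicator {x. r \<le> norm x} x :: ennreal) \<le> ennreal (exp (- r\<^sup>2 / (4 * h))) * ennreal (exp ((norm x)\<^sup>2 / (4 * h)))"
      using h r by (auto simp: indicator_def ennreal_mult [symmetric] mult_exp_exp field_simps power_mono
          simp flip: ennreal_1 intro!: ennreal_leI)
  qed
  also have "\<dots> = ennreal (exp (- r\<^sup>2 / (4 * h))) * (\<integral>\<^sup>+ x. ennreal (exp ((norm (x :: real ^ 'm))\<^sup>2 / (4 * h))) \<partial>gauss_measure v)"
    by (rule nn_integral_cmult) auto
  also have "\<dots> \<le> ennreal (exp (- r\<^sup>2 / (4 * h))) * ennreal (sqrt 2 ^ CARD('m))"
    by (intro mult_left_mono nn_integral_gauss_measure_exp_sq v) auto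
  finally show ?thesis by (simp add: ennreal_mult [symmetric] mult.commute)
qed

section \<open>Avoiding a ball that shrinks in time\<close>

text \<open>By \<open>nn_integral_gauss_measure_exp\<close> the right-hand side is the Gaussian mean
  of the exponential after a step from \<open>z\<close> to \<open>a *\<^sub>R z + x\<close>. In
  continuous time, half the Laplacian of \<open>exp (- lam * r\<^sup>2)\<close> is \<open>(2 *
  lam\<^sup>2 * r\<^sup>2 - lam * m) * exp (- lam * r\<^sup>2)\<close> in dimension m. Away from the
  centre, a large \<open>lam\<close> thus makes the quadratic gain beat the losses linear in
  \<open>lam\<close>: \<open>L\<close> from the shrinking radius, the dimension from the Laplacian,
  \<open>2 * S * D + D\<close> from the drift. By \<open>cond\<close> the losses use up at most half
  of the gain; the other half is the surplus on the left-hand side.\<close>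

lemma avoid_exp_step:
  fixes y z :: "real ^ 'm" and R L D S lam h v a t :: real
  assumes lam: "0 < lam" and R: "0 < R" and D: "0 \<le> D"
    and h: "0 < h" "lam * h \<le> 1" "D * h \<le> R / 8" "D * h \<le> 1"
    and v: "h / 2 \<le> v" "v \<le> h"
    and drift: "norm ((a - 1) *\<^sub>R z) \<le> D * h"
    and z: "R\<^sup>2 / 2 \<le> (norm (z - y))\<^sup>2" "norm (z - y) \<le> S"
    and cond: "L + CARD('m) + 2 * S * D + D \<le> lam * R\<^sup>2 / 16"
  shows "exp (- lam * ((norm (z - y))\<^sup>2 - R\<^sup>2 + t)) * (1 + lam\<^sup>2 * R\<^sup>2 * h / 16) \<le>
    exp (- lam * (t + L * h - R\<^sup>2)) * ((1 / sqrt (1 + 2 * lam * v)) ^ CARD('m) *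
      exp (- lam * (norm (a *\<^sub>R z - y))\<^sup>2 / (1 + 2 * lam * v)))"
proof -
  define r e where "r = norm (z - y)" and "e = norm (a *\<^sub>R z - y)"
  have az: "a *\<^sub>R z - y = (z - y) + (a - 1) *\<^sub>R z"
    by (simp add: algebra_simps)
  have e1: "e \<le> r + D * h" and e2: "r - D * h \<le> e"
    using norm_triangle_ineq[of "z - y" "(a - 1) *\<^sub>R z"] norm_diff_ineq[of "z - y" "(a - 1) *\<^sub>R z"] drift
    by (auto simp: e_def r_def az)
  have rp: "0 \<le> r" "0 \<le> e" by (auto simp: r_def e_def)
  have Dh: "0 \<le> D * h" using D h by simp
  have rR: "R / 2 \<le> r"
  proof (rule power2_le_imp_le)
    have "(R / 2)\<^sup>2 \<le> R\<^sup>2 / 2" by (simp add: power_divide)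
    then show "(R / 2)\<^sup>2 \<le> r\<^sup>2" using z(1) by (simp add: r_def)
  qed (use rp in auto)
  have up: "e\<^sup>2 \<le> r\<^sup>2 + (2 * S * D + D) * h"
  proof -
    have "e\<^sup>2 \<le> (r + D * h)\<^sup>2" using e1 rp by (intro power_mono) auto
    also have "\<dots> = r\<^sup>2 + 2 * r * (D * h) + (D * h) * (D * h)" by (simp add: power2_eq_square algebra_simps)
    also have "\<dots> \<le> r\<^sup>2 + 2 * S * (D * h) + (D * h) * 1"
      using z(2) Dh h(4) by (intro add_mono mult_right_mono mult_left_mono) (auto simp: r_def)
    finally show ?thesis by (simp add: algebra_simps)
  qed
  \<comment> \<open>The gain is proportional to \<open>e\<^sup>2\<close>, so the drifted point must
    stay away from the centre of the ball; \<open>D * h \<le> R / 8\<close> ensures this.\<close>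
  have lo: "R\<^sup>2 / 4 \<le> e\<^sup>2"
  proof -
    have "r * (R / 4) \<le> r * (r / 2)" using rR rp by (intro mult_left_mono) auto
    moreover have "2 * r * (D * h) \<le> 2 * r * (R / 8)" using h(3) rp by (intro mult_left_mono) auto
    ultimately have "r\<^sup>2 / 2 \<le> r\<^sup>2 - 2 * r * (D * h)" by (simp add: power2_eq_square)
    also have "\<dots> \<le> (r - D * h)\<^sup>2" by (simp add: power2_diff)
    also have "\<dots> \<le> e\<^sup>2" using e2 rR h(3) R by (intro power_mono) auto
    finally show ?thesis using z(1) by (simp add: r_def)
  qed
  have lv: "0 < 1 + 2 * lam * v" "0 \<le> v" using lam h v by (auto intro!: add_pos_nonneg)
  have frac: "h / 4 \<le> v / (1 + 2 * lam * v)"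
  proof -
    have "h * lam * v \<le> 1 * v" using h lv by (intro mult_right_mono) (auto simp: mult.commute)
    then have "h * (1 + 2 * lam * v) \<le> 4 * v" using v by (simp add: algebra_simps)
    then show ?thesis using lv by (simp add: field_simps)
  qed
  have main: "- lam * (r\<^sup>2 - R\<^sup>2 + t) + lam\<^sup>2 * R\<^sup>2 * h / 16 \<le>
      - lam * (t + L * h - R\<^sup>2) - CARD('m) * (lam * v) - lam * e\<^sup>2 / (1 + 2 * lam * v)"
  proof -
    have "lam * e\<^sup>2 / (1 + 2 * lam * v) = lam * e\<^sup>2 - 2 * lam\<^sup>2 * e\<^sup>2 * (v / (1 + 2 * lam * v))"
      using lv(1) by (simp add: field_simps power2_eq_square)
    also have "\<dots> \<le> lam * e\<^sup>2 - 2 * lam\<^sup>2 * (R\<^sup>2 / 4) * (h / 4)"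
      using lo frac lam h by (intro diff_left_mono mult_mono mult_left_mono) auto
    also have "\<dots> \<le> lam * (r\<^sup>2 + (2 * S * D + D) * h) - lam\<^sup>2 * R\<^sup>2 * h / 8"
      using mult_left_mono[OF up, of lam] lam by (simp add: mult.commute)
    finally have A: "lam * e\<^sup>2 / (1 + 2 * lam * v) \<le> lam * (r\<^sup>2 + (2 * S * D + D) * h) - lam\<^sup>2 * R\<^sup>2 * h / 8" .
    have B: "real CARD('m) * (lam * v) \<le> real CARD('m) * (lam * h)"
      using v lam by (intro mult_left_mono) auto
    have "lam * h * (L + CARD('m) + 2 * S * D + D) \<le> lam * h * (lam * R\<^sup>2 / 16)"
      using cond lam h by (intro mult_left_mono) auto
    then have "lam * (L * h) + real CARD('m) * (lam * h) + lam * ((2 * S * D + D) * h) \<le> lam\<^sup>2 * R\<^sup>2 * h / 16"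
      by (simp add: algebra_simps power2_eq_square)
    with A B show ?thesis by (simp add: algebra_simps)
  qed
  have card: "exp (- (CARD('m) * (lam * v))) \<le> (1 / sqrt (1 + 2 * lam * v)) ^ CARD('m)"
  proof -
    have "sqrt (1 + 2 * lam * v) \<le> sqrt ((exp (lam * v))\<^sup>2)"
      using exp_ge_add_one_self[of "2 * lam * v"]
      by (intro real_sqrt_le_mono) (simp add: power2_eq_square mult_exp_exp mult.assoc)
    then have "sqrt (1 + 2 * lam * v) \<le> exp (lam * v)" by simp
    then have "exp (- (lam * v)) \<le> 1 / sqrt (1 + 2 * lam * v)"
      using lv by (simp add: exp_minus field_simps)
    then have "exp (- (lam * v)) ^ CARD('m) \<le> (1 / sqrt (1 + 2 * lam * v)) ^ CARD('m)"
      by (intro power_mono) auto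
    then show ?thesis by (simp add: exp_of_nat_mult [symmetric])
  qed
  have "exp (- lam * (r\<^sup>2 - R\<^sup>2 + t)) * (1 + lam\<^sup>2 * R\<^sup>2 * h / 16)
      \<le> exp (- lam * (r\<^sup>2 - R\<^sup>2 + t)) * exp (lam\<^sup>2 * R\<^sup>2 * h / 16)"
    using exp_ge_add_one_self[of "lam\<^sup>2 * R\<^sup>2 * h / 16"] by (intro mult_left_mono) auto
  also have "\<dots> \<le> exp (- lam * (t + L * h - R\<^sup>2) - CARD('m) * (lam * v) - lam * e\<^sup>2 / (1 + 2 * lam * v))"
    using main by (simp add: mult_exp_exp)
  also have "\<dots> = exp (- lam * (t + L * h - R\<^sup>2)) * (exp (- (CARD('m) * (lam * v))) * exp (- lam * e\<^sup>2 / (1 + 2 * lam * v)))"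
    by (simp add: mult_exp_exp algebra_simps)
  also have "\<dots> \<le> exp (- lam * (t + L * h - R\<^sup>2)) * ((1 / sqrt (1 + 2 * lam * v)) ^ CARD('m) * exp (- lam * e\<^sup>2 / (1 + 2 * lam * v)))"
    using card by (intro mult_left_mono mult_right_mono) auto
  finally show ?thesis by (simp add: r_def e_def)
qed

text \<open>The barrier behind the avoidance estimate is
  \<^term>\<open>2 * (1 - exp (- lam * w)) + 2 * (exp (lam * eta) - 1) + j * h / s\<close> with
  \<^term>\<open>w = (norm (z - y))\<^sup>2 - R\<^sup>2 + L * (j * h)\<close>: it is a supersolution for the killed chain,
  and \<^term>\<open>eta\<close> absorbs the overshoot of a Gaussian step into the ball.\<close>
lemma avoid_bound:
  fixes R L D lam s eta :: real
  assumes R: "0 < R" and L: "0 \<le> L" and D: "0 \<le> D" and lam: "0 < lam" and s: "0 < s" and eta: "0 < eta"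
    and cond: "L + CARD('m) + 2 * sqrt (R\<^sup>2 + 1 / lam) * D + D \<le> lam * R\<^sup>2 / 16"
    and conds: "1 / s \<le> lam\<^sup>2 * R\<^sup>2 / 48"
  obtains h0 where "0 < h0"
    "\<And>h n a v p (y :: real ^ 'm) x. 0 < h \<Longrightarrow> h < h0 \<Longrightarrow> s \<le> real n * h \<Longrightarrow> 2 * L * (real n * h) \<le> R\<^sup>2 \<Longrightarrow>
      (\<And>j. j < n \<Longrightarrow> h / 2 \<le> v j \<and> v j \<le> h) \<Longrightarrow>
      (\<And>j z. j < n \<Longrightarrow> (norm (z - y))\<^sup>2 \<le> R\<^sup>2 + 1 / lam \<Longrightarrow> norm ((a j - 1) *\<^sub>R z) \<le> D * h) \<Longrightarrow>
      (\<And>j. j \<le> n \<Longrightarrow> p j \<in> borel_measurable borel) \<Longrightarrow>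
      (\<And>j z. j \<le> n \<Longrightarrow> p j z \<le> 1) \<Longrightarrow>
      (\<And>j z. j \<le> n \<Longrightarrow> (norm (z - y))\<^sup>2 < R\<^sup>2 - L * (real j * h) \<Longrightarrow> p j z = 0) \<Longrightarrow>
      (\<And>j z. j < n \<Longrightarrow> p j z \<le> (\<integral>\<^sup>+ x. p (Suc j) (a j *\<^sub>R z + x) \<partial>gauss_measure (v j))) \<Longrightarrow>
      p 0 x \<le> ennreal (2 * lam * max 0 ((norm (x - y))\<^sup>2 - R\<^sup>2) + 2 * (exp (lam * eta) - 1))"
proof -
  define S where "S = sqrt (R\<^sup>2 + 1 / lam)"
  \<comment> \<open>An increment shorter than \<open>e'\<close> lowers the barrier variable
    \<open>w\<close> by less than \<open>eta / 2\<close>, and the drift lowers it by at most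
    \<open>eta / 2\<close>; hence only increments of norm at least \<open>e'\<close> overshoot
    beyond \<open>- eta\<close>. Their probability carries the exponent \<open>- c / h\<close>, and
    \<open>K\<close> collects its prefactor and the largest value of the exponential inside the
    ball. The five entries of \<open>h0\<close> are the two drift conditions and the rate condition
    of \<open>avoid_exp_step\<close>, the drift share of \<open>eta\<close>, and the smallness of
    the tail relative to \<open>h\<close>.\<close>
  define e' where "e' = eta / (4 * (S + 1))"
  define c where "c = e'\<^sup>2 / 4"
  define K where "K = 2 * exp (lam * R\<^sup>2) * sqrt 2 ^ CARD('m)"
  define h0 where "h0 = Min {1 / lam, R / (8 * (D + 1)), 1 / (D + 1), eta / (4 * (S + 1) * (D + 1)), lam\<^sup>2 * R\<^sup>2 * c\<^sup>2 / (96 * K)}"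
  have S: "0 \<le> S" "S\<^sup>2 = R\<^sup>2 + 1 / lam" using lam by (auto simp: S_def)
  have e': "0 < e'" using eta S by (simp add: e'_def)
  have c: "0 < c" using e' by (simp add: c_def)
  have K: "0 < K" by (simp add: K_def)
  have h0: "0 < h0" using lam R D eta S c K by (simp add: h0_def)
  show thesis
  proof (rule that[OF h0])
    fix h :: real and n :: nat and a v :: "nat \<Rightarrow> real" and p :: "nat \<Rightarrow> real ^ 'm \<Rightarrow> ennreal" and y x :: "real ^ 'm"
    assume h: "0 < h" "h < h0" and n: "s \<le> real n * h" "2 * L * (real n * h) \<le> R\<^sup>2"
      and v: "\<And>j. j < n \<Longrightarrow> h / 2 \<le> v j \<and> v j \<le> h"
      and drift: "\<And>j z. j < n \<Longrightarrow> (norm (z - y))\<^sup>2 \<le> R\<^sup>2 + 1 / lam \<Longrightarrow> norm ((a j - 1) *\<^sub>R z) \<le> D * h"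
      and meas: "\<And>j. j \<le> n \<Longrightarrow> p j \<in> borel_measurable borel"
      and p1: "\<And>j z. j \<le> n \<Longrightarrow> p j z \<le> 1"
      and p0: "\<And>j z. j \<le> n \<Longrightarrow> (norm (z - y))\<^sup>2 < R\<^sup>2 - L * (real j * h) \<Longrightarrow> p j z = 0"
      and step: "\<And>j z. j < n \<Longrightarrow> p j z \<le> (\<integral>\<^sup>+ x. p (Suc j) (a j *\<^sub>R z + x) \<partial>gauss_measure (v j))"
    have "h < 1 / lam" "h < R / (8 * (D + 1))" "h < 1 / (D + 1)" "h < eta / (4 * (S + 1) * (D + 1))"
      "h < lam\<^sup>2 * R\<^sup>2 * c\<^sup>2 / (96 * K)"
      using h(2) by (simp_all add: h0_def)
    moreover have "4 * (S + 1) * (D + 1) > 0" using S D by simp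
    ultimately have "lam * h \<le> 1" "(D + 1) * h \<le> R / 8" "(D + 1) * h \<le> 1" and Sh: "(S + 1) * ((D + 1) * h) \<le> eta / 4"
      and hK: "K * h \<le> lam\<^sup>2 * R\<^sup>2 * c\<^sup>2 / 96"
      using lam D K by (simp_all add: pos_less_divide_eq algebra_simps)
    then have hh: "lam * h \<le> 1" "D * h \<le> R / 8" "D * h \<le> 1"
      using h(1) by (auto simp: distrib_right)
    have Sh': "2 * S * (D * h) \<le> eta / 2"
    proof -
      have "S * (D * h) \<le> (S + 1) * ((D + 1) * h)" using S D h by (intro mult_mono) auto
      then show ?thesis using Sh by simp
    qed
    define q where "q = sqrt 2 ^ CARD('m) * exp (- e'\<^sup>2 / (4 * h))"
    have q0: "0 \<le> q" by (simp add: q_def)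
    have small: "2 * exp (lam * R\<^sup>2) * q \<le> lam\<^sup>2 * R\<^sup>2 * h / 48"
    proof -
      have "(c / h)\<^sup>2 / 2 \<le> exp (c / h)"
        using exp_lower_Taylor_quadratic[of "c / h"] c h divide_pos_pos[of c h] by linarith
      then have "exp (- (c / h)) \<le> 2 * h\<^sup>2 / c\<^sup>2"
        using c h by (simp add: exp_minus field_simps)
      then have "K * exp (- (c / h)) \<le> K * (2 * h\<^sup>2 / c\<^sup>2)" using K by (intro mult_left_mono) auto
      also have "\<dots> = (K * h) * (2 * h / c\<^sup>2)" by (simp add: power2_eq_square)
      also have "\<dots> \<le> (lam\<^sup>2 * R\<^sup>2 * c\<^sup>2 / 96) * (2 * h / c\<^sup>2)" using hK h by (intro mult_right_mono) auto
      also have "\<dots> = lam\<^sup>2 * R\<^sup>2 * h / 48" using c by simp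
      finally show ?thesis by (simp add: K_def q_def c_def)
    qed
    define w where "w j z = (norm (z - y))\<^sup>2 - R\<^sup>2 + L * (real j * h)" for j :: nat and z :: "real ^ 'm"
    \<comment> \<open>The linear time term is what lifts the barrier above 1 at the terminal index,
      where \<open>real n * h / s\<close> is at least 1. It vanishes at index 0, where the bound is
      read off, and costs \<open>h / s\<close> per step.\<close>
    define C where "C j = 2 + 2 * (exp (lam * eta) - 1) + real j * h / s" for j :: nat
    have e1: "1 \<le> exp (lam * eta)" using lam eta by simp
    have C: "2 \<le> C j" "2 * exp (lam * eta) \<le> C j" for j
    proof -
      have "0 \<le> real j * h / s" using h s by simp
      moreover have "C j = 2 * exp (lam * eta) + real j * h / s" by (simp add: C_def)
      ultimately show "2 * exp (lam * eta) \<le> C j" and "2 \<le> C j" using e1 by linarith+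
    qed
    have bound: "0 \<le> w j z \<Longrightarrow> p j z \<le> ennreal (C j - 2 * exp (- lam * w j z))" if "j \<le> n" for j z
      using that
    proof (induction j arbitrary: z rule: inc_induct)
      case base
      have "1 \<le> real n * h / s" using n s by (simp add: field_simps)
      moreover have "exp (- lam * w n z) \<le> 1" using base lam by simp
      moreover have "C n = 2 * exp (lam * eta) + real n * h / s" by (simp add: C_def)
      ultimately have "1 \<le> C n - 2 * exp (- lam * w n z)" using e1 by linarith
      then have "(1::ennreal) \<le> ennreal (C n - 2 * exp (- lam * w n z))"
        by (simp flip: ennreal_1 del: ennreal_1 add: ennreal_leI)
      then show ?case by (rule order_trans[OF p1[OF order_refl]])
    next
      case (step j)
      show ?case
      \<comment> \<open>Far from the ball the barrier already exceeds 1, because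
        \<open>2 * exp (- 1) \<le> 1\<close>. In the remaining shell
        \<open>exp (- lam * w j z)\<close> is at least \<open>exp (- 1)\<close>, which makes the
        surplus of the one-step inequality uniform.\<close>
      proof (cases "1 / lam < w j z")
        case True
        then have "1 \<le> lam * w j z" using lam by (simp add: field_simps)
        then have "exp (- lam * w j z) \<le> exp (- 1)" by simp
        also have "\<dots> \<le> 1 / 2" using exp_ge_add_one_self[of 1] by (simp add: exp_minus field_simps)
        finally have "1 \<le> C j - 2 * exp (- lam * w j z)" using C(1)[of j] by linarith
        then have "(1::ennreal) \<le> ennreal (C j - 2 * exp (- lam * w j z))"
          by (simp flip: ennreal_1 del: ennreal_1 add: ennreal_leI)
        then show ?thesis by (rule order_trans[OF p1[OF less_imp_le[OF \<open>j < n\<close>]]])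
      next
        case False
        note j = \<open>j < n\<close>
        define r where "r = norm (z - y)"
        have jL: "0 \<le> L * (real j * h)" "2 * (L * (real j * h)) \<le> R\<^sup>2"
        proof -
          have "L * (real j * h) \<le> L * (real n * h)" using j L h by (intro mult_left_mono mult_right_mono) auto
          then show "2 * (L * (real j * h)) \<le> R\<^sup>2" using n(2) by simp
        qed (use L h in auto)
        have r2: "r\<^sup>2 \<le> R\<^sup>2 + 1 / lam" "R\<^sup>2 / 2 \<le> r\<^sup>2"
          using False step.prems jL by (auto simp: w_def r_def)
        have rS: "r \<le> S" unfolding S_def using r2(1) by (rule real_le_rsqrt)
        have dr: "norm ((a j - 1) *\<^sub>R z) \<le> D * h" using drift j r2(1) by (auto simp: r_def)
        define g where "g = (1 / sqrt (1 + 2 * lam * v j)) ^ CARD('m) * exp (- lam * (norm (a j *\<^sub>R z - y))\<^sup>2 / (1 + 2 * lam * v j))"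
        have vj: "h / 2 \<le> v j" "v j \<le> h" "0 < v j" using v[OF j] h by auto
        interpret G: prob_space "gauss_measure (v j) :: (real ^ 'm) measure"
          by (rule prob_space_gauss_measure[OF vj(3)])
        have key: "exp (- lam * w j z) * (1 + lam\<^sup>2 * R\<^sup>2 * h / 16) \<le> exp (- lam * (L * (real (Suc j) * h) - R\<^sup>2)) * g"
          using avoid_exp_step[OF lam R D h(1) hh vj(1,2) dr, of y S L "L * (real j * h)"] r2 rS cond
          by (simp add: g_def w_def r_def S_def algebra_simps)
        \<comment> \<open>With \<open>exp (- 1) \<ge> 1 / 3\<close> the surplus is at least
          \<open>lam\<^sup>2 * R\<^sup>2 * h / 48\<close>. The barrier contains the exponential
          twice, so there are two such shares: one pays for the time term by \<open>conds\<close>,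
          the other for the overshoot tail by \<open>small\<close>.\<close>
        have ge: "exp (- lam * w j z) + lam\<^sup>2 * R\<^sup>2 * h / 48 \<le> exp (- lam * (L * (real (Suc j) * h) - R\<^sup>2)) * g"
        proof -
          have "lam * w j z \<le> 1" using False lam by (simp add: field_simps)
          then have "exp (- 1) \<le> exp (- lam * w j z)" by simp
          moreover have "1 / 3 \<le> exp (- 1 :: real)" using exp_le by (simp add: exp_minus field_simps)
          ultimately have "1 / 3 \<le> exp (- lam * w j z)" by linarith
          then have "1 / 3 * (lam\<^sup>2 * R\<^sup>2 * h / 16) \<le> exp (- lam * w j z) * (lam\<^sup>2 * R\<^sup>2 * h / 16)"
            by (rule mult_right_mono) (use h in auto)
          then show ?thesis using key by (simp add: algebra_simps)
        qed
        have "0 \<le> g" using vj lam by (simp add: g_def)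
        let ?z = "\<lambda>x. a j *\<^sub>R z + x"
        let ?B = "{x :: real ^ 'm. e' \<le> norm x}"
        \<comment> \<open>The exponential is added on the left to avoid truncated subtraction in
          \<open>ennreal\<close>. Outside the ball the induction hypothesis applies; for an
          overshoot of at most \<open>eta\<close> the walk is killed and
          \<open>2 * exp (lam * eta) \<le> C (Suc j)\<close>; a deeper overshoot needs a long
          increment and is charged to the indicator.\<close>
        have pw: "p (Suc j) (?z x) + ennreal (2 * exp (- lam * w (Suc j) (?z x)))
            \<le> ennreal (C (Suc j)) + ennreal (2 * exp (lam * R\<^sup>2)) * indicator ?B x" for x
        proof (cases "0 \<le> w (Suc j) (?z x)")
          case True
          then have le1: "exp (- lam * w (Suc j) (?z x)) \<le> 1" using lam by simp
          have "p (Suc j) (?z x) + ennreal (2 * exp (- lam * w (Suc j) (?z x))) \<le>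
             ennreal (C (Suc j) - 2 * exp (- lam * w (Suc j) (?z x))) + ennreal (2 * exp (- lam * w (Suc j) (?z x)))"
            using step.IH[OF True] by (intro add_right_mono)
          also have "2 * exp (- lam * w (Suc j) (?z x)) \<le> C (Suc j)" using le1 C(1)[of "Suc j"] by linarith
          then have "ennreal (C (Suc j) - 2 * exp (- lam * w (Suc j) (?z x))) + ennreal (2 * exp (- lam * w (Suc j) (?z x))) = ennreal (C (Suc j))"
            by (subst ennreal_plus [symmetric]) auto
          finally show ?thesis by (simp add: add_increasing2)
        next
          case False
          then have "p (Suc j) (?z x) = 0" using j by (intro p0) (auto simp: w_def)
          moreover have "ennreal (2 * exp (- lam * w (Suc j) (?z x))) \<le> ennreal (C (Suc j)) + ennreal (2 * exp (lam * R\<^sup>2)) * indicator ?B x"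
          proof (cases "w (Suc j) (?z x) < - eta")
            case True
            have "w j z - 2 * S * (D * h) - 2 * (S + 1) * norm x \<le> w (Suc j) (?z x)"
            proof -
              let ?e = "a j *\<^sub>R z - y"
              have e: "?e = (z - y) + (a j - 1) *\<^sub>R z" by (simp add: algebra_simps)
              have n1: "norm ?e \<le> S + 1"
                using norm_triangle_ineq[of "z - y" "(a j - 1) *\<^sub>R z"] dr rS hh unfolding e r_def by linarith
              have n2: "r - D * h \<le> norm ?e"
                using norm_diff_ineq[of "z - y" "(a j - 1) *\<^sub>R z"] dr unfolding e r_def by linarith
              have n3: "r\<^sup>2 - 2 * S * (D * h) \<le> (norm ?e)\<^sup>2"
              proof (cases "0 \<le> r - D * h")
                case True
                have "r * (D * h) \<le> S * (D * h)" using rS D h by (intro mult_right_mono) auto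
                then have "r\<^sup>2 - 2 * S * (D * h) \<le> r\<^sup>2 - 2 * r * (D * h) + (D * h)\<^sup>2"
                  using zero_le_power2[of "D * h"] by linarith
                also have "\<dots> = (r - D * h)\<^sup>2" by (simp add: power2_diff)
                also have "\<dots> \<le> (norm ?e)\<^sup>2" using n2 True by (intro power_mono)
                finally show ?thesis .
              next
                case False
                then have "r * r \<le> S * (D * h)" using rS by (intro mult_mono) (auto simp: r_def S)
                moreover have "0 \<le> S * (D * h)" using S D h by auto
                ultimately have "r\<^sup>2 - 2 * S * (D * h) \<le> 0" unfolding power2_eq_square by linarith
                also have "0 \<le> (norm ?e)\<^sup>2" by simp
                finally show ?thesis .
              qed
              have "(norm (?z x - y))\<^sup>2 = (norm (?e + x))\<^sup>2" by (simp add: algebra_simps)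
              also have "\<dots> = (norm ?e)\<^sup>2 + 2 * (?e \<bullet> x) + (norm x)\<^sup>2"
                by (simp add: power2_norm_eq_inner inner_add_left inner_add_right inner_commute)
              also have "\<dots> \<ge> (norm ?e)\<^sup>2 - 2 * ((S + 1) * norm x)"
              proof -
                have "- (?e \<bullet> x) \<le> norm ?e * norm x" using Cauchy_Schwarz_ineq2[of ?e x] by linarith
                also have "\<dots> \<le> (S + 1) * norm x" using n1 by (intro mult_right_mono) auto
                finally show ?thesis using zero_le_power2[of "norm x"] by linarith
              qed
              finally have "(norm ?e)\<^sup>2 - 2 * ((S + 1) * norm x) \<le> (norm (?z x - y))\<^sup>2" .
              moreover have "L * (real j * h) \<le> L * (real (Suc j) * h)" using L h by (intro mult_left_mono) auto
              ultimately show ?thesis using n3 unfolding w_def r_def mult.assoc by linarith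
            qed
            then have "eta / 2 \<le> 2 * (S + 1) * norm x" using True Sh' step.prems by linarith
            then have "x \<in> ?B" using S by (simp add: e'_def field_simps)
            have "0 \<le> L * (real (Suc j) * h)" using L h by simp
            then have "- w (Suc j) (?z x) \<le> R\<^sup>2" using zero_le_power2[of "norm (?z x - y)"] unfolding w_def by linarith
            then have "lam * (- w (Suc j) (?z x)) \<le> lam * R\<^sup>2" by (rule mult_left_mono) (use lam in simp)
            then have "- lam * w (Suc j) (?z x) \<le> lam * R\<^sup>2" by (simp only: mult_minus_left mult_minus_right)
            then have "ennreal (2 * exp (- lam * w (Suc j) (?z x))) \<le> ennreal (2 * exp (lam * R\<^sup>2))"
              by (intro ennreal_leI mult_left_mono iffD2[OF exp_le_cancel_iff]) simp_all
            also have "\<dots> = ennreal (2 * exp (lam * R\<^sup>2)) * indicator ?B x"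
              using \<open>x \<in> ?B\<close> by simp
            also have "\<dots> \<le> ennreal (C (Suc j)) + ennreal (2 * exp (lam * R\<^sup>2)) * indicator ?B x"
              by (rule add_increasing) simp_all
            finally show ?thesis .
          next
            case nlt: False
            then have "- w (Suc j) (?z x) \<le> eta" by simp
            then have "lam * (- w (Suc j) (?z x)) \<le> lam * eta" by (rule mult_left_mono) (use lam in simp)
            then have "- lam * w (Suc j) (?z x) \<le> lam * eta" by (simp only: mult_minus_left mult_minus_right)
            then have "2 * exp (- lam * w (Suc j) (?z x)) \<le> 2 * exp (lam * eta)"
              by (intro mult_left_mono iffD2[OF exp_le_cancel_iff]) simp_all
            also have "\<dots> \<le> C (Suc j)" by (rule C)
            finally show ?thesis by (rule add_increasing2[OF zero_le ennreal_leI])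
          qed
          ultimately show ?thesis by simp
        qed
        have mp [measurable]: "p (Suc j) \<in> borel_measurable borel" using meas j by simp
        have mw [measurable]: "w (Suc j) \<in> borel_measurable borel" unfolding w_def by measurable
        have mB [measurable]: "?B \<in> sets borel" by measurable
        have "(\<integral>\<^sup>+ x. p (Suc j) (?z x) \<partial>gauss_measure (v j)) + (\<integral>\<^sup>+ x. ennreal (2 * exp (- lam * w (Suc j) (?z x))) \<partial>gauss_measure (v j))
            = (\<integral>\<^sup>+ x. p (Suc j) (?z x) + ennreal (2 * exp (- lam * w (Suc j) (?z x))) \<partial>gauss_measure (v j))"
          by (intro nn_integral_add [symmetric]) measurable
        also have "\<dots> \<le> (\<integral>\<^sup>+ x. ennreal (C (Suc j)) + ennreal (2 * exp (lam * R\<^sup>2)) * indicator ?B x \<partial>gauss_measure (v j))"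
          by (intro nn_integral_mono pw)
        also have "\<dots> = ennreal (C (Suc j)) + ennreal (2 * exp (lam * R\<^sup>2)) * emeasure (gauss_measure (v j)) ?B"
          using G.emeasure_space_1 by (subst nn_integral_add) (auto simp: nn_integral_cmult)
        also have "\<dots> \<le> ennreal (C (Suc j)) + ennreal (2 * exp (lam * R\<^sup>2)) * ennreal q"
          using gauss_measure_tail[OF vj(3,2), of e', where 'm = 'm] e' unfolding q_def
          by (intro add_left_mono mult_left_mono) auto
        also have "\<dots> = ennreal (C (Suc j) + 2 * exp (lam * R\<^sup>2) * q)"
          using C(1)[of "Suc j"] q0 by (simp add: ennreal_mult [symmetric])
        finally have sum: "(\<integral>\<^sup>+ x. p (Suc j) (?z x) \<partial>gauss_measure (v j)) + (\<integral>\<^sup>+ x. ennreal (2 * exp (- lam * w (Suc j) (?z x))) \<partial>gauss_measure (v j))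
          \<le> ennreal (C (Suc j) + 2 * exp (lam * R\<^sup>2) * q)" .
        have "(\<integral>\<^sup>+ x. ennreal (2 * exp (- lam * w (Suc j) (?z x))) \<partial>gauss_measure (v j))
            = (\<integral>\<^sup>+ x. ennreal (2 * exp (- lam * (L * (real (Suc j) * h) - R\<^sup>2))) * ennreal (exp (- lam * (norm ((a j *\<^sub>R z - y) + x))\<^sup>2)) \<partial>gauss_measure (v j))"
          by (intro nn_integral_cong) (simp add: w_def ennreal_mult [symmetric] mult_exp_exp algebra_simps del: of_nat_Suc)
        also have "\<dots> = ennreal (2 * exp (- lam * (L * (real (Suc j) * h) - R\<^sup>2))) * ennreal g"
          using lam vj unfolding g_def
          by (subst nn_integral_cmult) (auto simp: nn_integral_gauss_measure_exp [simplified] add_pos_pos)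
        also have "\<dots> = ennreal (2 * (exp (- lam * (L * (real (Suc j) * h) - R\<^sup>2)) * g))"
          using \<open>0 \<le> g\<close> by (simp add: ennreal_mult [symmetric] mult.assoc)
        finally have eq: "(\<integral>\<^sup>+ x. ennreal (2 * exp (- lam * w (Suc j) (?z x))) \<partial>gauss_measure (v j)) = ennreal (2 * (exp (- lam * (L * (real (Suc j) * h) - R\<^sup>2)) * g))" .
        let ?E = "2 * (exp (- lam * (L * (real (Suc j) * h) - R\<^sup>2)) * g)"
        have "(\<integral>\<^sup>+ x. p (Suc j) (?z x) \<partial>gauss_measure (v j)) \<le> ennreal (C (Suc j) + 2 * exp (lam * R\<^sup>2) * q) - ennreal ?E"
          using sum unfolding eq by (simp add: ennreal_le_minus_iff add.commute)
        also have "\<dots> = ennreal (C (Suc j) + 2 * exp (lam * R\<^sup>2) * q - ?E)"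
          using \<open>0 \<le> g\<close> by (intro ennreal_minus) auto
        also have "\<dots> \<le> ennreal (C j - 2 * exp (- lam * w j z))"
        proof (intro ennreal_leI)
          have "h * (1 / s) \<le> h * (lam\<^sup>2 * R\<^sup>2 / 48)" using conds h by (intro mult_left_mono) auto
          then have hs: "h / s \<le> lam\<^sup>2 * R\<^sup>2 * h / 48" by (simp add: field_simps)
          have "C (Suc j) = C j + h / s" by (simp add: C_def distrib_right add_divide_distrib)
          then show "C (Suc j) + 2 * exp (lam * R\<^sup>2) * q - ?E \<le> C j - 2 * exp (- lam * w j z)"
            using small hs ge by linarith
        qed
        finally show ?thesis using \<open>\<And>j z. j < n \<Longrightarrow> p j z \<le> _\<close>[OF j, of z] by auto
      qed
    qed
    show "p 0 x \<le> ennreal (2 * lam * max 0 ((norm (x - y))\<^sup>2 - R\<^sup>2) + 2 * (exp (lam * eta) - 1))"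
    proof (cases "0 \<le> w 0 x")
      case True
      have "p 0 x \<le> ennreal (C 0 - 2 * exp (- lam * w 0 x))" using bound[OF _ True] by simp
      also have "\<dots> \<le> ennreal (2 * lam * max 0 ((norm (x - y))\<^sup>2 - R\<^sup>2) + 2 * (exp (lam * eta) - 1))"
      proof (intro ennreal_leI)
        have "1 - lam * w 0 x \<le> exp (- lam * w 0 x)" using exp_ge_add_one_self[of "- lam * w 0 x"] by simp
        then show "C 0 - 2 * exp (- lam * w 0 x) \<le> 2 * lam * max 0 ((norm (x - y))\<^sup>2 - R\<^sup>2) + 2 * (exp (lam * eta) - 1)"
          using True by (simp add: C_def w_def)
      qed
      finally show ?thesis .
    next
      case False
      then have "p 0 x = 0" by (intro p0) (auto simp: w_def)
      then show ?thesis by simp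
    qed
  qed
qed

section \<open>The Markov property and time reversal\<close>

context std_brownian_motion
begin

definition past :: "real \<Rightarrow> 'w measure" where
  "past s = sigma (space M) {W u -` B \<inter> space M | u B. 0 \<le> u \<and> u \<le> s \<and> B \<in> sets borel}"

lemma space_past [simp]: "space (past s) = space M"
  by (simp add: past_def space_measure_of_conv)

lemma sets_past: "sets (past s) = sigma_sets (space M) {W u -` B \<inter> space M | u B. 0 \<le> u \<and> u \<le> s \<and> B \<in> sets borel}"
  unfolding past_def by (rule sets_measure_of) auto

lemma sets_past_subset: "sets (past s) \<subseteq> sets M"
  unfolding sets_past
  by (rule sets.sigma_sets_subset) (auto intro!: measurable_sets[OF W_measurable])

lemma past_mono: "s \<le> t \<Longrightarrow> sets (past s) \<subseteq> sets (past t)"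
  unfolding sets_past by (rule sigma_sets_mono') fastforce

lemma measurable_past_imp_M: "f \<in> measurable (past s) N \<Longrightarrow> f \<in> measurable M N"
  using sets_past_subset[of s] by (auto simp: measurable_def)

lemma W_measurable_past: "0 \<le> u \<Longrightarrow> u \<le> s \<Longrightarrow> W u \<in> measurable (past s) borel"
  by (rule measurableI) (auto simp: sets_past intro!: sigma_sets.Basic)

text \<open>The axiom concerns increments over finitely many times. Finite-dimensional cylinders
  form an intersection-stable generator of the past, and each of them is an event about finitely
  many increments before \<open>s\<close>; the pi-lambda theorem does the rest.\<close>

lemma indep_past_increment:
  assumes s: "0 \<le> s" and h: "0 < h"
  shows "indep_set (sets (past s)) {(\<lambda>\<omega>. W (s + h) \<omega> - W s \<omega>) -` C \<inter> space M | C. C \<in> sets borel}"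
proof -
  define X where "X \<omega> = W (s + h) \<omega> - W s \<omega>" for \<omega>
  define E where "E = {{\<omega> \<in> space M. \<forall>u\<in>U. W u \<omega> \<in> B u} | U B. finite U \<and> U \<subseteq> {0..s} \<and> (\<forall>u\<in>U. B u \<in> sets borel)}"
  define F where "F = {X -` C \<inter> space M | C. C \<in> sets (borel :: (real ^ 'm) measure)}"
  have X_meas: "X \<in> measurable M borel"
    unfolding X_def using W_measurable s h by (intro borel_measurable_diff) auto
  have Em: "A \<in> events" if "A \<in> E" for A
  proof -
    from that obtain U B where A: "A = {\<omega> \<in> space M. \<forall>u\<in>U. W u \<omega> \<in> B u}" and U: "finite U" "U \<subseteq> {0..s}" "\<forall>u\<in>U. B u \<in> sets borel"
      unfolding E_def by auto
    show ?thesis unfolding A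
    proof (rule sets.sets_Collect_finite_All)
      fix u assume "u \<in> U"
      then have "W u -` B u \<inter> space M \<in> events" using U by (intro measurable_sets[OF W_measurable]) auto
      also have "W u -` B u \<inter> space M = {\<omega> \<in> space M. W u \<omega> \<in> B u}" by auto
      finally show "{\<omega> \<in> space M. W u \<omega> \<in> B u} \<in> events" .
    qed (rule U)
  qed
  have "indep_set E F"
  proof (rule indep_setI)
    show "E \<subseteq> events" using Em by auto
    show "F \<subseteq> events" using X_meas by (auto simp: F_def intro: measurable_sets)
    fix A D assume "A \<in> E" "D \<in> F"
    then obtain U B C where A: "A = {\<omega> \<in> space M. \<forall>u\<in>U. W u \<omega> \<in> B u}" and U: "finite U" "U \<subseteq> {0..s}" "\<forall>u\<in>U. B u \<in> sets borel"
      and D: "D = X -` C \<inter> space M" and C: "C \<in> sets borel"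
      unfolding E_def F_def by auto
    \<comment> \<open>With 0 among the times every position is a sum of increments, since the path
      starts at 0; with \<open>s\<close> among them the increment from \<open>s\<close> to
      \<open>s + h\<close> is the last one of the partition.\<close>
    define V where "V = insert 0 (insert s U)"
    define k where "k = card V - 1"
    define xs where "xs = sorted_list_of_set V"
    have V: "finite V" "V \<subseteq> {0..s}" "0 \<in> V" "s \<in> V" using U s by (auto simp: V_def)
    have "0 < card V" using V by (auto simp: card_gt_0_iff)
    then have xs: "set xs = V" "sorted_wrt (<) xs" "length xs = Suc k"
      using V by (auto simp: xs_def k_def)
    define \<tau> where "\<tau> i = (if i \<le> k then xs ! i else s + h)" for i
    have tau_mono: "\<tau> i < \<tau> j" if "i < j" "j \<le> k" for i j
      using that xs sorted_wrt_nth_less[OF xs(2), of i j] by (simp add: \<tau>_def)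
    have tau_in: "i \<le> k \<Longrightarrow> \<tau> i \<in> V" for i using xs by (auto simp: \<tau>_def intro: nth_mem)
    have tau_ex: "\<exists>i\<le>k. \<tau> i = v" if v: "v \<in> V" for v
    proof -
      obtain i where "i < length xs" "xs ! i = v" using v xs(1) by (auto simp: in_set_conv_nth)
      then show ?thesis using xs(3) by (intro exI[of _ i]) (auto simp: \<tau>_def)
    qed
    have tau0: "\<tau> 0 = 0"
    proof -
      obtain i where i: "i \<le> k" "\<tau> i = 0" using tau_ex V by blast
      have "0 \<le> \<tau> 0" using tau_in[of 0] V by auto
      then show ?thesis using tau_mono[of 0 i] i by (cases "i = 0") auto
    qed
    have tauk: "\<tau> k = s"
    proof -
      obtain i where i: "i \<le> k" "\<tau> i = s" using tau_ex V by blast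
      have "\<tau> k \<le> s" using tau_in[of k] V by auto
      then show ?thesis using tau_mono[of i k] i by (cases "i = k") auto
    qed
    have tauS: "\<tau> (Suc k) = s + h" by (simp add: \<tau>_def)
    define I where "I i \<omega> = W (\<tau> (Suc i)) \<omega> - W (\<tau> i) \<omega>" for i \<omega>
    have "indep_vars (\<lambda>_. borel) I {..<Suc k}"
      unfolding I_def
    proof (rule W_indep_increments)
      show "\<tau> i < \<tau> (Suc i)" if "i < Suc k" for i
        using tau_mono[of i "Suc i"] that tauk tauS h by (cases "i = k") auto
    qed (simp add: tau0)
    then have iv: "indep_var (PiM {..<k} (\<lambda>_. borel)) (\<lambda>\<omega>. restrict (\<lambda>i. I i \<omega>) {..<k}) (PiM {k} (\<lambda>_. borel)) (\<lambda>\<omega>. restrict (\<lambda>i. I i \<omega>) {k})"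
      by (rule indep_var_restrict) auto
    have W_sum: "W (\<tau> j) \<omega> = (\<Sum>i<j. I i \<omega>)" if "\<omega> \<in> space M" for j \<omega>
      using W_start[OF that] tau0 sum_lessThan_telescope[of "\<lambda>i. W (\<tau> i) \<omega>" j] by (simp add: I_def)
    have "\<forall>u\<in>U. \<exists>i. i \<le> k \<and> \<tau> i = u" using tau_ex by (auto simp: V_def)
    then obtain g where g: "\<And>u. u \<in> U \<Longrightarrow> g u \<le> k \<and> \<tau> (g u) = u"
      by (auto dest!: bchoice)
    define S where "S = {y \<in> space (PiM {..<k} (\<lambda>_. borel :: (real ^ 'm) measure)). \<forall>u\<in>U. (\<Sum>i<g u. y i) \<in> B u}"
    have S_meas: "S \<in> sets (PiM {..<k} (\<lambda>_. borel))"
      unfolding S_def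
    proof (rule sets.sets_Collect_finite_All)
      fix u assume u: "u \<in> U"
      have "(\<lambda>y. \<Sum>i<g u. y i) \<in> borel_measurable (PiM {..<k} (\<lambda>_. borel :: (real ^ 'm) measure))"
        using g[OF u] by (intro borel_measurable_sum measurable_component_singleton) auto
      from measurable_sets[OF this, of "B u"] show "{y \<in> space (PiM {..<k} (\<lambda>_. borel :: (real ^ 'm) measure)). (\<Sum>i<g u. y i) \<in> B u} \<in> sets (PiM {..<k} (\<lambda>_. borel))"
        using U u by (simp add: vimage_def Int_def conj_commute)
    qed (rule U)
    have AS: "A = (\<lambda>\<omega>. restrict (\<lambda>i. I i \<omega>) {..<k}) -` S \<inter> space M"
    proof -
      have "(\<Sum>i<g u. restrict (\<lambda>i. I i \<omega>) {..<k} i) = W u \<omega>" if "u \<in> U" "\<omega> \<in> space M" for u \<omega>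
        using g[OF that(1)] W_sum[OF that(2), of "g u"] by (auto intro!: sum.cong)
      then show ?thesis by (auto simp: A S_def space_PiM)
    qed
    have DC: "D = (\<lambda>\<omega>. restrict (\<lambda>i. I i \<omega>) {k}) -` {y \<in> space (PiM {k} (\<lambda>_. borel)). y k \<in> C} \<inter> space M"
      by (auto simp: D X_def I_def tauk tauS space_PiM)
    have C': "{y \<in> space (PiM {k} (\<lambda>_. borel)). y k \<in> C} \<in> sets (PiM {k} (\<lambda>_. borel))"
      using C by measurable
    show "prob (A \<inter> D) = prob A * prob D"
      using indep_varD[OF iv S_meas C'] unfolding AS DC
      by (simp add: vimage_def Int_def conj_ac)
  qed
  moreover have "Int_stable E"
  proof (rule Int_stableI)
    fix a b assume "a \<in> E" "b \<in> E"
    then obtain U B U' B' where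
      a: "a = {\<omega> \<in> space M. \<forall>u\<in>U. W u \<omega> \<in> B u}" "finite U" "U \<subseteq> {0..s}" "\<forall>u\<in>U. B u \<in> sets borel" and
      b: "b = {\<omega> \<in> space M. \<forall>u\<in>U'. W u \<omega> \<in> B' u}" "finite U'" "U' \<subseteq> {0..s}" "\<forall>u\<in>U'. B' u \<in> sets borel"
      unfolding E_def by auto
    have "a \<inter> b = {\<omega> \<in> space M. \<forall>u\<in>U \<union> U'. W u \<omega> \<in> (if u \<in> U then B u else UNIV) \<inter> (if u \<in> U' then B' u else UNIV)}"
      unfolding a b by auto
    then show "a \<inter> b \<in> E"
      unfolding E_def using a b
      by (intro CollectI exI[of _ "U \<union> U'"] exI[of _ "\<lambda>u. (if u \<in> U then B u else UNIV) \<inter> (if u \<in> U' then B' u else UNIV)"]) auto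
  qed
  moreover have "Int_stable F"
  proof (rule Int_stableI)
    fix a b assume "a \<in> F" "b \<in> F"
    then obtain A B where "a = X -` A \<inter> space M" "b = X -` B \<inter> space M" "A \<in> sets borel" "B \<in> sets borel"
      by (auto simp: F_def)
    then show "a \<inter> b \<in> F" unfolding F_def by (intro CollectI exI[of _ "A \<inter> B"]) auto
  qed
  ultimately have IS: "indep_set (sigma_sets (space M) E) (sigma_sets (space M) F)"
    by (rule indep_set_sigma_sets)
  have sub: "sets (past s) \<subseteq> sigma_sets (space M) E"
    unfolding sets_past
  proof (rule sigma_sets_mono', safe)
    fix u B assume u: "0 \<le> u" "u \<le> s" and B: "B \<in> sets (borel :: (real ^ 'm) measure)"
    have "W u -` B \<inter> space M = {\<omega> \<in> space M. \<forall>u'\<in>{u}. W u' \<omega> \<in> B}" by auto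
    then show "W u -` B \<inter> space M \<in> E"
      unfolding E_def using u B by (intro CollectI exI[of _ "{u}"] exI[of _ "\<lambda>_. B"]) auto
  qed
  show ?thesis
    using IS unfolding F_def X_def indep_set_def
    by (rule indep_sets_mono_sets) (use sub in \<open>auto split: bool.split\<close>)
qed

lemma distr_increment:
  assumes "0 \<le> s" "0 < h"
  shows "distr M borel (\<lambda>\<omega>. W (s + h) \<omega> - W s \<omega>) = gauss_measure h"
proof -
  have "distr M lborel (\<lambda>\<omega>. W (s + h) \<omega> - W s \<omega>) = density lborel (\<lambda>x. ennreal (gauss_density h x))"
    using W_gaussian_increments[of s "s + h"] assms
    by (simp add: distributed_def gauss_density_def)
  moreover have "distr M lborel (\<lambda>\<omega>. W (s + h) \<omega> - W s \<omega>) = distr M borel (\<lambda>\<omega>. W (s + h) \<omega> - W s \<omega>)"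
    by (rule distr_cong) auto
  ultimately show ?thesis by (simp add: gauss_measure_def)
qed

lemma distr_W:
  assumes "0 < t"
  shows "distr M borel (W t) = gauss_measure t"
proof -
  have "distr M borel (W t) = distr M borel (\<lambda>\<omega>. W (0 + t) \<omega> - W 0 \<omega>)"
    using W_start by (intro distr_cong) auto
  then show ?thesis using distr_increment[of 0 t] assms by simp
qed

text \<open>Independence makes the joint law of \<open>X\<close> and the increment a product
  measure, and Fubini integrates out the increment first. \<open>X\<close> carries whatever has to
  be remembered of the past.\<close>

lemma Markov:
  assumes s: "0 \<le> s" and h: "0 < h" and X: "X \<in> measurable (past s) N"
    and f [measurable]: "f \<in> borel_measurable (N \<Otimes>\<^sub>M borel)"
  shows "(\<integral>\<^sup>+ \<omega>. f (X \<omega>, W (s + h) \<omega> - W s \<omega>) \<partial>M) =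
    (\<integral>\<^sup>+ \<omega>. (\<integral>\<^sup>+ x. f (X \<omega>, x) \<partial>gauss_measure h) \<partial>M)"
proof -
  let ?Y = "\<lambda>\<omega>. W (s + h) \<omega> - W s \<omega>"
  have [measurable]: "X \<in> measurable M N" using X by (rule measurable_past_imp_M)
  have [measurable]: "W s \<in> borel_measurable M" "W (s + h) \<in> borel_measurable M"
    using W_measurable s h by auto
  interpret G: prob_space "gauss_measure h :: (real ^ 'm) measure"
    using h by (rule prob_space_gauss_measure)
  interpret X: prob_space "distr M N X" by (rule prob_space_distr) simp
  have D: "distr M N X \<Otimes>\<^sub>M gauss_measure h = distr M (N \<Otimes>\<^sub>M borel) (\<lambda>\<omega>. (X \<omega>, ?Y \<omega>))"
  proof (rule pair_measure_eqI)
    show "sets (distr M N X \<Otimes>\<^sub>M gauss_measure h) = sets (distr M (N \<Otimes>\<^sub>M borel) (\<lambda>\<omega>. (X \<omega>, ?Y \<omega>)))"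
      by (simp cong: sets_pair_measure_cong)
    fix A B assume "A \<in> sets (distr M N X)" "B \<in> sets (gauss_measure h :: (real ^ 'm) measure)"
    then have A [measurable]: "A \<in> sets N" and B [measurable]: "B \<in> sets borel" by auto
    have "prob ((X -` A \<inter> space M) \<inter> (?Y -` B \<inter> space M)) = prob (X -` A \<inter> space M) * prob (?Y -` B \<inter> space M)"
      using measurable_sets[OF X A] B by (intro indep_setD[OF indep_past_increment[OF s h]]) auto
    moreover have "(\<lambda>\<omega>. (X \<omega>, ?Y \<omega>)) -` (A \<times> B) \<inter> space M = (X -` A \<inter> space M) \<inter> (?Y -` B \<inter> space M)"
      by auto
    ultimately show "emeasure (distr M N X) A * emeasure (gauss_measure h) B =
        emeasure (distr M (N \<Otimes>\<^sub>M borel) (\<lambda>\<omega>. (X \<omega>, ?Y \<omega>))) (A \<times> B)"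
      unfolding distr_increment[OF s h, symmetric]
      by (simp add: emeasure_distr emeasure_eq_measure ennreal_mult [symmetric])
  qed (rule X.sigma_finite_measure_axioms G.sigma_finite_measure_axioms)+
  have [measurable]: "f \<in> borel_measurable (distr M N X \<Otimes>\<^sub>M gauss_measure h)"
    by (subst measurable_cong_sets[OF sets_pair_measure_cong[of _ N _ borel] refl]) auto
  have "(\<integral>\<^sup>+ \<omega>. f (X \<omega>, ?Y \<omega>) \<partial>M) = (\<integral>\<^sup>+ z. f z \<partial>distr M (N \<Otimes>\<^sub>M borel) (\<lambda>\<omega>. (X \<omega>, ?Y \<omega>)))"
    by (subst nn_integral_distr) auto
  also have "\<dots> = (\<integral>\<^sup>+ x. (\<integral>\<^sup>+ y. f (x, y) \<partial>gauss_measure h) \<partial>distr M N X)"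
    unfolding D [symmetric] by (subst G.nn_integral_fst [symmetric]) auto
  also have "\<dots> = (\<integral>\<^sup>+ \<omega>. (\<integral>\<^sup>+ x. f (X \<omega>, x) \<partial>gauss_measure h) \<partial>M)"
    by (subst nn_integral_distr) (auto intro!: G.borel_measurable_nn_integral)
  finally show ?thesis .
qed

end

text \<open>Fatou's lemma for indicators: the passage from grid events to events in continuous time.
  If \<open>S\<close> is not measurable, its \<open>emeasure\<close> is 0 by convention and the
  bound is trivial.\<close>

lemma emeasure_eventually_le:
  assumes E: "\<And>n::nat. E n \<in> sets M"
    and ev: "\<And>\<omega>. \<omega> \<in> S \<Longrightarrow> eventually (\<lambda>n. \<omega> \<in> E n) sequentially"
    and le: "eventually (\<lambda>n. emeasure M (E n) \<le> c) sequentially"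
  shows "emeasure M S \<le> c"
proof (cases "S \<in> sets M")
  case True
  have "emeasure M S = (\<integral>\<^sup>+ \<omega>. indicator S \<omega> \<partial>M)"
    using True by simp
  also have "\<dots> \<le> (\<integral>\<^sup>+ \<omega>. liminf (\<lambda>n. indicator (E n) \<omega>) \<partial>M)"
  proof (intro nn_integral_mono)
    fix \<omega>
    show "(indicator S \<omega> :: ennreal) \<le> liminf (\<lambda>n. indicator (E n) \<omega>)"
    proof (cases "\<omega> \<in> S")
      case True
      from ev[OF this] have "eventually (\<lambda>n. (1 :: ennreal) \<le> indicator (E n) \<omega>) sequentially"
        by eventually_elim simp
      then show ?thesis using True by (simp add: Liminf_bounded)
    qed simp
  qed
  also have "\<dots> \<le> liminf (\<lambda>n. \<integral>\<^sup>+ \<omega>. indicator (E n) \<omega> \<partial>M)"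
    by (rule nn_integral_liminf) (use E in auto)
  also have "\<dots> = liminf (\<lambda>n. emeasure M (E n))"
    using E by simp
  also have "\<dots> \<le> c"
    using le Liminf_mono[of "\<lambda>n. emeasure M (E n)" "\<lambda>n. c" sequentially] by (simp add: Liminf_const)
  finally show ?thesis .
qed (simp add: emeasure_notin_sets)

lemma all_le_Suc_iff: "(\<forall>i\<le>Suc k. P i) \<longleftrightarrow> P 0 \<and> (\<forall>i\<le>k. P (Suc i))"
proof
  assume r: "P 0 \<and> (\<forall>i\<le>k. P (Suc i))"
  show "\<forall>i\<le>Suc k. P i"
  proof (intro allI impI)
    fix i assume "i \<le> Suc k"
    then show "P i" using r by (cases i) auto
  qed
qed auto

section \<open>Kernels of the walk sampled on a time grid, in both directions of time\<close>

lemma borel_measurable_shift_nn_integral: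
  fixes f :: "real ^ 'm \<Rightarrow> ennreal"
  assumes v: "0 < v" and [measurable]: "f \<in> borel_measurable borel"
  shows "(\<lambda>z. \<integral>\<^sup>+ x. f (a *\<^sub>R z + x) \<partial>gauss_measure v) \<in> borel_measurable borel"
proof -
  interpret G: prob_space "gauss_measure v :: (real ^ 'm) measure"
    by (rule prob_space_gauss_measure[OF v])
  show ?thesis by (rule G.borel_measurable_nn_integral) measurable
qed

text \<open>Duality of the forward and the backward step, obtained by integrating
  \<open>gauss_density_reverse\<close>. Given the position \<open>x\<close> at time
  \<open>s + h\<close>, the position at time \<open>s\<close> is that of a Brownian bridge from 0:
  mean \<open>(s / (s + h)) *\<^sub>R x\<close> and variance
  \<open>h * (s / (s + h))\<close>.\<close>

lemma nn_integral_gauss_reverse: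
  fixes b f :: "real ^ 'm \<Rightarrow> ennreal"
  assumes s: "0 < s" and h: "0 < h"
    and [measurable]: "b \<in> borel_measurable borel" "f \<in> borel_measurable borel"
  shows "(\<integral>\<^sup>+ z. b z * (\<integral>\<^sup>+ x. f (z + x) \<partial>gauss_measure h) \<partial>gauss_measure s) =
    (\<integral>\<^sup>+ x. f x * (\<integral>\<^sup>+ y. b ((s / (s + h)) *\<^sub>R x + y) \<partial>gauss_measure (h * (s / (s + h)))) \<partial>gauss_measure (s + h))"
proof -
  define a where "a = s / (s + h)"
  let ?g = "\<lambda>v x :: real ^ 'm. ennreal (gauss_density v x)"
  have inner: "(\<integral>\<^sup>+ x. f (z + x) \<partial>gauss_measure h) = (\<integral>\<^sup>+ x. f x * ?g h (x - z) \<partial>lborel)" for z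
    using nn_integral_lborel_shift[of "\<lambda>x. f x * ?g h (x - z)" z]
    by (subst nn_integral_gauss_measure) auto
  define I where "I z = (\<integral>\<^sup>+ x. f (z + x) \<partial>gauss_measure h)" for z
  have [measurable]: "I \<in> borel_measurable borel"
    using borel_measurable_shift_nn_integral[OF h, of f 1] by (simp add: I_def[abs_def])
  have "(\<integral>\<^sup>+ z. b z * (\<integral>\<^sup>+ x. f (z + x) \<partial>gauss_measure h) \<partial>gauss_measure s) = (\<integral>\<^sup>+ z. b z * I z * ?g s z \<partial>lborel)"
    unfolding I_def[symmetric] by (rule nn_integral_gauss_measure) measurable
  also have "\<dots> = (\<integral>\<^sup>+ z. (\<integral>\<^sup>+ x. b z * ?g s z * (f x * ?g h (x - z)) \<partial>lborel) \<partial>lborel)"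
  proof (intro nn_integral_cong)
    fix z
    have "(\<integral>\<^sup>+ x. (b z * ?g s z) * (f x * ?g h (x - z)) \<partial>lborel) = (b z * ?g s z) * I z"
      unfolding I_def inner by (rule nn_integral_cmult) measurable
    then show "b z * I z * ?g s z = (\<integral>\<^sup>+ x. b z * ?g s z * (f x * ?g h (x - z)) \<partial>lborel)"
      by (simp only: mult_ac)
  qed
  also have "\<dots> = (\<integral>\<^sup>+ x. (\<integral>\<^sup>+ z. b z * ?g s z * (f x * ?g h (x - z)) \<partial>lborel) \<partial>lborel)"
    by (rule lborel_pair.Fubini') measurable
  also have "\<dots> = (\<integral>\<^sup>+ x. (\<integral>\<^sup>+ z. (f x * ?g (s + h) x) * (b z * ?g (h * a) (z - a *\<^sub>R x)) \<partial>lborel) \<partial>lborel)"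
  proof (intro nn_integral_cong)
    fix x z :: "real ^ 'm"
    have "?g s z * ?g h (x - z) = ?g (s + h) x * ?g (h * a) (z - a *\<^sub>R x)"
      using gauss_density_reverse[OF s h, of z x] by (simp add: ennreal_mult [symmetric] a_def)
    moreover have "b z * ?g s z * (f x * ?g h (x - z)) = b z * f x * (?g s z * ?g h (x - z))"
      by (simp only: mult_ac)
    ultimately show "b z * ?g s z * (f x * ?g h (x - z)) = (f x * ?g (s + h) x) * (b z * ?g (h * a) (z - a *\<^sub>R x))"
      by (simp only: mult_ac)
  qed
  also have "\<dots> = (\<integral>\<^sup>+ x. (f x * ?g (s + h) x) * (\<integral>\<^sup>+ y. b (a *\<^sub>R x + y) \<partial>gauss_measure (h * a)) \<partial>lborel)"
  proof (intro nn_integral_cong)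
    fix x :: "real ^ 'm"
    have "(\<integral>\<^sup>+ y. b (a *\<^sub>R x + y) \<partial>gauss_measure (h * a)) = (\<integral>\<^sup>+ z. b z * ?g (h * a) (z - a *\<^sub>R x) \<partial>lborel)"
      using nn_integral_lborel_shift[of "\<lambda>z. b z * ?g (h * a) (z - a *\<^sub>R x)" "a *\<^sub>R x"]
      by (subst nn_integral_gauss_measure) auto
    then show "(\<integral>\<^sup>+ z. (f x * ?g (s + h) x) * (b z * ?g (h * a) (z - a *\<^sub>R x)) \<partial>lborel)
        = (f x * ?g (s + h) x) * (\<integral>\<^sup>+ y. b (a *\<^sub>R x + y) \<partial>gauss_measure (h * a))"
      by (simp add: nn_integral_cmult)
  qed
  also have "\<dots> = (\<integral>\<^sup>+ x. f x * (\<integral>\<^sup>+ y. b (a *\<^sub>R x + y) \<partial>gauss_measure (h * a)) \<partial>gauss_measure (s + h))"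
  proof -
    have ha: "0 < h * a" using s h by (simp add: a_def)
    have [measurable]: "(\<lambda>x. \<integral>\<^sup>+ y. b (a *\<^sub>R x + y) \<partial>gauss_measure (h * a)) \<in> borel_measurable borel"
      by (rule borel_measurable_shift_nn_integral[OF ha]) measurable
    have "(\<integral>\<^sup>+ x. f x * (\<integral>\<^sup>+ y. b (a *\<^sub>R x + y) \<partial>gauss_measure (h * a)) \<partial>gauss_measure (s + h)) =
      (\<integral>\<^sup>+ x. f x * (\<integral>\<^sup>+ y. b (a *\<^sub>R x + y) \<partial>gauss_measure (h * a)) * ?g (s + h) x \<partial>lborel)"
      by (rule nn_integral_gauss_measure) measurable
    then show ?thesis by (simp only: mult_ac)
  qed
  finally show ?thesis by (simp add: a_def)
qed

text \<open>The probability that the walk with Gaussian steps of variance \<open>h\<close>, started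
  at \<open>z\<close>, visits \<open>C 0\<close>, ..., \<open>C k\<close> in turn.\<close>

primrec forward_kernel :: "real \<Rightarrow> nat \<Rightarrow> (nat \<Rightarrow> (real ^ 'm) set) \<Rightarrow> real ^ 'm \<Rightarrow> ennreal" where
  "forward_kernel h 0 C z = indicator (C 0) z"
| "forward_kernel h (Suc k) C z =
    indicator (C 0) z * (\<integral>\<^sup>+ x. forward_kernel h k (\<lambda>i. C (Suc i)) (z + x) \<partial>gauss_measure h)"

lemma borel_measurable_forward_kernel:
  assumes "0 < h" "\<And>i. C i \<in> sets borel"
  shows "forward_kernel h k C \<in> borel_measurable borel"
  using assms(2)
proof (induction k arbitrary: C)
  case (Suc k)
  have "(\<lambda>z. \<integral>\<^sup>+ x. forward_kernel h k (\<lambda>i. C (Suc i)) (1 *\<^sub>R z + x) \<partial>gauss_measure h) \<in> borel_measurable borel"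
    by (rule borel_measurable_shift_nn_integral[OF assms(1)]) (rule Suc.IH, rule Suc.prems)
  then show ?case using Suc.prems by simp
next
  case 0
  have "forward_kernel h 0 C = indicator (C 0)" by (simp add: fun_eq_iff)
  then show ?case using 0 by simp
qed

lemma forward_kernel_le_1:
  fixes z :: "real ^ 'm"
  assumes "0 < h"
  shows "forward_kernel h k C z \<le> 1"
proof (induction k arbitrary: C z)
  case (Suc k)
  interpret G: prob_space "gauss_measure h :: (real ^ 'm) measure"
    by (rule prob_space_gauss_measure[OF assms])
  have "(\<integral>\<^sup>+ x. forward_kernel h k (\<lambda>i. C (Suc i)) (z + x) \<partial>gauss_measure h) \<le> (\<integral>\<^sup>+ x. 1 \<partial>(gauss_measure h :: (real ^ 'm) measure))"
    by (intro nn_integral_mono Suc.IH)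
  then have "(\<integral>\<^sup>+ x. forward_kernel h k (\<lambda>i. C (Suc i)) (z + x) \<partial>gauss_measure h) \<le> 1"
    using G.emeasure_space_1 by simp
  then show ?case by (simp add: indicator_def)
qed (simp add: indicator_def)

text \<open>The conditional probability that the path lies in \<open>C i\<close> at each time
  \<open>r + i * h\<close> up to index \<open>j\<close>, given that it is at \<open>z\<close> at the
  last of them. A step back in time is a bridge step: contraction by \<open>a\<close> and variance
  \<open>h * a\<close>.\<close>

primrec backward_kernel :: "real \<Rightarrow> real \<Rightarrow> (nat \<Rightarrow> (real ^ 'm) set) \<Rightarrow> nat \<Rightarrow> real ^ 'm \<Rightarrow> ennreal" where
  "backward_kernel r h C 0 z = indicator (C 0) z"
| "backward_kernel r h C (Suc j) z =
    (let a = (r + real j * h) / (r + real (Suc j) * h) in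
     indicator (C (Suc j)) z * (\<integral>\<^sup>+ x. backward_kernel r h C j (a *\<^sub>R z + x) \<partial>gauss_measure (h * a)))"

lemma borel_measurable_backward_kernel:
  assumes r: "0 < r" and h: "0 < h" and C: "\<And>i. C i \<in> sets borel"
  shows "backward_kernel r h C k \<in> borel_measurable borel"
proof (induction k)
  case (Suc k)
  have "0 < h * ((r + real k * h) / (r + real (Suc k) * h))"
    using r h by (intro mult_pos_pos divide_pos_pos add_pos_nonneg) auto
  from borel_measurable_shift_nn_integral[OF this Suc.IH] show ?case
    using C by (simp add: Let_def)
next
  case 0
  have "backward_kernel r h C 0 = indicator (C 0)" by (simp add: fun_eq_iff)
  then show ?case using C by simp
qed

lemma backward_kernel_le_1:
  fixes z :: "real ^ 'm"
  assumes r: "0 < r" and h: "0 < h"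
  shows "backward_kernel r h C k z \<le> 1"
proof (induction k arbitrary: z)
  case (Suc k)
  define v where "v = h * ((r + real k * h) / (r + real (Suc k) * h))"
  have v: "0 < v"
    unfolding v_def using r h by (intro mult_pos_pos divide_pos_pos add_pos_nonneg) auto
  interpret G: prob_space "gauss_measure v :: (real ^ 'm) measure"
    by (rule prob_space_gauss_measure[OF v])
  have "(\<integral>\<^sup>+ x. backward_kernel r h C k (y + x) \<partial>gauss_measure v) \<le> (\<integral>\<^sup>+ x. 1 \<partial>(gauss_measure v :: (real ^ 'm) measure))" for y
    by (intro nn_integral_mono Suc.IH)
  then have "(\<integral>\<^sup>+ x. backward_kernel r h C k (y + x) \<partial>gauss_measure v) \<le> 1" for y
    using G.emeasure_space_1 by simp
  then show ?case by (simp add: indicator_def Let_def v_def)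
qed (simp add: indicator_def)

context std_brownian_motion
begin

lemma measurable_stay_grid:
  assumes "0 \<le> s" "0 \<le> h" "\<And>i. C i \<in> sets borel" "s + real k * h \<le> t"
  shows "{\<omega> \<in> space M. \<forall>i\<le>k. W (s + real i * h) \<omega> \<in> C i} \<in> sets (past t)"
proof -
  have "{\<omega> \<in> space (past t). \<forall>i\<in>{..k}. W (s + real i * h) \<omega> \<in> C i} \<in> sets (past t)"
  proof (rule sets.sets_Collect_finite_All)
    fix i assume "i \<in> {..k}"
    then have "real i * h \<le> real k * h" using assms(2) by (intro mult_right_mono) auto
    then have le: "s + real i * h \<le> t" using assms(4) by linarith
    have "0 \<le> s + real i * h" using assms(1,2) by simp
    from measurable_sets[OF W_measurable_past[OF this le] assms(3)[of i]]
    have "W (s + real i * h) -` C i \<inter> space (past t) \<in> sets (past t)" .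
    also have "W (s + real i * h) -` C i \<inter> space (past t) = {\<omega> \<in> space (past t). W (s + real i * h) \<omega> \<in> C i}"
      by auto
    finally show "{\<omega> \<in> space (past t). W (s + real i * h) \<omega> \<in> C i} \<in> sets (past t)" .
  qed simp
  then show ?thesis by (simp only: space_past Ball_def atMost_iff)
qed

lemma Markov_indicator:
  assumes s: "0 \<le> s" and h: "0 < h" and A: "A \<in> sets (past s)" and [measurable]: "f \<in> borel_measurable borel"
  shows "(\<integral>\<^sup>+ \<omega>. indicator A \<omega> * f (W (s + h) \<omega>) \<partial>M) =
    (\<integral>\<^sup>+ \<omega>. indicator A \<omega> * (\<integral>\<^sup>+ x. f (W s \<omega> + x) \<partial>gauss_measure h) \<partial>M)"
proof -
  have X: "(\<lambda>\<omega>. (indicator A \<omega> :: ennreal, W s \<omega>)) \<in> measurable (past s) (borel \<Otimes>\<^sub>M borel)"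
    using A W_measurable_past[OF s order_refl] by (intro measurable_Pair borel_measurable_indicator)
  let ?f = "\<lambda>p :: (ennreal \<times> (real ^ 'm)) \<times> (real ^ 'm). fst (fst p) * f (snd (fst p) + snd p)"
  have "(\<integral>\<^sup>+ \<omega>. ?f ((indicator A \<omega>, W s \<omega>), W (s + h) \<omega> - W s \<omega>) \<partial>M) =
    (\<integral>\<^sup>+ \<omega>. (\<integral>\<^sup>+ x. ?f ((indicator A \<omega>, W s \<omega>), x) \<partial>gauss_measure h) \<partial>M)"
    by (rule Markov[OF s h X]) measurable
  moreover have "(\<integral>\<^sup>+ x. indicator A \<omega> * f (W s \<omega> + x) \<partial>gauss_measure h) =
      indicator A \<omega> * (\<integral>\<^sup>+ x. f (W s \<omega> + x) \<partial>gauss_measure h)" for \<omega>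
    by (rule nn_integral_cmult) measurable
  ultimately show ?thesis by simp
qed

text \<open>The induction absorbs the constraint at the first grid time into the past event
  \<open>A\<close>, which is why \<open>A\<close> is arbitrary.\<close>

lemma forward_kernel_stay:
  assumes h: "0 < h" and s: "0 \<le> s" and A: "A \<in> sets (past s)" and C: "\<And>i. C i \<in> sets borel"
  shows "emeasure M (A \<inter> {\<omega> \<in> space M. \<forall>i\<le>k. W (s + real i * h) \<omega> \<in> C i}) =
    (\<integral>\<^sup>+ \<omega>. indicator A \<omega> * forward_kernel h k C (W s \<omega>) \<partial>M)"
  using s A C
proof (induction k arbitrary: s A C)
  case 0
  have [measurable]: "W s \<in> borel_measurable M" using W_measurable 0 by auto
  have [measurable]: "A \<in> sets M" using 0 sets_past_subset by auto
  have "A \<inter> {\<omega> \<in> space M. \<forall>i\<le>0. W (s + real i * h) \<omega> \<in> C i} = {\<omega> \<in> space M. \<omega> \<in> A \<and> W s \<omega> \<in> C 0}"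
    using sets.sets_into_space[of A M] by auto
  moreover have "{\<omega> \<in> space M. \<omega> \<in> A \<and> W s \<omega> \<in> C 0} \<in> sets M" using 0(3)[of 0] by measurable
  ultimately have "emeasure M (A \<inter> {\<omega> \<in> space M. \<forall>i\<le>0. W (s + real i * h) \<omega> \<in> C i}) =
      (\<integral>\<^sup>+ \<omega>. indicator {\<omega> \<in> space M. \<omega> \<in> A \<and> W s \<omega> \<in> C 0} \<omega> \<partial>M)"
    by simp
  also have "\<dots> = (\<integral>\<^sup>+ \<omega>. indicator A \<omega> * forward_kernel h 0 C (W s \<omega>) \<partial>M)"
    by (intro nn_integral_cong) (auto simp: indicator_def)
  finally show ?case .
next
  case (Suc k)
  define B where "B = A \<inter> (W s -` C 0 \<inter> space M)"
  have B: "B \<in> sets (past s)"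
    unfolding B_def
    using measurable_sets[OF W_measurable_past[OF Suc.prems(1) order_refl] Suc.prems(3)[of 0]]
    by (intro sets.Int[OF Suc.prems(2)]) simp
  have B': "B \<in> sets (past (s + h))" using B past_mono[of s "s + h"] h by auto
  have sh: "0 \<le> s + h" using Suc.prems(1) h by simp
  have eq: "A \<inter> {\<omega> \<in> space M. \<forall>i\<le>Suc k. W (s + real i * h) \<omega> \<in> C i} =
      B \<inter> {\<omega> \<in> space M. \<forall>i\<le>k. W ((s + h) + real i * h) \<omega> \<in> C (Suc i)}"
  proof -
    have "W (s + real (Suc i) * h) = W ((s + h) + real i * h)" for i by (simp add: algebra_simps)
    then show ?thesis unfolding B_def all_le_Suc_iff by auto
  qed
  have "emeasure M (A \<inter> {\<omega> \<in> space M. \<forall>i\<le>Suc k. W (s + real i * h) \<omega> \<in> C i}) =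
      (\<integral>\<^sup>+ \<omega>. indicator B \<omega> * forward_kernel h k (\<lambda>i. C (Suc i)) (W (s + h) \<omega>) \<partial>M)"
    unfolding eq by (rule Suc.IH[OF sh B' Suc.prems(3)])
  also have "\<dots> = (\<integral>\<^sup>+ \<omega>. indicator B \<omega> * (\<integral>\<^sup>+ x. forward_kernel h k (\<lambda>i. C (Suc i)) (W s \<omega> + x) \<partial>gauss_measure h) \<partial>M)"
    by (intro Markov_indicator[OF Suc.prems(1) h B] borel_measurable_forward_kernel[OF h] Suc.prems(3))
  also have "\<dots> = (\<integral>\<^sup>+ \<omega>. indicator A \<omega> * forward_kernel h (Suc k) C (W s \<omega>) \<partial>M)"
    by (intro nn_integral_cong) (auto simp: B_def indicator_def)
  finally show ?case .
qed

text \<open>The induction removes the last grid time: the Markov property turns the terminal weight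
  into a weight one step earlier, and \<open>nn_integral_gauss_reverse\<close> moves the step onto
  the kernel. Hence the arbitrary \<open>f\<close>. Since \<open>r\<close> is positive, the law at
  every grid time is a nondegenerate Gaussian.\<close>

lemma backward_kernel_stay:
  assumes r: "0 < r" and h: "0 < h" and C: "\<And>i. C i \<in> sets borel"
    and f: "f \<in> borel_measurable borel"
  shows "(\<integral>\<^sup>+ \<omega>. indicator {\<omega> \<in> space M. \<forall>i\<le>k. W (r + real i * h) \<omega> \<in> C i} \<omega> * f (W (r + real k * h) \<omega>) \<partial>M) =
    (\<integral>\<^sup>+ \<omega>. backward_kernel r h C k (W (r + real k * h) \<omega>) * f (W (r + real k * h) \<omega>) \<partial>M)"
  using f
proof (induction k arbitrary: f)
  case 0
  show ?case by (intro nn_integral_cong) (auto simp: indicator_def)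
next
  case (Suc k)
  note [measurable] = \<open>f \<in> borel_measurable borel\<close> C
  define s where "s = r + real k * h"
  have s: "0 < s" using r h by (auto simp: s_def intro: add_pos_nonneg)
  have sh: "r + real (Suc k) * h = s + h" by (simp add: s_def algebra_simps)
  define a where "a = s / (s + h)"
  have a: "0 < h * a" using s h by (simp add: a_def)
  define \<phi> where "\<phi> x = indicator (C (Suc k)) x * f x" for x
  have [measurable]: "\<phi> \<in> borel_measurable borel" unfolding \<phi>_def by measurable
  define \<psi> where "\<psi> z = (\<integral>\<^sup>+ x. \<phi> (z + x) \<partial>gauss_measure h)" for z
  have psi [measurable]: "\<psi> \<in> borel_measurable borel"
    using borel_measurable_shift_nn_integral[OF h, of \<phi> 1] by (simp add: \<psi>_def[abs_def])
  note bm [measurable] = borel_measurable_backward_kernel[where C = C, OF r h C]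
  let ?A = "\<lambda>k. {\<omega> \<in> space M. \<forall>i\<le>k. W (r + real i * h) \<omega> \<in> C i}"
  have A: "?A k \<in> sets (past s)"
    using r h C by (intro measurable_stay_grid) (auto simp: s_def)
  have [measurable]: "W s \<in> borel_measurable M" "W (s + h) \<in> borel_measurable M" using W_measurable s h by auto
  have "(\<integral>\<^sup>+ \<omega>. indicator (?A (Suc k)) \<omega> * f (W (r + real (Suc k) * h) \<omega>) \<partial>M)
      = (\<integral>\<^sup>+ \<omega>. indicator (?A k) \<omega> * \<phi> (W (s + h) \<omega>) \<partial>M)"
    unfolding sh [symmetric] by (intro nn_integral_cong) (auto simp: indicator_def \<phi>_def le_Suc_eq)
  also have "\<dots> = (\<integral>\<^sup>+ \<omega>. indicator (?A k) \<omega> * \<psi> (W s \<omega>) \<partial>M)"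
    unfolding \<psi>_def by (rule Markov_indicator[OF less_imp_le[OF s] h A]) measurable
  also have "\<dots> = (\<integral>\<^sup>+ \<omega>. backward_kernel r h C k (W s \<omega>) * \<psi> (W s \<omega>) \<partial>M)"
    using Suc.IH[OF psi] by (simp add: s_def)
  also have "\<dots> = (\<integral>\<^sup>+ z. backward_kernel r h C k z * \<psi> z \<partial>gauss_measure s)"
    unfolding distr_W[OF s, symmetric] by (rule nn_integral_distr[symmetric]) measurable
  also have "\<dots> = (\<integral>\<^sup>+ x. \<phi> x * (\<integral>\<^sup>+ y. backward_kernel r h C k (a *\<^sub>R x + y) \<partial>gauss_measure (h * a)) \<partial>gauss_measure (s + h))"
    unfolding \<psi>_def a_def by (rule nn_integral_gauss_reverse[OF s h]) measurable
  also have "\<dots> = (\<integral>\<^sup>+ x. backward_kernel r h C (Suc k) x * f x \<partial>gauss_measure (s + h))"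
    unfolding backward_kernel.simps Let_def sh
    by (intro nn_integral_cong) (simp add: \<phi>_def a_def s_def mult_ac)
  also have "\<dots> = (\<integral>\<^sup>+ \<omega>. backward_kernel r h C (Suc k) (W (s + h) \<omega>) * f (W (s + h) \<omega>) \<partial>M)"
    using s h unfolding distr_W[OF add_pos_pos[OF s h], symmetric] by (intro nn_integral_distr) measurable
  finally show ?case unfolding sh .
qed

end

section \<open>An exponential maximal inequality for Brownian increments\<close>

context std_brownian_motion
begin

text \<open>The Gaussian mean is explicit: both its prefactor and its exponent are at least the
  original ones because \<open>b \<le> 1\<close>, while \<open>k \<le> h\<close> keeps
  \<open>b\<close> positive. The weight \<open>Z\<close> allows restriction to an event known at
  time \<open>s\<close>.\<close>

lemma exp_norm_sq_submartingale:
  fixes X :: "'w \<Rightarrow> real ^ 'm"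
  assumes s: "0 \<le> s" and k: "0 \<le> k" "k \<le> h" and h: "0 < h"
    and X: "X \<in> measurable (past s) borel" and Z: "Z \<in> measurable (past s) borel"
  shows "(\<integral>\<^sup>+ \<omega>. Z \<omega> * ennreal (exp ((norm (X \<omega>))\<^sup>2 / (4 * h))) \<partial>M) \<le>
    (\<integral>\<^sup>+ \<omega>. Z \<omega> * ennreal (exp ((norm (X \<omega> + (W (s + k) \<omega> - W s \<omega>)))\<^sup>2 / (4 * h))) \<partial>M)"
proof (cases "k = 0")
  case False
  then have k0: "0 < k" using k by simp
  let ?f = "\<lambda>p :: (ennreal \<times> (real ^ 'm)) \<times> (real ^ 'm). fst (fst p) * ennreal (exp ((norm (snd (fst p) + snd p))\<^sup>2 / (4 * h)))"
  have ZX: "(\<lambda>\<omega>. (Z \<omega>, X \<omega>)) \<in> measurable (past s) (borel \<Otimes>\<^sub>M borel)"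
    by (rule measurable_Pair[OF Z X])
  have "(\<integral>\<^sup>+ \<omega>. ?f ((Z \<omega>, X \<omega>), W (s + k) \<omega> - W s \<omega>) \<partial>M) =
      (\<integral>\<^sup>+ \<omega>. (\<integral>\<^sup>+ x. ?f ((Z \<omega>, X \<omega>), x) \<partial>gauss_measure k) \<partial>M)"
    by (rule Markov[OF s k0 ZX]) measurable
  moreover have "(\<integral>\<^sup>+ \<omega>. Z \<omega> * ennreal (exp ((norm (X \<omega>))\<^sup>2 / (4 * h))) \<partial>M) \<le>
      (\<integral>\<^sup>+ \<omega>. (\<integral>\<^sup>+ x. ?f ((Z \<omega>, X \<omega>), x) \<partial>gauss_measure k) \<partial>M)"
  proof (intro nn_integral_mono)
    fix \<omega>
    define b where "b = 1 - k / (2 * h)"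
    have b: "0 < b" "b \<le> 1" using k k0 h by (auto simp: b_def field_simps)
    have "(norm (X \<omega>))\<^sup>2 * b \<le> (norm (X \<omega>))\<^sup>2 * 1" using b by (intro mult_left_mono) auto
    then have e: "(norm (X \<omega>))\<^sup>2 / (4 * h) \<le> (norm (X \<omega>))\<^sup>2 / (4 * h) / b"
      using b h by (simp add: field_simps)
    have "1 * exp ((norm (X \<omega>))\<^sup>2 / (4 * h)) \<le> (1 / sqrt b) ^ CARD('m) * exp ((norm (X \<omega>))\<^sup>2 / (4 * h) / b)"
      using b e by (intro mult_mono one_le_power) (auto simp: field_simps)
    also have "ennreal \<dots> = (\<integral>\<^sup>+ x. ennreal (exp ((norm (X \<omega> + x))\<^sup>2 / (4 * h))) \<partial>gauss_measure k)"
      using nn_integral_gauss_measure_exp[of k "- 1 / (4 * h)" "X \<omega>"] k0 b by (simp add: b_def)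
    finally have "ennreal (exp ((norm (X \<omega>))\<^sup>2 / (4 * h))) \<le> (\<integral>\<^sup>+ x. ennreal (exp ((norm (X \<omega> + x))\<^sup>2 / (4 * h))) \<partial>gauss_measure k)"
      by (simp add: ennreal_leI)
    then have "Z \<omega> * ennreal (exp ((norm (X \<omega>))\<^sup>2 / (4 * h))) \<le> Z \<omega> * (\<integral>\<^sup>+ x. ennreal (exp ((norm (X \<omega> + x))\<^sup>2 / (4 * h))) \<partial>gauss_measure k)"
      by (rule mult_left_mono) simp
    also have "\<dots> = (\<integral>\<^sup>+ x. ?f ((Z \<omega>, X \<omega>), x) \<partial>gauss_measure k)"
      by (simp add: nn_integral_cmult)
    finally show "Z \<omega> * ennreal (exp ((norm (X \<omega>))\<^sup>2 / (4 * h))) \<le> (\<integral>\<^sup>+ x. ?f ((Z \<omega>, X \<omega>), x) \<partial>gauss_measure k)" .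
  qed
  ultimately show ?thesis by simp
qed simp

text \<open>Doob's argument for the exponential submartingale, by decomposition according to the
  first grid time above the threshold. The threshold may depend on the position at time
  \<open>t\<close>; this yields a bound that can later be integrated against the law of the distance
  to the boundary.\<close>

lemma maximal_inequality_grid:
  assumes t: "0 \<le> t" and h: "0 < h" and N: "0 < N" and A: "A \<in> sets (past t)"
    and g: "g \<in> borel_measurable borel" "\<And>x. 0 \<le> g x"
  shows "emeasure M (A \<inter> {\<omega> \<in> space M. \<exists>i\<le>N. g (W t \<omega>) < norm (W (t + real i * (h / real N)) \<omega> - W t \<omega>)}) \<le>
    ennreal (sqrt 2 ^ CARD('m)) * (\<integral>\<^sup>+ \<omega>. indicator A \<omega> * ennreal (exp (- (g (W t \<omega>))\<^sup>2 / (4 * h))) \<partial>M)"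
    (is "emeasure M (A \<inter> ?U) \<le> _")
proof -
  define ti where "ti i = t + real i * (h / real N)" for i :: nat
  have ti: "t \<le> ti i" "0 \<le> ti i" "i \<le> j \<Longrightarrow> ti i \<le> ti j" for i j
    using t h by (auto simp: ti_def intro!: mult_right_mono divide_right_mono)
  have tiN: "ti N = t + h" using N by (simp add: ti_def)
  define Y where "Y i \<omega> = W (ti i) \<omega> - W t \<omega>" for i \<omega>
  define R where "R \<omega> = ennreal (exp (- (g (W t \<omega>))\<^sup>2 / (4 * h)))" for \<omega>
  define Q where "Q \<omega> = R \<omega> * ennreal (exp ((norm (W (t + h) \<omega> - W t \<omega>))\<^sup>2 / (4 * h)))" for \<omega>
  have Wm: "W t \<in> measurable (past (ti i)) borel" "W (ti j) \<in> measurable (past (ti i)) borel" if "j \<le> i" for i j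
    using that t ti by (auto intro!: W_measurable_past)
  have gm: "(\<lambda>\<omega>. g (W t \<omega>)) \<in> measurable (past (ti i)) borel" for i
    using measurable_compose[OF Wm(1)[OF order_refl] g(1)] .
  have Ym: "Y j \<in> measurable (past (ti i)) borel" if "j \<le> i" for i j
    unfolding Y_def using Wm[OF that] by (intro borel_measurable_diff)
  have Rm: "R \<in> measurable (past (ti i)) borel" for i
  proof -
    note [measurable] = gm[of i]
    show ?thesis unfolding R_def by measurable
  qed
  \<comment> \<open>First passage over the threshold at grid index \<open>i\<close>: disjoint
    events, each known at time \<open>ti i\<close>.\<close>
  define E where "E i = A \<inter> {\<omega> \<in> space M. (\<forall>j<i. norm (Y j \<omega>) \<le> g (W t \<omega>)) \<and> g (W t \<omega>) < norm (Y i \<omega>)}" for i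
  have Em: "E i \<in> sets (past (ti i))" for i
  proof -
    note [measurable] = gm[of i]
    have Yn: "(\<lambda>\<omega>. norm (Y j \<omega>)) \<in> borel_measurable (past (ti i))" if "j \<le> i" for j
      by (rule measurable_compose[OF Ym[OF that] borel_measurable_norm])
    have "{\<omega> \<in> space (past (ti i)). \<forall>j\<in>{..<i}. norm (Y j \<omega>) \<le> g (W t \<omega>)} \<in> sets (past (ti i))"
      by (intro sets.sets_Collect_finite_All borel_measurable_le Yn gm finite_lessThan) simp
    moreover have "{\<omega> \<in> space (past (ti i)). g (W t \<omega>) < norm (Y i \<omega>)} \<in> sets (past (ti i))"
      by (intro borel_measurable_less gm Yn order_refl)
    moreover have "A \<in> sets (past (ti i))" using A past_mono[OF ti(1)] by auto
    ultimately have "A \<inter> ({\<omega> \<in> space (past (ti i)). \<forall>j\<in>{..<i}. norm (Y j \<omega>) \<le> g (W t \<omega>)} \<inter> {\<omega> \<in> space (past (ti i)). g (W t \<omega>) < norm (Y i \<omega>)}) \<in> sets (past (ti i))"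
      by (intro sets.Int)
    also have "A \<inter> ({\<omega> \<in> space (past (ti i)). \<forall>j\<in>{..<i}. norm (Y j \<omega>) \<le> g (W t \<omega>)} \<inter> {\<omega> \<in> space (past (ti i)). g (W t \<omega>) < norm (Y i \<omega>)}) = E i"
      by (auto simp: E_def)
    finally show ?thesis .
  qed
  have EM [measurable]: "E i \<in> sets M" for i using Em sets_past_subset by blast
  have AM [measurable]: "A \<in> sets M" using A sets_past_subset by blast
  have WM [measurable]: "W t \<in> borel_measurable M" "W (t + h) \<in> borel_measurable M"
    using W_measurable t h by auto
  have RM [measurable]: "R \<in> borel_measurable M" using Rm[of 0] by (rule measurable_past_imp_M)
  have QM [measurable]: "Q \<in> borel_measurable M" unfolding Q_def by measurable
  have sub: "A \<inter> ?U \<subseteq> (\<Union>i\<in>{..N}. E i)"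
  proof safe
    fix \<omega> i assume w: "\<omega> \<in> A" "\<omega> \<in> space M" "i \<le> N" "g (W t \<omega>) < norm (W (t + real i * (h / real N)) \<omega> - W t \<omega>)"
    define P where "P i \<longleftrightarrow> g (W t \<omega>) < norm (Y i \<omega>)" for i
    have Pi: "P i" using w by (simp add: P_def Y_def ti_def)
    define j where "j = (LEAST i. P i)"
    have "P j" "j \<le> i" "\<And>k. k < j \<Longrightarrow> \<not> P k"
      unfolding j_def using Pi by (auto intro: LeastI Least_le dest: not_less_Least)
    then have "\<omega> \<in> E j" using w by (auto simp: E_def P_def not_less)
    then show "\<omega> \<in> (\<Union>i\<in>{..N}. E i)" using \<open>j \<le> i\<close> w by auto
  qed
  have disj: "disjoint_family_on E {..N}"
  proof -
    have "E i \<inter> E j = {}" if "i < j" for i j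
      using that by (auto simp: E_def not_less dest!: spec[of _ i])
    then show ?thesis unfolding disjoint_family_on_def by (metis Int_commute nat_neq_iff)
  qed
  \<comment> \<open>On \<open>E i\<close> the increment exceeds the threshold, so \<open>R\<close>
    times the exponential is at least 1 at time \<open>ti i\<close>. The submartingale property then
    replaces \<open>ti i\<close> by the common final time \<open>t + h\<close>, after which the
    disjoint events can be summed.\<close>
  have step: "emeasure M (E i) \<le> (\<integral>\<^sup>+ \<omega>. indicator (E i) \<omega> * Q \<omega> \<partial>M)" if i: "i \<le> N" for i
  proof -
    have "emeasure M (E i) = (\<integral>\<^sup>+ \<omega>. indicator (E i) \<omega> \<partial>M)" by simp
    also have "\<dots> \<le> (\<integral>\<^sup>+ \<omega>. (indicator (E i) \<omega> * R \<omega>) * ennreal (exp ((norm (Y i \<omega>))\<^sup>2 / (4 * h))) \<partial>M)"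
    proof (intro nn_integral_mono)
      fix \<omega>
      show "indicator (E i) \<omega> \<le> (indicator (E i) \<omega> * R \<omega>) * ennreal (exp ((norm (Y i \<omega>))\<^sup>2 / (4 * h)))"
      proof (cases "\<omega> \<in> E i")
        case True
        then have "(g (W t \<omega>))\<^sup>2 \<le> (norm (Y i \<omega>))\<^sup>2" using g by (intro power_mono) (auto simp: E_def)
        then have "0 \<le> - (g (W t \<omega>))\<^sup>2 / (4 * h) + (norm (Y i \<omega>))\<^sup>2 / (4 * h)"
          using h by (simp add: divide_right_mono)
        then have "1 \<le> exp (- (g (W t \<omega>))\<^sup>2 / (4 * h)) * exp ((norm (Y i \<omega>))\<^sup>2 / (4 * h))"
          unfolding mult_exp_exp by simp
        from ennreal_leI[OF this] show ?thesis using True by (simp add: R_def ennreal_mult)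
      qed simp
    qed
    also have "\<dots> \<le> (\<integral>\<^sup>+ \<omega>. (indicator (E i) \<omega> * R \<omega>) * ennreal (exp ((norm (Y i \<omega> + (W (ti i + (t + h - ti i)) \<omega> - W (ti i) \<omega>)))\<^sup>2 / (4 * h))) \<partial>M)"
      using ti(1,2)[of i] ti(3)[OF i] tiN Em[of i] Rm[of i] Ym[OF order_refl] h
      by (intro exp_norm_sq_submartingale borel_measurable_times_ennreal borel_measurable_indicator) auto
    also have "\<dots> = (\<integral>\<^sup>+ \<omega>. indicator (E i) \<omega> * Q \<omega> \<partial>M)"
      by (intro nn_integral_cong) (simp add: Q_def Y_def mult.assoc)
    finally show ?thesis .
  qed
  have "emeasure M (A \<inter> ?U) \<le> emeasure M (\<Union>i\<in>{..N}. E i)"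
    by (rule emeasure_mono[OF sub]) auto
  also have "\<dots> \<le> (\<Sum>i\<in>{..N}. emeasure M (E i))"
    by (rule emeasure_subadditive_finite) auto
  also have "\<dots> \<le> (\<Sum>i\<in>{..N}. \<integral>\<^sup>+ \<omega>. indicator (E i) \<omega> * Q \<omega> \<partial>M)"
    by (intro sum_mono step) auto
  also have "\<dots> = (\<integral>\<^sup>+ \<omega>. (\<Sum>i\<in>{..N}. indicator (E i) \<omega> * Q \<omega>) \<partial>M)"
    by (rule nn_integral_sum [symmetric]) measurable
  also have "\<dots> \<le> (\<integral>\<^sup>+ \<omega>. (indicator A \<omega> * R \<omega>) * ennreal (exp ((norm (W (t + h) \<omega> - W t \<omega>))\<^sup>2 / (4 * h))) \<partial>M)"
  proof (intro nn_integral_mono)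
    fix \<omega>
    have "(\<Sum>i\<in>{..N}. indicator (E i) \<omega> * Q \<omega>) = indicator (\<Union>i\<in>{..N}. E i) \<omega> * Q \<omega>"
      unfolding sum_distrib_right [symmetric] by (subst indicator_UN_disjoint [OF _ disj]) auto
    also have "\<dots> \<le> indicator A \<omega> * Q \<omega>"
      by (intro mult_right_mono indicator_leI) (auto simp: E_def)
    finally show "(\<Sum>i\<in>{..N}. indicator (E i) \<omega> * Q \<omega>) \<le> (indicator A \<omega> * R \<omega>) * ennreal (exp ((norm (W (t + h) \<omega> - W t \<omega>))\<^sup>2 / (4 * h)))"
      by (simp add: Q_def mult.assoc)
  qed
  also have "\<dots> = (\<integral>\<^sup>+ \<omega>. (\<integral>\<^sup>+ x. (indicator A \<omega> * R \<omega>) * ennreal (exp ((norm (x :: real ^ 'm))\<^sup>2 / (4 * h))) \<partial>gauss_measure h) \<partial>M)"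
  proof -
    let ?f = "\<lambda>p :: ennreal \<times> (real ^ 'm). fst p * ennreal (exp ((norm (snd p))\<^sup>2 / (4 * h)))"
    have X: "(\<lambda>\<omega>. indicator A \<omega> * R \<omega>) \<in> measurable (past t) borel"
      using A Rm[of 0] by (intro borel_measurable_times_ennreal borel_measurable_indicator) (auto simp: ti_def)
    have "(\<integral>\<^sup>+ \<omega>. ?f (indicator A \<omega> * R \<omega>, W (t + h) \<omega> - W t \<omega>) \<partial>M) =
      (\<integral>\<^sup>+ \<omega>. (\<integral>\<^sup>+ x. ?f (indicator A \<omega> * R \<omega>, x) \<partial>gauss_measure h) \<partial>M)"
      by (rule Markov[OF t h X]) measurable
    then show ?thesis by simp
  qed
  also have "\<dots> \<le> (\<integral>\<^sup>+ \<omega>. ennreal (sqrt 2 ^ CARD('m)) * (indicator A \<omega> * R \<omega>) \<partial>M)"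
  proof (intro nn_integral_mono)
    fix \<omega>
    have "(\<integral>\<^sup>+ x. (indicator A \<omega> * R \<omega>) * ennreal (exp ((norm (x :: real ^ 'm))\<^sup>2 / (4 * h))) \<partial>gauss_measure h)
       = (indicator A \<omega> * R \<omega>) * (\<integral>\<^sup>+ x. ennreal (exp ((norm (x :: real ^ 'm))\<^sup>2 / (4 * h))) \<partial>gauss_measure h)"
      by (rule nn_integral_cmult) measurable
    also have "\<dots> \<le> (indicator A \<omega> * R \<omega>) * ennreal (sqrt 2 ^ CARD('m))"
      by (intro mult_left_mono nn_integral_gauss_measure_exp_sq h) auto
    finally show "(\<integral>\<^sup>+ x. (indicator A \<omega> * R \<omega>) * ennreal (exp ((norm (x :: real ^ 'm))\<^sup>2 / (4 * h))) \<partial>gauss_measure h)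
        \<le> ennreal (sqrt 2 ^ CARD('m)) * (indicator A \<omega> * R \<omega>)"
      by (simp only: mult.commute)
  qed
  also have "\<dots> = ennreal (sqrt 2 ^ CARD('m)) * (\<integral>\<^sup>+ \<omega>. indicator A \<omega> * R \<omega> \<partial>M)"
    by (rule nn_integral_cmult) measurable
  finally show ?thesis unfolding R_def .
qed

end

text \<open>The last grid point not after \<open>u\<close> is within one mesh width of
  \<open>u\<close>, so the values of \<open>f\<close> there converge to \<open>f u\<close> and
  eventually enter the open set.\<close>

lemma eventually_grid:
  fixes f :: "real \<Rightarrow> 'a :: topological_space"
  assumes ab: "a < b" and u: "u \<in> {a..b}" and f: "continuous_on {a..b} f" and U: "open U" "f u \<in> U"
  shows "eventually (\<lambda>n. \<exists>i\<le>Suc n. f (a + real i * ((b - a) / real (Suc n))) \<in> U) sequentially"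
proof -
  define d where "d = b - a"
  have d: "0 < d" using ab by (simp add: d_def)
  define i where "i n = nat \<lfloor>(u - a) * real (Suc n) / d\<rfloor>" for n
  define t where "t n = a + real (i n) * (d / real (Suc n))" for n
  have q: "0 \<le> (u - a) * real (Suc n) / d" for n using u d by auto
  have ri: "real (i n) \<le> (u - a) * real (Suc n) / d" "(u - a) * real (Suc n) / d - 1 \<le> real (i n)" for n
    using q[of n] unfolding i_def by linarith+
  have t1: "t n \<le> u" "u - d / real (Suc n) \<le> t n" for n
  proof -
    have "real (i n) * (d / real (Suc n)) \<le> (u - a) * real (Suc n) / d * (d / real (Suc n))"
      using ri d by (intro mult_right_mono) auto
    then show "t n \<le> u" using d by (simp add: t_def)
    have "((u - a) * real (Suc n) / d - 1) * (d / real (Suc n)) \<le> real (i n) * (d / real (Suc n))"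
      using ri d by (intro mult_right_mono) auto
    moreover have "((u - a) * real (Suc n) / d - 1) * (d / real (Suc n)) = u - a - d / real (Suc n)"
    proof -
      have "(x * r / d - 1) * (d / r) = x - d / r" if "0 < r" for x r :: real
        using that d by (simp add: field_simps)
      from this[of "real (Suc n)" "u - a"] show ?thesis by simp
    qed
    ultimately show "u - d / real (Suc n) \<le> t n" unfolding t_def by linarith
  qed
  have ta: "a \<le> t n" for n using d by (simp add: t_def)
  have "(\<lambda>n. u - d / real (Suc n)) \<longlonglongrightarrow> u - 0"
    by (intro tendsto_diff tendsto_const LIMSEQ_Suc[OF lim_const_over_n])
  then have "t \<longlonglongrightarrow> u"
    by (intro tendsto_sandwich[of "\<lambda>n. u - d / real (Suc n)" t sequentially "\<lambda>_. u" u]) (use t1 in auto)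
  then have "(\<lambda>n. f (t n)) \<longlonglongrightarrow> f u"
    using u t1(1) ta by (intro continuous_on_tendsto_compose[OF f]) (auto intro!: always_eventually order_trans[OF t1(1)])
  from topological_tendstoD[OF this U] show ?thesis
  proof eventually_elim
    case (elim n)
    have "real (i n) \<le> real (Suc n)"
    proof -
      have "(u - a) * real (Suc n) / d \<le> d * real (Suc n) / d"
        using u d by (intro divide_right_mono mult_right_mono) (auto simp: d_def)
      then show ?thesis using ri(1)[of n] d by simp
    qed
    then show ?case using elim by (intro exI[of _ "i n"]) (auto simp: t_def d_def)
  qed
qed

context std_brownian_motion
begin

text \<open>The strict inequality is an open condition along a continuous path, so every
  sufficiently fine grid detects it.\<close>

lemma maximal_inequality:
  assumes t: "0 \<le> t" and h: "0 < h" and A: "A \<in> sets (past t)"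
    and g: "g \<in> borel_measurable borel" "\<And>x. 0 \<le> g x"
  shows "emeasure M (A \<inter> {\<omega> \<in> space M. \<exists>u\<in>{t..t + h}. g (W t \<omega>) < norm (W u \<omega> - W t \<omega>)}) \<le>
    ennreal (sqrt 2 ^ CARD('m)) * (\<integral>\<^sup>+ \<omega>. indicator A \<omega> * ennreal (exp (- (g (W t \<omega>))\<^sup>2 / (4 * h))) \<partial>M)"
proof (rule emeasure_eventually_le)
  let ?E = "\<lambda>n. {\<omega> \<in> space M. \<exists>i\<le>Suc n. g (W t \<omega>) < norm (W (t + real i * (h / real (Suc n))) \<omega> - W t \<omega>)}"
  show "A \<inter> ?E n \<in> sets M" for n
  proof (rule sets.Int)
    show "A \<in> sets M" using A sets_past_subset by blast
    have "{\<omega> \<in> space M. \<exists>i\<in>{..Suc n}. g (W t \<omega>) < norm (W (t + real i * (h / real (Suc n))) \<omega> - W t \<omega>)} \<in> sets M"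
    proof (rule sets.sets_Collect_finite_Ex)
      fix i
      have [measurable]: "W t \<in> borel_measurable M" "W (t + real i * (h / real (Suc n))) \<in> borel_measurable M"
        using W_measurable t h by auto
      note [measurable] = g(1)
      show "{\<omega> \<in> space M. g (W t \<omega>) < norm (W (t + real i * (h / real (Suc n))) \<omega> - W t \<omega>)} \<in> sets M"
        by measurable
    qed simp
    then show "?E n \<in> sets M" by (simp only: Bex_def atMost_iff)
  qed
  show "eventually (\<lambda>n. emeasure M (A \<inter> ?E n) \<le> ennreal (sqrt 2 ^ CARD('m)) * (\<integral>\<^sup>+ \<omega>. indicator A \<omega> * ennreal (exp (- (g (W t \<omega>))\<^sup>2 / (4 * h))) \<partial>M)) sequentially"
    using maximal_inequality_grid[OF t h _ A g] by (intro always_eventually allI) blast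
  fix \<omega> assume "\<omega> \<in> A \<inter> {\<omega> \<in> space M. \<exists>u\<in>{t..t + h}. g (W t \<omega>) < norm (W u \<omega> - W t \<omega>)}"
  then obtain u where u: "\<omega> \<in> A" "\<omega> \<in> space M" "u \<in> {t..t + h}" "g (W t \<omega>) < norm (W u \<omega> - W t \<omega>)" by auto
  have "continuous_on {t..t + h} (\<lambda>u. W u \<omega>)"
    using W_continuous[OF u(2)] t by (auto elim: continuous_on_subset)
  then have c: "continuous_on {t..t + h} (\<lambda>u. norm (W u \<omega> - W t \<omega>))"
    by (intro continuous_on_norm continuous_on_diff continuous_on_const)
  have "eventually (\<lambda>n. \<exists>i\<le>Suc n. norm (W (t + real i * ((t + h - t) / real (Suc n))) \<omega> - W t \<omega>) \<in> {g (W t \<omega>)<..}) sequentially"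
    using h u by (intro eventually_grid[OF _ u(3) c]) auto
  then show "eventually (\<lambda>n. \<omega> \<in> A \<inter> ?E n) sequentially"
    by eventually_elim (use u in auto)
qed

end

section \<open>Regular space-time domains\<close>

lemma hausdorff_h_bound:
  assumes le: "hausdorff_h A B \<le> ereal c" and x: "x \<in> A" and e: "c < e"
  shows "\<exists>y\<in>B. dist x y < e"
proof -
  have "hausdorff_h A B < ereal e" using le e by (auto intro: le_less_trans)
  then obtain e' where e': "e' < e" "A \<subseteq> nbhd B e'"
    unfolding hausdorff_h_def by (auto simp: Inf_less_iff)
  then have "set_dist x B < ereal e'" using x by (auto simp: nbhd_def)
  then obtain y where "y \<in> B" "dist x y < e'"
    unfolding set_dist_def by (auto simp: INF_less_iff)
  then show ?thesis using e'(1) by (intro bexI[of _ y]) auto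
qed

lemma hausdorff_h_sym: "hausdorff_h A B = hausdorff_h B A"
  unfolding hausdorff_h_def by (rule arg_cong[where f = Inf]) auto

lemma infdist_lessE:
  assumes "A \<noteq> {}" "infdist x A < r"
  obtains y where "y \<in> A" "dist x y < r"
proof -
  have "bdd_below (dist x ` A)" by (intro bdd_belowI[of _ 0]) auto
  then show thesis using assms that by (auto simp: infdist_def cINF_less_iff)
qed

text \<open>Nonemptiness is essential: on the empty set the two distances are infinity and
  0.\<close>

lemma set_dist_eq_infdist:
  assumes "A \<noteq> {}"
  shows "set_dist x A = ereal (infdist x A)"
proof (rule antisym)
  show "ereal (infdist x A) \<le> set_dist x A"
    unfolding set_dist_def by (intro INF_greatest) (simp add: infdist_le)
  show "set_dist x A \<le> ereal (infdist x A)"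
  proof (rule ccontr)
    assume "\<not> set_dist x A \<le> ereal (infdist x A)"
    then obtain r where r: "infdist x A < r" "ereal r < set_dist x A"
      using ereal_dense2[of "ereal (infdist x A)" "set_dist x A"] by (auto simp: not_le)
    obtain y where "y \<in> A" "dist x y < r" using infdist_lessE[OF assms r(1)] .
    then have "set_dist x A \<le> ereal (dist x y)" "ereal (dist x y) < ereal r"
      unfolding set_dist_def by (auto intro: INF_lower)
    then show False using r(2) by (meson le_less_trans less_asym)
  qed
qed

text \<open>Turns a radius that decreases linearly in time into the linear lower bound on its square
  that \<open>avoid_bound\<close> expects. If \<open>q\<close> exceeds \<open>R\<close>, the
  left-hand side is negative or zero.\<close>

lemma power2_ge_diff:
  fixes x R q :: real
  assumes "R - q \<le> x" "0 \<le> x" "0 \<le> R" "0 \<le> q"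
  shows "R\<^sup>2 - 2 * R * q \<le> x\<^sup>2"
proof (cases "0 \<le> R - q")
  case True
  have "(R - q)\<^sup>2 \<le> x\<^sup>2" using True assms by (intro power_mono) auto
  then show ?thesis using zero_le_power2[of q] unfolding power2_diff by linarith
next
  case False
  then have "R * R \<le> R * (2 * q)" using assms by (intro mult_left_mono) auto
  then show ?thesis using zero_le_power2[of x] unfolding power2_eq_square by linarith
qed

text \<open>The minimum over a compact interval is attained. Therefore the event holds iff, for
  every k, some grid point has value below \<open>\<delta> + 1 / (k + 1)\<close>, and this involves
  only countably many times.\<close>

lemma measurable_Ex_le:
  fixes \<Phi> :: "real \<Rightarrow> 'w \<Rightarrow> real"
  assumes ab: "a \<le> b"
    and m: "\<And>u. a \<le> u \<Longrightarrow> u \<le> b \<Longrightarrow> \<Phi> u \<in> borel_measurable N"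
    and c: "\<And>\<omega>. \<omega> \<in> space N \<Longrightarrow> continuous_on {a..b} (\<lambda>u. \<Phi> u \<omega>)"
  shows "{\<omega> \<in> space N. \<exists>u\<in>{a..b}. \<Phi> u \<omega> \<le> \<delta>} \<in> sets N"
proof (cases "a = b")
  case True
  have "{\<omega> \<in> space N. \<Phi> a \<omega> \<le> \<delta>} \<in> sets N"
    using m[of a] True by (intro borel_measurable_le) auto
  moreover have "{\<omega> \<in> space N. \<exists>u\<in>{a..b}. \<Phi> u \<omega> \<le> \<delta>} = {\<omega> \<in> space N. \<Phi> a \<omega> \<le> \<delta>}"
    using True by auto
  ultimately show ?thesis by (simp only:)
next
  case False
  then have ab': "a < b" using ab by simp
  define t where "t n i = a + real i * ((b - a) / real (Suc n))" for n i :: nat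
  define S where "S = (\<Inter>k. \<Union>n. \<Union>i\<in>{..Suc n}. {\<omega> \<in> space N. \<Phi> (t n i) \<omega> < \<delta> + 1 / real (Suc k)})"
  have t: "t n i \<in> {a..b}" if "i \<le> Suc n" for n i
  proof -
    have "real i * ((b - a) / real (Suc n)) \<le> real (Suc n) * ((b - a) / real (Suc n))"
      using that ab by (intro mult_right_mono) auto
    then show ?thesis using ab by (auto simp: t_def)
  qed
  have "(\<Union>n. \<Union>i\<in>{..Suc n}. {\<omega> \<in> space N. \<Phi> (t n i) \<omega> < \<delta> + 1 / real (Suc k)}) \<in> sets N" for k
  proof (intro sets.countable_UN image_subsetI sets.finite_UN finite_atMost)
    fix n i assume "i \<in> {..Suc n}"
    then show "{\<omega> \<in> space N. \<Phi> (t n i) \<omega> < \<delta> + 1 / real (Suc k)} \<in> sets N"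
      using t[of i n] m[of "t n i"] by (intro borel_measurable_less) auto
  qed
  then have "S \<in> sets N" unfolding S_def by (intro sets.countable_INT image_subsetI) auto
  moreover have "S = {\<omega> \<in> space N. \<exists>u\<in>{a..b}. \<Phi> u \<omega> \<le> \<delta>}"
  proof (intro set_eqI iffI)
    fix \<omega> assume w: "\<omega> \<in> S"
    then have sp: "\<omega> \<in> space N" by (auto simp: S_def)
    obtain u where u: "u \<in> {a..b}" "\<And>v. v \<in> {a..b} \<Longrightarrow> \<Phi> u \<omega> \<le> \<Phi> v \<omega>"
      using continuous_attains_inf[OF compact_Icc _ c[OF sp]] ab by auto
    have "\<Phi> u \<omega> \<le> \<delta> + 1 / real (Suc k)" for k
    proof -
      from w obtain n i where "i \<le> Suc n" "\<Phi> (t n i) \<omega> < \<delta> + 1 / real (Suc k)"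
        unfolding S_def by blast
      then show ?thesis using u(2)[OF t[of i n]] by simp
    qed
    moreover have "(\<lambda>k. \<delta> + 1 / real (Suc k)) \<longlonglongrightarrow> \<delta> + 0"
      by (intro tendsto_add tendsto_const LIMSEQ_Suc[OF lim_const_over_n])
    ultimately have "\<Phi> u \<omega> \<le> \<delta> + 0"
      by (intro LIMSEQ_le_const) auto
    then show "\<omega> \<in> {\<omega> \<in> space N. \<exists>u\<in>{a..b}. \<Phi> u \<omega> \<le> \<delta>}" using sp u(1) by auto
  next
    fix \<omega> assume "\<omega> \<in> {\<omega> \<in> space N. \<exists>u\<in>{a..b}. \<Phi> u \<omega> \<le> \<delta>}"
    then obtain u where u: "\<omega> \<in> space N" "u \<in> {a..b}" "\<Phi> u \<omega> \<le> \<delta>" by auto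
    have "\<exists>n. \<exists>i\<le>Suc n. \<Phi> (t n i) \<omega> < \<delta> + 1 / real (Suc k)" for k
    proof -
      have "eventually (\<lambda>n. \<exists>i\<le>Suc n. \<Phi> (a + real i * ((b - a) / real (Suc n))) \<omega> \<in> {..<\<delta> + 1 / real (Suc k)}) sequentially"
      proof (rule eventually_grid[OF ab' u(2) c[OF u(1)]])
        have "0 < 1 / real (Suc k)" by simp
        then show "\<Phi> u \<omega> \<in> {..<\<delta> + 1 / real (Suc k)}" using u(3) by (simp add: le_less_trans del: of_nat_Suc)
      qed auto
      then show ?thesis unfolding eventually_sequentially t_def by blast
    qed
    then show "\<omega> \<in> S" using u(1) unfolding S_def by blast
  qed
  ultimately show ?thesis by (simp only:)
qed

text \<open>The first two conditions of the class in the form in which they act, symmetric in the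
  two times. The Hausdorff bound is an infimum, so it provides a nearby point only for each
  \<open>e\<close> strictly above \<open>K * \<bar>s - t\<bar>\<close>. Nonempty complements make
  \<open>infdist\<close> the true distance.\<close>

locale regular_domain = std_brownian_motion M W
  for M :: "'w measure" and W :: "real \<Rightarrow> 'w \<Rightarrow> real ^ 'm" +
  fixes T K \<beta> :: real and D :: "real \<Rightarrow> (real ^ 'm) set"
  assumes T: "0 < T" and K: "0 < K" and beta: "0 < \<beta>"
    and open_D: "0 < t \<Longrightarrow> t < T \<Longrightarrow> open (D t)"
    and compl_D: "0 < t \<Longrightarrow> t < T \<Longrightarrow> - D t \<noteq> {}"
    and D_near: "0 < s \<Longrightarrow> s < T \<Longrightarrow> 0 < t \<Longrightarrow> t < T \<Longrightarrow> x \<in> D s \<Longrightarrow> K * \<bar>s - t\<bar> < e \<Longrightarrow> \<exists>y\<in>D t. dist x y < e"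
    and compl_near: "0 < s \<Longrightarrow> s < T \<Longrightarrow> 0 < t \<Longrightarrow> t < T \<Longrightarrow> x \<notin> D s \<Longrightarrow> K * \<bar>s - t\<bar> < e \<Longrightarrow> \<exists>y. y \<notin> D t \<and> dist x y < e"
    and ext_ball: "0 < t \<Longrightarrow> t < T \<Longrightarrow> g \<in> frontier (D t) \<Longrightarrow> \<exists>y. ball y \<beta> \<inter> D t = {} \<and> dist y g = \<beta>"
begin

definition bdist :: "real \<Rightarrow> real ^ 'm \<Rightarrow> real" where
  "bdist t x = infdist x (- D t)"

definition Stay :: "real \<Rightarrow> 'w set" where
  "Stay t = {\<omega> \<in> space M. \<forall>u\<in>{0<..<t}. W u \<omega> \<in> D u}"

definition Near :: "real \<Rightarrow> real \<Rightarrow> real \<Rightarrow> 'w set" where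
  "Near \<delta> a b = {\<omega> \<in> space M. \<exists>u\<in>{a..b}. bdist u (W u \<omega>) \<le> \<delta>}"

definition Exit :: "real \<Rightarrow> real \<Rightarrow> 'w set" where
  "Exit a b = {\<omega> \<in> space M. \<exists>u\<in>{a..b}. W u \<omega> \<notin> D u}"

lemma bdist_nonneg [simp]: "0 \<le> bdist t x"
  by (simp add: bdist_def infdist_nonneg)

lemma bdist_measurable [measurable]: "bdist t \<in> borel_measurable borel"
  unfolding bdist_def by (intro borel_measurable_continuous_onI continuous_intros)

lemma bdist_eq_0: "0 < t \<Longrightarrow> t < T \<Longrightarrow> bdist t x = 0 \<longleftrightarrow> x \<notin> D t"
  using in_closed_iff_infdist_zero[of "- D t" x] open_D compl_D by (auto simp: bdist_def closed_def)

lemma bdist_lipschitz: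
  assumes s: "0 < s" "s < T" and t: "0 < t" "t < T"
  shows "bdist t x \<le> bdist s y + dist x y + K * \<bar>s - t\<bar>"
proof (rule field_le_epsilon)
  fix e :: real assume e: "0 < e"
  have "infdist y (- D s) < infdist y (- D s) + e / 2" using e by simp
  then obtain z where z: "z \<notin> D s" "dist y z < bdist s y + e / 2"
    using infdist_lessE[of "- D s" y] compl_D[OF s] unfolding bdist_def by (metis Compl_iff)
  have "K * \<bar>s - t\<bar> < K * \<bar>s - t\<bar> + e / 2" using e by simp
  then obtain z' where z': "z' \<notin> D t" "dist z z' < K * \<bar>s - t\<bar> + e / 2"
    using compl_near[OF s t z(1)] by blast
  have "bdist t x \<le> dist x z'" unfolding bdist_def by (rule infdist_le) (use z' in auto)
  also have "\<dots> \<le> dist x y + dist y z + dist z z'"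
    using dist_triangle[of x z' y] dist_triangle[of y z' z] by linarith
  finally show "bdist t x \<le> bdist s y + dist x y + K * \<bar>s - t\<bar> + e"
    using z z' by linarith
qed

lemma bdist_path_continuous:
  assumes a: "0 < a" and b: "b < T" and w: "\<omega> \<in> space M"
  shows "continuous_on {a..b} (\<lambda>u. bdist u (W u \<omega>))"
  unfolding continuous_on_def
proof
  fix u assume u: "u \<in> {a..b}"
  have W: "((\<lambda>v. W v \<omega>) \<longlongrightarrow> W u \<omega>) (at u within {a..b})"
    using continuous_on_subset[OF W_continuous[OF w], of "{a..b}"] a u by (auto simp: continuous_on_def)
  have lim: "((\<lambda>v. dist (W v \<omega>) (W u \<omega>) + K * \<bar>v - u\<bar>) \<longlongrightarrow> dist (W u \<omega>) (W u \<omega>) + K * \<bar>u - u\<bar>) (at u within {a..b})"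
    by (intro tendsto_intros W)
  show "((\<lambda>v. bdist v (W v \<omega>)) \<longlongrightarrow> bdist u (W u \<omega>)) (at u within {a..b})"
  proof (rule Lim_transform_bound[THEN LIM_zero_cancel])
    show "((\<lambda>v. dist (W v \<omega>) (W u \<omega>) + K * \<bar>v - u\<bar>) \<longlongrightarrow> 0) (at u within {a..b})" using lim by simp
    show "eventually (\<lambda>v. norm (bdist v (W v \<omega>) - bdist u (W u \<omega>)) \<le> norm (dist (W v \<omega>) (W u \<omega>) + K * \<bar>v - u\<bar>)) (at u within {a..b})"
      unfolding eventually_at_filter
    proof (rule always_eventually, intro allI impI)
      fix v assume v: "v \<in> {a..b}"
      have "bdist v (W v \<omega>) \<le> bdist u (W u \<omega>) + dist (W v \<omega>) (W u \<omega>) + K * \<bar>u - v\<bar>"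
        using u v a b by (intro bdist_lipschitz) auto
      moreover have "bdist u (W u \<omega>) \<le> bdist v (W v \<omega>) + dist (W u \<omega>) (W v \<omega>) + K * \<bar>v - u\<bar>"
        using u v a b by (intro bdist_lipschitz) auto
      ultimately show "norm (bdist v (W v \<omega>) - bdist u (W u \<omega>)) \<le> norm (dist (W v \<omega>) (W u \<omega>) + K * \<bar>v - u\<bar>)"
        by (simp add: dist_commute abs_minus_commute)
    qed
  qed
qed

lemma Near_past:
  assumes "0 < a" "a \<le> b" "b < T"
  shows "Near \<delta> a b \<in> sets (past b)"
proof -
  have "{\<omega> \<in> space (past b). \<exists>u\<in>{a..b}. bdist u (W u \<omega>) \<le> \<delta>} \<in> sets (past b)"
  proof (rule measurable_Ex_le[OF assms(2)])
    fix u assume "a \<le> u" "u \<le> b"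
    then show "(\<lambda>\<omega>. bdist u (W u \<omega>)) \<in> borel_measurable (past b)"
      using assms by (intro measurable_compose[OF W_measurable_past bdist_measurable]) auto
  next
    fix \<omega> assume "\<omega> \<in> space (past b)"
    then show "continuous_on {a..b} (\<lambda>u. bdist u (W u \<omega>))"
      using assms bdist_path_continuous by simp
  qed
  then show ?thesis by (simp only: Near_def space_past)
qed

lemma Exit_eq_Near:
  assumes "0 < a" "b < T"
  shows "Exit a b = Near 0 a b"
proof -
  have "W u \<omega> \<notin> D u \<longleftrightarrow> bdist u (W u \<omega>) \<le> 0" if "u \<in> {a..b}" for u \<omega>
    using bdist_eq_0[of u "W u \<omega>"] assms that by (auto dest: order_antisym[OF _ bdist_nonneg])
  then show ?thesis unfolding Exit_def Near_def by blast
qed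

lemma Exit_past:
  assumes "0 < a" "a \<le> b" "b < T"
  shows "Exit a b \<in> sets (past b)"
  unfolding Exit_eq_Near[OF assms(1,3)] by (rule Near_past[OF assms])

lemma Stay_past:
  assumes t: "0 < t" "t \<le> T"
  shows "Stay t \<in> sets (past t)"
proof -
  \<comment> \<open>With \<open>n + 3\<close> the margin is at most \<open>t / 3\<close>, so that
    the intervals from \<open>r n\<close> to \<open>t - r n\<close> are nonempty; they exhaust the
    open interval.\<close>
  define r where "r n = t / real (n + 3)" for n :: nat
  have r: "0 < r n" "r n \<le> t - r n" "t - r n < t" for n
  proof -
    show "0 < r n" using t by (simp add: r_def)
    then show "t - r n < t" by simp
    have "2 * t \<le> t * real (n + 3)" using t by (simp add: algebra_simps)
    then show "r n \<le> t - r n" using t unfolding r_def by (simp add: field_simps)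
  qed
  have "Exit (r n) (t - r n) \<in> sets (past t)" for n
    using Exit_past[of "r n" "t - r n"] r[of n] t past_mono[of "t - r n" t] by auto
  then have "space M - (\<Union>n. Exit (r n) (t - r n)) \<in> sets (past t)"
    using sets.compl_sets[of "\<Union>n. Exit (r n) (t - r n)" "past t"] by auto
  also have "space M - (\<Union>n. Exit (r n) (t - r n)) = Stay t"
  proof (intro set_eqI iffI)
    fix \<omega> assume w: "\<omega> \<in> space M - (\<Union>n. Exit (r n) (t - r n))"
    have "W u \<omega> \<in> D u" if u: "u \<in> {0<..<t}" for u
    proof -
      have lim: "r \<longlonglongrightarrow> 0"
        unfolding r_def by (rule LIMSEQ_ignore_initial_segment[OF lim_const_over_n])
      have "eventually (\<lambda>n. r n < u) sequentially" "eventually (\<lambda>n. r n < t - u) sequentially"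
        using u by (auto intro!: order_tendstoD(2)[OF lim])
      then have "eventually (\<lambda>n. r n < u \<and> r n < t - u) sequentially" by (rule eventually_conj)
      then obtain n where "r n < u" "r n < t - u" unfolding eventually_sequentially by blast
      then have "u \<in> {r n..t - r n}" by simp
      then show ?thesis using w unfolding Exit_def by blast
    qed
    then show "\<omega> \<in> Stay t" using w by (auto simp: Stay_def)
  next
    fix \<omega> assume "\<omega> \<in> Stay t"
    moreover have "{r n..t - r n} \<subseteq> {0<..<t}" for n using r[of n] by auto
    ultimately show "\<omega> \<in> space M - (\<Union>n. Exit (r n) (t - r n))"
      unfolding Stay_def Exit_def by blast
  qed
  finally show ?thesis .
qed

text \<open>The open ball around \<open>x\<close> up to the nearest complement point lies in the
  section, which puts that point into the closure. A point outside the section has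
  \<open>bdist\<close> 0, and only membership in the closure makes it a frontier point
  itself.\<close>

lemma nearest_frontier_point:
  assumes t: "0 < t" "t < T" and x: "x \<in> closure (D t)"
  obtains g where "g \<in> frontier (D t)" "dist x g = bdist t x"
proof -
  have cl: "closed (- D t)" using open_D[OF t] by (simp add: closed_def)
  obtain g where g: "g \<in> - D t" "bdist t x = dist x g"
    using infdist_attains_inf[OF cl compl_D[OF t]] unfolding bdist_def by blast
  have "g \<in> closure (D t)"
  proof (cases "x \<in> D t")
    case False
    then have "bdist t x = 0" using bdist_eq_0[OF t] by simp
    then show ?thesis using g x by simp
  next
    case True
    then have r: "0 < dist x g" using g by auto
    have sub: "ball x (dist x g) \<subseteq> D t"
    proof
      fix z assume z: "z \<in> ball x (dist x g)"
      show "z \<in> D t"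
      proof (rule ccontr)
        assume "z \<notin> D t"
        then have "bdist t x \<le> dist x z" unfolding bdist_def by (intro infdist_le) auto
        then show False using z g by (simp add: mem_ball)
      qed
    qed
    have "g \<in> closure (ball x (dist x g))" using r by simp
    then show ?thesis using closure_mono[OF sub] by auto
  qed
  then have "g \<in> frontier (D t)" using g(1) interior_subset[of "D t"] by (auto simp: frontier_def)
  then show thesis using g(2) that by metis
qed

text \<open>A point of the section at time \<open>t\<close> has points of the section at time
  \<open>s\<close> within any distance above \<open>K * \<bar>t - s\<bar>\<close>, and those stay
  outside the ball.\<close>

lemma avoids_shrinking_ball:
  assumes s: "0 < s" "s < T" and t: "0 < t" "t < T" and y: "ball y \<beta> \<inter> D s = {}" and z: "z \<in> D t"
  shows "\<beta> - K * \<bar>t - s\<bar> \<le> norm (z - y)"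
proof (rule field_le_epsilon)
  fix e :: real assume e: "0 < e"
  then have "K * \<bar>t - s\<bar> < K * \<bar>t - s\<bar> + e" by simp
  then obtain x where x: "x \<in> D s" "dist z x < K * \<bar>t - s\<bar> + e" using D_near[OF t s z] by blast
  have "\<beta> \<le> dist y x" using x y by (force simp: not_less mem_ball)
  also have "\<dots> \<le> dist y z + dist z x" by (rule dist_triangle)
  finally show "\<beta> - K * \<bar>t - s\<bar> \<le> norm (z - y) + e"
    using x by (simp add: dist_norm norm_minus_commute)
qed

end

section \<open>Escaping after an exit is unlikely\<close>

context regular_domain
begin

text \<open>\<open>avoid_bound\<close> without drift, for the exterior ball at a frontier point near
  \<open>x\<close>. Since \<open>R\<close> is at least \<open>\<beta> / 2\<close>, the constants 64
  and 14 supply the factors 16 and 48 demanded there (\<open>196 = 4 * 49\<close>), and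
  \<open>s \<le> \<beta> / (32 * K)\<close> lets the ball survive for the time
  \<open>2 * s\<close>.\<close>

lemma forward_kernel_bound:
  fixes s b \<epsilon> lam :: real
  assumes eps: "0 < \<epsilon>" "\<epsilon> \<le> \<beta> / 2" and s: "0 < s" "s \<le> \<beta> / (32 * K)" and b: "0 < b" "b + 2 * s < T"
    and lam: "0 < lam" "64 * (2 * K * \<beta> + CARD('m)) / \<beta>\<^sup>2 \<le> lam" "14 / (\<beta> * sqrt s) \<le> lam"
    and U: "\<And>t x. 0 < t \<Longrightarrow> t < T \<Longrightarrow> x \<in> U t \<Longrightarrow> \<exists>z\<in>D t. dist x z < \<epsilon>"
    and Um: "\<And>t. 0 < t \<Longrightarrow> t < T \<Longrightarrow> U t \<in> sets borel"
  obtains h0 where "0 < h0"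
    "\<And>h k t x C. 0 < h \<Longrightarrow> h < h0 \<Longrightarrow> s \<le> real k * h \<Longrightarrow> real k * h \<le> 2 * s \<Longrightarrow> 0 < t \<Longrightarrow> t \<le> b \<Longrightarrow>
      bdist t x < \<epsilon> \<Longrightarrow> (\<And>j. j \<le> k \<Longrightarrow> C j = U (t + real j * h)) \<Longrightarrow> (\<And>j. C j \<in> sets borel) \<Longrightarrow> 
      forward_kernel h k C x \<le> ennreal (10 * lam * \<beta> * \<epsilon>)"
proof -
  \<comment> \<open>A walk that is only known to stay within \<epsilon> of the domain can enter the
    exterior ball to a depth below \<epsilon>, so it avoids the ball of radius \<open>R\<close>. The
    rate \<open>L\<close> bounds the loss of squared radius per unit of time, and \<open>eta\<close>
    makes the overshoot term equal to \<open>2 * lam * \<beta> * \<epsilon>\<close>.\<close>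
  define R where "R = \<beta> - \<epsilon>"
  define L where "L = 2 * K * \<beta>"
  define eta where "eta = ln (1 + lam * \<beta> * \<epsilon>) / lam"
  have R: "0 < R" "\<beta> / 2 \<le> R" "R \<le> \<beta>" using eps beta by (auto simp: R_def)
  have R2: "\<beta>\<^sup>2 / 4 \<le> R\<^sup>2" using power_mono[OF R(2), of 2] beta by (simp add: power_divide)
  have L: "0 \<le> L" using K beta by (simp add: L_def)
  have eta: "0 < eta" "exp (lam * eta) - 1 = lam * \<beta> * \<epsilon>"
    using lam beta eps by (auto simp: eta_def add_pos_pos)
  have cond: "L + CARD('m) + 2 * sqrt (R\<^sup>2 + 1 / lam) * 0 + 0 \<le> lam * R\<^sup>2 / 16"
  proof -
    have "64 * (L + CARD('m)) \<le> lam * \<beta>\<^sup>2" using lam(2) beta by (simp add: L_def divide_le_eq)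
    also have "\<dots> \<le> lam * (4 * R\<^sup>2)" using R2 lam by (intro mult_left_mono) auto
    finally show ?thesis by simp
  qed
  have conds: "1 / s \<le> lam\<^sup>2 * R\<^sup>2 / 48"
  proof -
    have "14 / sqrt s \<le> lam * \<beta>" using lam(3) beta s by (simp add: field_simps)
    then have "(14 / sqrt s)\<^sup>2 \<le> (lam * \<beta>)\<^sup>2" using s by (intro power_mono) auto
    then have "196 / s \<le> lam\<^sup>2 * \<beta>\<^sup>2" using s by (simp add: power_divide power_mult_distrib)
    also have "\<dots> \<le> lam\<^sup>2 * (4 * R\<^sup>2)" using R2 by (intro mult_left_mono) auto
    finally show ?thesis using s by (simp add: field_simps)
  qed
  show thesis
  proof (rule avoid_bound[where 'm = 'm, OF R(1) L order_refl lam(1) s(1) eta(1) cond conds])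
    fix h0 assume h0: "0 < h0" and av: "\<And>h n a v p (y :: real ^ 'm) x. 0 < h \<Longrightarrow> h < h0 \<Longrightarrow> s \<le> real n * h \<Longrightarrow> 2 * L * (real n * h) \<le> R\<^sup>2 \<Longrightarrow>
        (\<And>j. j < n \<Longrightarrow> h / 2 \<le> v j \<and> v j \<le> h) \<Longrightarrow>
        (\<And>j z. j < n \<Longrightarrow> (norm (z - y))\<^sup>2 \<le> R\<^sup>2 + 1 / lam \<Longrightarrow> norm ((a j - 1) *\<^sub>R z) \<le> 0 * h) \<Longrightarrow>
        (\<And>j. j \<le> n \<Longrightarrow> p j \<in> borel_measurable borel) \<Longrightarrow>
        (\<And>j z. j \<le> n \<Longrightarrow> p j z \<le> 1) \<Longrightarrow>
        (\<And>j z. j \<le> n \<Longrightarrow> (norm (z - y))\<^sup>2 < R\<^sup>2 - L * (real j * h) \<Longrightarrow> p j z = 0) \<Longrightarrow>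
        (\<And>j z. j < n \<Longrightarrow> p j z \<le> (\<integral>\<^sup>+ x. p (Suc j) (a j *\<^sub>R z + x) \<partial>gauss_measure (v j))) \<Longrightarrow>
        p 0 x \<le> ennreal (2 * lam * max 0 ((norm (x - y))\<^sup>2 - R\<^sup>2) + 2 * (exp (lam * eta) - 1))"
    show thesis
    proof (rule that[OF h0])
      fix h :: real and k :: nat and t :: real and x :: "real ^ 'm" and C :: "nat \<Rightarrow> (real ^ 'm) set"
      assume h: "0 < h" "h < h0" and k: "s \<le> real k * h" "real k * h \<le> 2 * s" and t: "0 < t" "t \<le> b"
        and x: "bdist t x < \<epsilon>" and C: "\<And>j. j \<le> k \<Longrightarrow> C j = U (t + real j * h)" and Cm: "\<And>j. C j \<in> sets borel"
      have tT: "t < T" using t b s by linarith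
      show "forward_kernel h k C x \<le> ennreal (10 * lam * \<beta> * \<epsilon>)"
      proof (cases "x \<in> C 0")
        case False
        then have "forward_kernel h k C x = 0" by (cases k) auto
        then show ?thesis by simp
      next
        case True
        then have xU: "x \<in> U t" using C[of 0] by simp
        \<comment> \<open>Inside the section the nearest complement point serves; outside it, the
          segment from \<open>x\<close> to a point of the section at distance below \<epsilon>
          crosses the frontier.\<close>
        obtain g where g: "g \<in> frontier (D t)" "dist x g < \<epsilon>"
        proof (cases "x \<in> D t")
          case True
          then have "x \<in> closure (D t)" using closure_subset by auto
          then show thesis using nearest_frontier_point[OF t(1) tT, of x] x that by metis
        next
          case False
          obtain z where z: "z \<in> D t" "dist x z < \<epsilon>" using U[OF t(1) tT xU] by blast
          have "closed_segment x z \<inter> frontier (D t) \<noteq> {}"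
            using False z by (intro connected_Int_frontier) auto
          then obtain g where "g \<in> closed_segment x z" "g \<in> frontier (D t)" by auto
          then show thesis using that[of g] z(2) segment_bound(1)[of g x z] by (simp add: dist_norm norm_minus_commute)
        qed
        obtain y where y: "ball y \<beta> \<inter> D t = {}" "dist y g = \<beta>" using ext_ball[OF t(1) tT g(1)] by blast
        have xy: "norm (x - y) \<le> \<beta> + \<epsilon>"
          using dist_triangle[of x y g] g(2) y(2) by (simp add: dist_norm norm_minus_commute)
        have tj: "0 < t + real j * h" "t + real j * h < T" if "j \<le> k" for j
        proof -
          have "real j * h \<le> real k * h" using that h by (intro mult_right_mono) auto
          then show "t + real j * h < T" using k t b by linarith
          show "0 < t + real j * h" using t h by (simp add: add_pos_nonneg)
        qed
        define p where "p j = forward_kernel h (k - j) (\<lambda>i. C (i + j))" for j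
        have "p 0 x \<le> ennreal (2 * lam * max 0 ((norm (x - y))\<^sup>2 - R\<^sup>2) + 2 * (exp (lam * eta) - 1))"
        proof (rule av[of h k "\<lambda>_. h" y "\<lambda>_. 1" p x, OF h k(1)])
          have "2 * L * (real k * h) \<le> 2 * L * (2 * s)" using k L by (intro mult_left_mono) auto
          also have "\<dots> \<le> 2 * L * (2 * (\<beta> / (32 * K)))" using s L by (intro mult_left_mono) auto
          also have "\<dots> = \<beta>\<^sup>2 / 4" using K by (simp add: L_def power2_eq_square)
          also have "\<dots> \<le> R\<^sup>2" by (rule R2)
          finally show "2 * L * (real k * h) \<le> R\<^sup>2" .
        next
          fix j
          show "p j \<in> borel_measurable borel"
            unfolding p_def by (intro borel_measurable_forward_kernel h Cm)
          fix z :: "real ^ 'm"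
          show "p j z \<le> 1" unfolding p_def by (rule forward_kernel_le_1[OF h(1)])
          {
            assume j: "j \<le> k" and z: "(norm (z - y))\<^sup>2 < R\<^sup>2 - L * (real j * h)"
            have "z \<notin> C j"
            proof
              assume "z \<in> C j"
              then have "z \<in> U (t + real j * h)" using C j by simp
              then obtain z' where z': "z' \<in> D (t + real j * h)" "dist z z' < \<epsilon>" using U tj[OF j] by blast
              have jh: "0 \<le> real j * h" using h by simp
              have "\<beta> - K * (real j * h) \<le> norm (z' - y)"
                using avoids_shrinking_ball[OF t(1) tT tj[OF j] y(1) z'(1)] jh by simp
              also have "norm (z' - y) \<le> norm (z - y) + \<epsilon>"
                using norm_triangle_ineq[of "z - y" "z' - z"] z'(2) by (simp add: dist_norm norm_minus_commute)
              finally have "R - K * (real j * h) \<le> norm (z - y)" by (simp add: R_def)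
              then have "R\<^sup>2 - 2 * R * (K * (real j * h)) \<le> (norm (z - y))\<^sup>2"
                using R K jh by (intro power2_ge_diff) auto
              moreover have "2 * R * (K * (real j * h)) \<le> L * (real j * h)"
                using mult_right_mono[OF R(3), of "2 * K * (real j * h)"] K jh by (simp add: L_def mult_ac)
              ultimately show False using z by linarith
            qed
            then show "p j z = 0" unfolding p_def by (cases "k - j") auto
          }
          {
            assume j: "j < k"
            then have "k - j = Suc (k - Suc j)" by simp
            then have "p j z = indicator (C j) z * (\<integral>\<^sup>+ x. p (Suc j) (1 *\<^sub>R z + x) \<partial>gauss_measure h)"
              unfolding p_def by simp
            also have "\<dots> \<le> 1 * (\<integral>\<^sup>+ x. p (Suc j) (1 *\<^sub>R z + x) \<partial>gauss_measure h)"
              by (intro mult_right_mono) (auto simp: indicator_def)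
            finally show "p j z \<le> (\<integral>\<^sup>+ x. p (Suc j) (1 *\<^sub>R z + x) \<partial>gauss_measure h)" by simp
          }
        qed (use h in auto)
        also have "p 0 x = forward_kernel h k C x" by (simp add: p_def)
        also have "ennreal (2 * lam * max 0 ((norm (x - y))\<^sup>2 - R\<^sup>2) + 2 * (exp (lam * eta) - 1)) \<le> ennreal (10 * lam * \<beta> * \<epsilon>)"
        proof (intro ennreal_leI)
          have "(norm (x - y))\<^sup>2 \<le> (\<beta> + \<epsilon>)\<^sup>2" using xy by (intro power_mono) auto
          \<comment> \<open>The start lies at most \<open>\<beta> + \<epsilon>\<close> from the
            centre of a ball of radius \<open>\<beta> - \<epsilon>\<close>. The two terms of the
            barrier contribute 8 and 2 to the constant 10.\<close>
          also have "(\<beta> + \<epsilon>)\<^sup>2 = R\<^sup>2 + 4 * \<beta> * \<epsilon>" by (simp add: R_def power2_eq_square algebra_simps)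
          finally have "max 0 ((norm (x - y))\<^sup>2 - R\<^sup>2) \<le> 4 * \<beta> * \<epsilon>" using beta eps by simp
          then have "2 * lam * max 0 ((norm (x - y))\<^sup>2 - R\<^sup>2) \<le> 2 * lam * (4 * \<beta> * \<epsilon>)"
            using lam by (intro mult_left_mono) auto
          then show "2 * lam * max 0 ((norm (x - y))\<^sup>2 - R\<^sup>2) + 2 * (exp (lam * eta) - 1) \<le> 10 * lam * \<beta> * \<epsilon>"
            unfolding eta(2) by (simp add: mult_ac)
        qed
        finally show ?thesis .
      qed
    qed
  qed
qed

text \<open>The bound \<open>10 * lam * \<beta>\<close> with every term of \<open>lam\<close> put
  over \<open>sqrt (T - b)\<close>: the terms that stay bounded as \<open>b\<close> tends to
  \<open>T\<close> acquire the factor \<open>sqrt T\<close>.\<close>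

definition escape_const :: real where
  "escape_const = 10 * \<beta> * ((64 * (2 * K * \<beta> + CARD('m)) / \<beta>\<^sup>2 + 14 * sqrt (32 * K / \<beta>) / \<beta>) * sqrt T + 28 / \<beta>)"

text \<open>The first grid time at distance below \<delta> from the complement replaces the exit
  time: it takes finitely many values, so the simple Markov property suffices. Every exiting path
  passes such a time on fine grids, and every such path belongs to \<open>Near\<close>.\<close>

lemma escape_Near:
  assumes ab: "0 < a" "a < b" "b < T" and A: "A \<in> sets (past a)"
    and eps: "0 < \<epsilon>" "\<epsilon> \<le> \<beta> / 2" and delta: "0 < \<delta>" "\<delta> < \<epsilon>"
    and U: "\<And>t x. 0 < t \<Longrightarrow> t < T \<Longrightarrow> x \<in> U t \<Longrightarrow> \<exists>z\<in>D t. dist x z < \<epsilon>"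
    and Um: "\<And>t. 0 < t \<Longrightarrow> t < T \<Longrightarrow> U t \<in> sets borel"
  shows "emeasure M (A \<inter> Exit a b \<inter> {\<omega> \<in> space M. \<forall>u\<in>{0<..<T}. W u \<omega> \<in> U u}) \<le>
    ennreal (escape_const * \<epsilon> / sqrt (T - b)) * emeasure M (A \<inter> Near \<delta> a b)"
proof -
  \<comment> \<open>The time during which the escaping path is watched: short enough for the
    exterior ball to persist and for the grid walk, which may last almost \<open>2 * s\<close>, to
    end before \<open>T\<close>.\<close>
  define s where "s = min (\<beta> / (32 * K)) ((T - b) / 4)"
  have s: "0 < s" "s \<le> \<beta> / (32 * K)" using beta K ab by (auto simp: s_def)
  have "s \<le> (T - b) / 4" unfolding s_def by (rule min.cobounded2)
  then have s4: "4 * s \<le> T - b" by simp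
  define lam where "lam = 64 * (2 * K * \<beta> + CARD('m)) / \<beta>\<^sup>2 + 14 / (\<beta> * sqrt s)"
  have p1: "0 < 64 * (2 * K * \<beta> + CARD('m)) / \<beta>\<^sup>2" using K beta by (simp add: add_pos_pos)
  have p2: "0 < 14 / (\<beta> * sqrt s)" using s beta by simp
  have lam: "0 < lam" "64 * (2 * K * \<beta> + CARD('m)) / \<beta>\<^sup>2 \<le> lam" "14 / (\<beta> * sqrt s) \<le> lam"
    unfolding lam_def using p1 p2 by linarith+
  have lam_le: "10 * lam * \<beta> * \<epsilon> \<le> escape_const * \<epsilon> / sqrt (T - b)"
  proof -
    have Tb: "0 < sqrt (T - b)" "sqrt (T - b) \<le> sqrt T" using ab by auto
    have "1 / sqrt s \<le> sqrt (32 * K / \<beta>) + 2 / sqrt (T - b)"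
    proof (cases "\<beta> / (32 * K) \<le> (T - b) / 4")
      case True
      then have "s = \<beta> / (32 * K)" by (simp add: s_def)
      then show ?thesis using Tb by (simp add: real_sqrt_divide)
    next
      case False
      then have "s = (T - b) / 4" unfolding s_def by (simp only: min_def if_False)
      have "sqrt s = sqrt (T - b) / 2"
        unfolding \<open>s = (T - b) / 4\<close> by (simp only: real_sqrt_divide real_sqrt_four)
      then have "1 / sqrt s = 2 / sqrt (T - b)" by (simp only: divide_divide_eq_right mult_1_left)
      moreover have "0 \<le> sqrt (32 * K / \<beta>)" using K beta by simp
      ultimately show ?thesis by linarith
    qed
    then have "14 / \<beta> * (1 / sqrt s) \<le> 14 / \<beta> * (sqrt (32 * K / \<beta>) + 2 / sqrt (T - b))"
      using beta by (intro mult_left_mono) auto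
    then have "lam \<le> (64 * (2 * K * \<beta> + CARD('m)) / \<beta>\<^sup>2 + 14 * sqrt (32 * K / \<beta>) / \<beta>) * 1 + 28 / \<beta> / sqrt (T - b)"
      by (simp add: lam_def algebra_simps)
    also have "\<dots> \<le> (64 * (2 * K * \<beta> + CARD('m)) / \<beta>\<^sup>2 + 14 * sqrt (32 * K / \<beta>) / \<beta>) * (sqrt T / sqrt (T - b)) + 28 / \<beta> / sqrt (T - b)"
      using p1 beta K Tb by (intro add_right_mono mult_left_mono) (auto intro!: add_nonneg_nonneg)
    also have "\<dots> = ((64 * (2 * K * \<beta> + CARD('m)) / \<beta>\<^sup>2 + 14 * sqrt (32 * K / \<beta>) / \<beta>) * sqrt T + 28 / \<beta>) / sqrt (T - b)"
      by (simp add: add_divide_distrib)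
    finally have "10 * \<beta> * \<epsilon> * lam \<le> 10 * \<beta> * \<epsilon> * (((64 * (2 * K * \<beta> + CARD('m)) / \<beta>\<^sup>2 + 14 * sqrt (32 * K / \<beta>) / \<beta>) * sqrt T + 28 / \<beta>) / sqrt (T - b))"
      using beta eps by (intro mult_left_mono) auto
    then show ?thesis by (simp only: escape_const_def mult_ac times_divide_eq_right times_divide_eq_left)
  qed
  have "b + 2 * s < T" using ab(3) s4 by linarith
  then have b: "0 < b" "b + 2 * s < T" using ab by auto
  show ?thesis
  proof (rule forward_kernel_bound[OF eps s(1,2) b lam U Um])
    fix h0 assume h0: "0 < h0" and fk:
      "\<And>h k t x C. 0 < h \<Longrightarrow> h < h0 \<Longrightarrow> s \<le> real k * h \<Longrightarrow> real k * h \<le> 2 * s \<Longrightarrow> 0 < t \<Longrightarrow> t \<le> b \<Longrightarrow>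
        bdist t x < \<epsilon> \<Longrightarrow> (\<And>j. j \<le> k \<Longrightarrow> C j = U (t + real j * h)) \<Longrightarrow> (\<And>j. C j \<in> sets borel) \<Longrightarrow>
        forward_kernel h k C x \<le> ennreal (10 * lam * \<beta> * \<epsilon>)"
    define h where "h n = (b - a) / real (Suc n)" for n
    define k where "k n = nat \<lceil>s / h n\<rceil>" for n
    define t where "t n i = a + real i * h n" for n i :: nat
    \<comment> \<open>Times beyond index \<open>k n\<close> may leave the interval from 0 to T,
      where nothing is known about \<open>U\<close>; \<open>UNIV\<close> keeps every set
      borel.\<close>
    define C where "C n i j = (if j \<le> k n then U (t n i + real j * h n) else UNIV)" for n i j
    define F where "F n i = A \<inter> {\<omega> \<in> space M. (\<forall>j<i. \<delta> \<le> bdist (t n j) (W (t n j) \<omega>)) \<and> bdist (t n i) (W (t n i) \<omega>) < \<delta>}" for n i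
    define E where "E n = (\<Union>i\<in>{..Suc n}. F n i \<inter> {\<omega> \<in> space M. \<forall>j\<le>k n. W (t n i + real j * h n) \<omega> \<in> U (t n i + real j * h n)})" for n
    have h: "0 < h n" for n using ab by (simp add: h_def)
    have hk: "s \<le> real (k n) * h n" "real (k n) * h n \<le> s + h n" for n
    proof -
      have "0 \<le> s / h n" using s h[of n] by simp
      then have "s / h n \<le> real (k n)" "real (k n) \<le> s / h n + 1" unfolding k_def by linarith+
      then have "s / h n * h n \<le> real (k n) * h n" "real (k n) * h n \<le> (s / h n + 1) * h n"
        using h[of n] by (intro mult_right_mono; simp)+
      then show "s \<le> real (k n) * h n" "real (k n) * h n \<le> s + h n" using h[of n] by (auto simp: distrib_right)
    qed
    have t: "0 < t n i" "a \<le> t n i" "t n i \<le> b" if "i \<le> Suc n" for n i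
    proof -
      have "real i * h n \<le> real (Suc n) * h n" using that h[of n] by (intro mult_right_mono) auto
      then show "t n i \<le> b" by (simp add: t_def h_def del: of_nat_Suc)
      have "0 \<le> real i * h n" using h[of n] by simp
      then show "a \<le> t n i" "0 < t n i" using ab by (auto simp: t_def)
    qed
    have tm: "t n j \<le> t n i" if "j \<le> i" for n i j
      using that h[of n] by (auto simp: t_def intro!: mult_right_mono)
    have ubd: "0 < t n i + real j * h n" "t n i + real j * h n < T" if "i \<le> Suc n" "j \<le> k n" "h n < s" for n i j
    proof -
      have "real j * h n \<le> real (k n) * h n" using that h[of n] by (intro mult_right_mono) auto
      then show "t n i + real j * h n < T" using hk(2)[of n] t(3)[OF that(1)] that(3) b by linarith
      have "0 \<le> real j * h n" using h[of n] by simp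
      then show "0 < t n i + real j * h n" using t(1)[OF that(1)] by linarith
    qed
    have Fm: "F n i \<in> sets (past (t n i))" if i: "i \<le> Suc n" for n i
    proof -
      have bm: "(\<lambda>\<omega>. bdist (t n j) (W (t n j) \<omega>)) \<in> borel_measurable (past (t n i))" if "j \<le> i" for j
        using that t[of j n] i tm[OF that, of n] by (intro measurable_compose[OF W_measurable_past bdist_measurable]) auto
      have "{\<omega> \<in> space (past (t n i)). \<forall>j\<in>{..<i}. \<delta> \<le> bdist (t n j) (W (t n j) \<omega>)} \<in> sets (past (t n i))"
        by (intro sets.sets_Collect_finite_All borel_measurable_le bm finite_lessThan borel_measurable_const) simp
      moreover have "{\<omega> \<in> space (past (t n i)). bdist (t n i) (W (t n i) \<omega>) < \<delta>} \<in> sets (past (t n i))"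
        by (intro borel_measurable_less bm order_refl borel_measurable_const)
      moreover have "A \<in> sets (past (t n i))" using A past_mono[OF t(2)[OF i]] by auto
      ultimately have "A \<inter> ({\<omega> \<in> space (past (t n i)). \<forall>j\<in>{..<i}. \<delta> \<le> bdist (t n j) (W (t n j) \<omega>)} \<inter> {\<omega> \<in> space (past (t n i)). bdist (t n i) (W (t n i) \<omega>) < \<delta>}) \<in> sets (past (t n i))"
        by (intro sets.Int)
      also have "A \<inter> ({\<omega> \<in> space (past (t n i)). \<forall>j\<in>{..<i}. \<delta> \<le> bdist (t n j) (W (t n j) \<omega>)} \<inter> {\<omega> \<in> space (past (t n i)). bdist (t n i) (W (t n i) \<omega>) < \<delta>}) = F n i"
        unfolding F_def space_past by blast
      finally show ?thesis .
    qed
    have FM: "F n i \<in> sets M" if "i \<le> Suc n" for n i using Fm[OF that] sets_past_subset by blast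
    have NM: "A \<inter> Near \<delta> a b \<in> sets M"
      using A Near_past[of a b \<delta>] ab sets_past_subset by (intro sets.Int) auto
    have disj: "disjoint_family_on (F n) {..Suc n}" for n
    proof -
      have "F n i \<inter> F n j = {}" if "i < j" for i j
        using that by (auto simp: F_def dest!: spec[of _ i])
      then show ?thesis unfolding disjoint_family_on_def by (metis Int_commute nat_neq_iff)
    qed
    have Fsub: "(\<Union>i\<in>{..Suc n}. F n i) \<subseteq> A \<inter> Near \<delta> a b" for n
    proof
      fix \<omega> assume "\<omega> \<in> (\<Union>i\<in>{..Suc n}. F n i)"
      then obtain i where i: "i \<le> Suc n" "\<omega> \<in> F n i" by auto
      then have "t n i \<in> {a..b}" "bdist (t n i) (W (t n i) \<omega>) \<le> \<delta>" "\<omega> \<in> A" "\<omega> \<in> space M"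
        using t[OF i(1)] by (auto simp: F_def)
      then show "\<omega> \<in> A \<inter> Near \<delta> a b" unfolding Near_def by blast
    qed
    have Cm: "C n i j \<in> sets borel" if "i \<le> Suc n" "h n < s" for n i j
      using Um ubd[OF that(1) _ that(2)] by (auto simp: C_def)
    have Eeq: "F n i \<inter> {\<omega> \<in> space M. \<forall>j\<le>k n. W (t n i + real j * h n) \<omega> \<in> U (t n i + real j * h n)} =
        F n i \<inter> {\<omega> \<in> space M. \<forall>j\<le>k n. W (t n i + real j * h n) \<omega> \<in> C n i j}" for n i
      by (auto simp: C_def)
    have Gm: "F n i \<inter> {\<omega> \<in> space M. \<forall>j\<le>k n. W (t n i + real j * h n) \<omega> \<in> C n i j} \<in> sets M"
      if "i \<le> Suc n" "h n < s" for n i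
    proof -
      have "{\<omega> \<in> space M. \<forall>j\<le>k n. W (t n i + real j * h n) \<omega> \<in> C n i j} \<in> sets (past (t n i + real (k n) * h n))"
        by (rule measurable_stay_grid[OF less_imp_le[OF t(1)[OF that(1)]] less_imp_le[OF h] Cm[OF that] order_refl])
      from subsetD[OF sets_past_subset this] show ?thesis by (rule sets.Int[OF FM[OF that(1)]])
    qed
    have hlim: "h \<longlonglongrightarrow> 0"
      unfolding h_def by (intro LIMSEQ_Suc[OF lim_const_over_n])
    have ev: "eventually (\<lambda>n. h n < min h0 s) sequentially"
      using h0 s by (intro order_tendstoD(2)[OF hlim]) auto
    \<comment> \<open>The measurability of \<open>E n\<close> and the kernel bound both require a
      fine mesh, whereas \<open>emeasure_eventually_le\<close> asks for measurability at every
      index; hence the shift by \<open>n0\<close>.\<close>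
    then obtain n0 where n0: "\<And>n. n0 \<le> n \<Longrightarrow> h n < h0 \<and> h n < s" unfolding eventually_sequentially by auto
    have EM: "E (n + n0) \<in> sets M" for n
      unfolding E_def Eeq
    proof (rule sets.finite_UN[OF finite_atMost])
      fix i assume "i \<in> {..Suc (n + n0)}"
      then show "F (n + n0) i \<inter> {\<omega> \<in> space M. \<forall>j\<le>k (n + n0). W (t (n + n0) i + real j * h (n + n0)) \<omega> \<in> C (n + n0) i j} \<in> sets M"
        using n0[of "n + n0"] by (intro Gm) simp_all
    qed
    have "emeasure M (A \<inter> Exit a b \<inter> {\<omega> \<in> space M. \<forall>u\<in>{0<..<T}. W u \<omega> \<in> U u}) \<le> ennreal (10 * lam * \<beta> * \<epsilon>) * emeasure M (A \<inter> Near \<delta> a b)"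
    proof (rule emeasure_eventually_le[where E = "\<lambda>n. E (n + n0)"])
      show "E (n + n0) \<in> sets M" for n by (rule EM)
      have "emeasure M (E n) \<le> ennreal (10 * lam * \<beta> * \<epsilon>) * emeasure M (A \<inter> Near \<delta> a b)" if n: "h n < h0" "h n < s" for n
      proof -
        have "emeasure M (E n) \<le> (\<Sum>i\<in>{..Suc n}. emeasure M (F n i \<inter> {\<omega> \<in> space M. \<forall>j\<le>k n. W (t n i + real j * h n) \<omega> \<in> C n i j}))"
          unfolding E_def Eeq by (intro emeasure_subadditive_finite image_subsetI Gm) (use n in auto)
        also have "\<dots> \<le> (\<Sum>i\<in>{..Suc n}. ennreal (10 * lam * \<beta> * \<epsilon>) * emeasure M (F n i))"
        proof (rule sum_mono)
          fix i assume "i \<in> {..Suc n}"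
          then have i: "i \<le> Suc n" by simp
          have "emeasure M (F n i \<inter> {\<omega> \<in> space M. \<forall>j\<le>k n. W (t n i + real j * h n) \<omega> \<in> C n i j}) =
              (\<integral>\<^sup>+ \<omega>. indicator (F n i) \<omega> * forward_kernel (h n) (k n) (C n i) (W (t n i) \<omega>) \<partial>M)"
            by (rule forward_kernel_stay[OF h less_imp_le[OF t(1)[OF i]] Fm[OF i] Cm[OF i n(2)]])
          also have "\<dots> \<le> (\<integral>\<^sup>+ \<omega>. ennreal (10 * lam * \<beta> * \<epsilon>) * indicator (F n i) \<omega> \<partial>M)"
          proof (rule nn_integral_mono)
            fix \<omega>
            show "indicator (F n i) \<omega> * forward_kernel (h n) (k n) (C n i) (W (t n i) \<omega>) \<le> ennreal (10 * lam * \<beta> * \<epsilon>) * indicator (F n i) \<omega>"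
            proof (cases "\<omega> \<in> F n i")
              case True
              then have "bdist (t n i) (W (t n i) \<omega>) < \<epsilon>" using delta by (auto simp: F_def)
              then have "forward_kernel (h n) (k n) (C n i) (W (t n i) \<omega>) \<le> ennreal (10 * lam * \<beta> * \<epsilon>)"
                using hk[of n] n t[OF i] Cm[OF i n(2)] by (intro fk[OF h n(1)]) (auto simp: C_def)
              then show ?thesis using True by simp
            qed simp
          qed
          also have "\<dots> = ennreal (10 * lam * \<beta> * \<epsilon>) * emeasure M (F n i)"
            using FM[OF i] by (subst nn_integral_cmult) auto
          finally show "emeasure M (F n i \<inter> {\<omega> \<in> space M. \<forall>j\<le>k n. W (t n i + real j * h n) \<omega> \<in> C n i j}) \<le> ennreal (10 * lam * \<beta> * \<epsilon>) * emeasure M (F n i)" .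
        qed
        also have "\<dots> = ennreal (10 * lam * \<beta> * \<epsilon>) * emeasure M (\<Union>i\<in>{..Suc n}. F n i)"
          unfolding sum_distrib_left [symmetric] using FM
          by (subst sum_emeasure[OF _ disj]) auto
        also have "\<dots> \<le> ennreal (10 * lam * \<beta> * \<epsilon>) * emeasure M (A \<inter> Near \<delta> a b)"
          by (intro mult_left_mono emeasure_mono Fsub NM) auto
        finally show ?thesis .
      qed
      then show "eventually (\<lambda>n. emeasure M (E (n + n0)) \<le> ennreal (10 * lam * \<beta> * \<epsilon>) * emeasure M (A \<inter> Near \<delta> a b)) sequentially"
        using n0 by (intro always_eventually allI) (auto simp del: n0)
      fix \<omega> assume w: "\<omega> \<in> A \<inter> Exit a b \<inter> {\<omega> \<in> space M. \<forall>u\<in>{0<..<T}. W u \<omega> \<in> U u}"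
      then obtain u where u: "u \<in> {a..b}" "W u \<omega> \<notin> D u" "\<omega> \<in> space M" "\<omega> \<in> A" and st: "\<And>v. 0 < v \<Longrightarrow> v < T \<Longrightarrow> W v \<omega> \<in> U v"
        unfolding Exit_def by auto
      have "bdist u (W u \<omega>) = 0" using bdist_eq_0[of u] u ab by auto
      then have "eventually (\<lambda>n. \<exists>i\<le>Suc n. bdist (a + real i * ((b - a) / real (Suc n))) (W (a + real i * ((b - a) / real (Suc n))) \<omega>) \<in> {..<\<delta>}) sequentially"
        using delta by (intro eventually_grid[OF ab(2) u(1) bdist_path_continuous[OF ab(1,3) u(3)]]) auto
      then have "eventually (\<lambda>n. \<exists>i\<le>Suc n. bdist (t n i) (W (t n i) \<omega>) < \<delta>) sequentially"
        by (simp only: t_def h_def lessThan_iff)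
      then have "eventually (\<lambda>n. \<exists>i\<le>Suc (n + n0). bdist (t (n + n0) i) (W (t (n + n0) i) \<omega>) < \<delta>) sequentially"
        by (rule eventually_sequentially_seg[THEN iffD2])
      then show "eventually (\<lambda>n. \<omega> \<in> E (n + n0)) sequentially"
      proof eventually_elim
        case (elim n')
        define n where "n = n' + n0"
        have hn: "h n < s" using n0[of n] by (simp add: n_def)
        define P where "P i \<longleftrightarrow> bdist (t n i) (W (t n i) \<omega>) < \<delta>" for i
        obtain i where i: "i \<le> Suc n" "P i" using elim by (auto simp: P_def n_def)
        define j where "j = (LEAST i. P i)"
        have j: "P j" "j \<le> i" "\<And>l. l < j \<Longrightarrow> \<not> P l"
          unfolding j_def using i(2) by (auto intro: LeastI Least_le dest: not_less_Least)
        then have "\<omega> \<in> F n j" using u by (auto simp: F_def P_def not_less)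
        moreover have "j \<le> Suc n" using j i by simp
        moreover have "\<forall>l\<le>k n. W (t n j + real l * h n) \<omega> \<in> U (t n j + real l * h n)"
          using st ubd[OF \<open>j \<le> Suc n\<close> _ hn] by blast
        ultimately have "\<omega> \<in> E n" unfolding E_def using u(3) by blast
        then show ?case by (simp only: n_def)
      qed
    qed
    also have "\<dots> \<le> ennreal (escape_const * \<epsilon> / sqrt (T - b)) * emeasure M (A \<inter> Near \<delta> a b)"
      using lam_le by (intro mult_right_mono ennreal_leI) auto
    finally show ?thesis .
  qed
qed

text \<open>As \<delta> tends to 0 the events \<open>Near\<close> decrease to \<open>Exit\<close>,
  because the distance attains its minimum along a path; continuity of the measure passes to the
  limit. The factor that remains, an exit probability, is the one that the density bound
  controls.\<close>

lemma escape_Exit: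
  assumes ab: "0 < a" "a < b" "b < T" and A: "A \<in> sets (past a)"
    and eps: "0 < \<epsilon>" "\<epsilon> \<le> \<beta> / 2"
    and U: "\<And>t x. 0 < t \<Longrightarrow> t < T \<Longrightarrow> x \<in> U t \<Longrightarrow> \<exists>z\<in>D t. dist x z < \<epsilon>"
    and Um: "\<And>t. 0 < t \<Longrightarrow> t < T \<Longrightarrow> U t \<in> sets borel"
  shows "emeasure M (A \<inter> Exit a b \<inter> {\<omega> \<in> space M. \<forall>u\<in>{0<..<T}. W u \<omega> \<in> U u}) \<le>
    ennreal (escape_const * \<epsilon> / sqrt (T - b)) * emeasure M (A \<inter> Exit a b)"
proof -
  define \<delta> where "\<delta> n = \<epsilon> / real (n + 2)" for n
  have d: "0 < \<delta> n" "\<delta> n < \<epsilon>" for n using eps by (auto simp: \<delta>_def field_simps add_pos_nonneg)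
  have dlim: "\<delta> \<longlonglongrightarrow> 0" unfolding \<delta>_def by (rule LIMSEQ_ignore_initial_segment[OF lim_const_over_n])
  have NM: "A \<inter> Near (\<delta> n) a b \<in> sets M" for n
    using A Near_past[of a b "\<delta> n"] ab sets_past_subset by (intro sets.Int) auto
  have inter: "(\<Inter>n. A \<inter> Near (\<delta> n) a b) = A \<inter> Exit a b"
  proof (intro set_eqI iffI)
    fix \<omega> assume w: "\<omega> \<in> (\<Inter>n. A \<inter> Near (\<delta> n) a b)"
    then have sp: "\<omega> \<in> space M" "\<omega> \<in> A" by (auto simp: Near_def)
    obtain u where u: "u \<in> {a..b}" "\<And>v. v \<in> {a..b} \<Longrightarrow> bdist u (W u \<omega>) \<le> bdist v (W v \<omega>)"
      using continuous_attains_inf[OF compact_Icc _ bdist_path_continuous[OF ab(1,3) sp(1)]] ab by auto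
    have "bdist u (W u \<omega>) \<le> \<delta> n" for n
    proof -
      from w have "\<omega> \<in> Near (\<delta> n) a b" by auto
      then obtain v where "v \<in> {a..b}" "bdist v (W v \<omega>) \<le> \<delta> n" by (auto simp: Near_def)
      then show ?thesis using u(2)[of v] by simp
    qed
    then have "bdist u (W u \<omega>) \<le> 0" by (intro LIMSEQ_le_const[OF dlim]) auto
    then show "\<omega> \<in> A \<inter> Exit a b" using sp u(1) unfolding Exit_eq_Near[OF ab(1,3)] Near_def by blast
  next
    fix \<omega> assume w: "\<omega> \<in> A \<inter> Exit a b"
    have "bdist u x \<le> \<delta> n" if "bdist u x \<le> 0" for u x n using that d(1)[of n] by linarith
    with w show "\<omega> \<in> (\<Inter>n. A \<inter> Near (\<delta> n) a b)"
      unfolding Exit_eq_Near[OF ab(1,3)] Near_def by blast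
  qed
  have "(\<lambda>n. emeasure M (A \<inter> Near (\<delta> n) a b)) \<longlonglongrightarrow> emeasure M (\<Inter>n. A \<inter> Near (\<delta> n) a b)"
  proof (rule Lim_emeasure_decseq)
    show "decseq (\<lambda>n. A \<inter> Near (\<delta> n) a b)"
    proof (rule decseq_SucI)
      fix n
      have "\<delta> (Suc n) \<le> \<delta> n" unfolding \<delta>_def using eps by (intro divide_left_mono) auto
      then show "A \<inter> Near (\<delta> (Suc n)) a b \<subseteq> A \<inter> Near (\<delta> n) a b"
        unfolding Near_def by (auto intro: order_trans)
    qed
  qed (use NM in auto)
  then have "(\<lambda>n. ennreal (escape_const * \<epsilon> / sqrt (T - b)) * emeasure M (A \<inter> Near (\<delta> n) a b)) \<longlonglongrightarrow>
      ennreal (escape_const * \<epsilon> / sqrt (T - b)) * emeasure M (A \<inter> Exit a b)"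
    unfolding inter by (intro ennreal_tendsto_cmult) auto
  moreover have "emeasure M (A \<inter> Exit a b \<inter> {\<omega> \<in> space M. \<forall>u\<in>{0<..<T}. W u \<omega> \<in> U u}) \<le>
      ennreal (escape_const * \<epsilon> / sqrt (T - b)) * emeasure M (A \<inter> Near (\<delta> n) a b)" for n
    by (rule escape_Near[OF ab A eps d U Um])
  ultimately show ?thesis by (intro LIMSEQ_le_const) auto
qed

end

section \<open>The law of the first exit time\<close>

context regular_domain
begin

text \<open>The length of the backward walk: for \<open>t\<close> in the second half it stays at
  times at least \<open>T / 4\<close>, which bounds the bridge drift, and the exterior ball persists
  throughout.\<close>

definition back_window :: real where
  "back_window = min (T / 4) (\<beta> / (4 * K))"

text \<open>The three summands secure, in turn, \<open>1 / lam \<le> \<beta>\<^sup>2\<close>, the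
  dominance condition with the drift included, and the condition on the time span, where
  \<open>49 \<ge> 48\<close> is used. The rate actually applied is this one times
  \<open>1 + norm x\<close>.\<close>

definition back_rate :: real where
  "back_rate = 1 / \<beta>\<^sup>2 + 16 / \<beta>\<^sup>2 * (2 * K * \<beta> + CARD('m) + (4 * \<beta> + 1)\<^sup>2 * (4 / T)) + 7 / (\<beta> * sqrt back_window)"

lemma back_window: "0 < back_window" "back_window \<le> T / 4" "4 * K * back_window \<le> \<beta>"
proof -
  show "0 < back_window" using T K beta by (simp add: back_window_def)
  show "back_window \<le> T / 4" unfolding back_window_def by (rule min.cobounded1)
  have "back_window \<le> \<beta> / (4 * K)" unfolding back_window_def by (rule min.cobounded2)
  then show "4 * K * back_window \<le> \<beta>" using K by (simp add: field_simps)
qed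

lemma back_rate: "0 < back_rate" "1 / \<beta>\<^sup>2 \<le> back_rate"
  "16 / \<beta>\<^sup>2 * (2 * K * \<beta> + CARD('m) + (4 * \<beta> + 1)\<^sup>2 * (4 / T)) \<le> back_rate"
  "7 / (\<beta> * sqrt back_window) \<le> back_rate"
proof -
  have 1: "0 < 1 / \<beta>\<^sup>2" using beta by simp
  have 2: "0 \<le> 16 / \<beta>\<^sup>2 * (2 * K * \<beta> + CARD('m) + (4 * \<beta> + 1)\<^sup>2 * (4 / T))"
    using beta K T by (intro mult_nonneg_nonneg add_nonneg_nonneg) auto
  have 3: "0 < 7 / (\<beta> * sqrt back_window)" using beta back_window by simp
  show "0 < back_rate" using 1 2 3 unfolding back_rate_def by linarith
  show "1 / \<beta>\<^sup>2 \<le> back_rate" using 1 2 3 unfolding back_rate_def by linarith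
  show "16 / \<beta>\<^sup>2 * (2 * K * \<beta> + CARD('m) + (4 * \<beta> + 1)\<^sup>2 * (4 / T)) \<le> back_rate" using 1 2 3 unfolding back_rate_def by linarith
  show "7 / (\<beta> * sqrt back_window) \<le> back_rate" using 1 2 3 unfolding back_rate_def by linarith
qed

text \<open>\<open>Stay t\<close> constrains only times before \<open>t\<close>, so at the last
  index continuity leaves only the closure of the section.\<close>

definition grid_sets :: "real \<Rightarrow> nat \<Rightarrow> nat \<Rightarrow> (real ^ 'm) set" where
  "grid_sets t N i = (if i < N then D (t - back_window + real i * (back_window / real N)) else closure (D t))"

text \<open>Seen from \<open>x\<close> at time \<open>t\<close>, the backward walk contracts towards
  the origin with a drift of order \<open>1 + norm x\<close>, which the rate \<open>lam\<close> has
  to dominate. The mesh at which the bound sets in depends on \<open>x\<close> and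
  \<open>eta\<close>; \<open>eta\<close> remains free and is later sent to 0.\<close>

lemma backward_kernel_bound:
  assumes t: "T / 2 \<le> t" "t < T" and x: "x \<in> closure (D t)" "bdist t x \<le> \<beta>" and eta: "0 < eta"
  shows "eventually (\<lambda>n. backward_kernel (t - back_window) (back_window / real (Suc n)) (grid_sets t (Suc n)) (Suc n) x
      \<le> ennreal (6 * \<beta> * back_rate * (1 + norm x) * bdist t x + 2 * (exp (back_rate * (1 + norm x) * eta) - 1))) sequentially"
proof -
  define lam where "lam = back_rate * (1 + norm x)"
  define L where "L = 2 * K * \<beta>"
  \<comment> \<open>The drift matters only for \<open>z\<close> within \<open>2 * \<beta>\<close> of
    the centre \<open>y\<close>, and \<open>y\<close> is within \<open>2 * \<beta>\<close> of
    \<open>x\<close>. As all times are at least \<open>T / 4\<close>, a step moves \<open>z\<close>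
    by at most \<open>4 / T * norm z * h\<close>.\<close>
  define Q where "Q = 4 / T * (norm x + 4 * \<beta>)"
  define r where "r = t - back_window"
  have r: "T / 4 \<le> r" "0 < r" using t T back_window by (auto simp: r_def)
  have tp: "0 < t" using t T by simp
  have nx: "1 \<le> 1 + norm x" by simp
  have lam: "0 < lam" "back_rate \<le> lam" using back_rate(1) mult_left_mono[OF nx, of back_rate] by (auto simp: lam_def add_pos_nonneg)
  have L: "0 \<le> L" using K beta by (simp add: L_def)
  have Q: "0 \<le> Q" using T beta by (simp add: Q_def)
  have il: "1 / lam \<le> \<beta>\<^sup>2"
  proof -
    have "1 / \<beta>\<^sup>2 \<le> lam" using back_rate(2) lam(2) by linarith
    then show ?thesis using beta lam(1) by (simp add: field_simps)
  qed
  have sq: "sqrt (\<beta>\<^sup>2 + 1 / lam) \<le> 2 * \<beta>"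
  proof (rule real_le_lsqrt)
    have "(2 * \<beta>)\<^sup>2 = 4 * \<beta>\<^sup>2" by simp
    then show "\<beta>\<^sup>2 + 1 / lam \<le> (2 * \<beta>)\<^sup>2" using il zero_le_power2[of \<beta>] by linarith
  qed (use beta in simp)
  have cond: "L + CARD('m) + 2 * sqrt (\<beta>\<^sup>2 + 1 / lam) * Q + Q \<le> lam * \<beta>\<^sup>2 / 16"
  proof -
    have "2 * sqrt (\<beta>\<^sup>2 + 1 / lam) * Q + Q \<le> 2 * (2 * \<beta>) * Q + Q"
      using sq Q by (intro add_right_mono mult_right_mono mult_left_mono) auto
    also have "\<dots> = (4 * \<beta> + 1) * (4 / T) * (norm x + 4 * \<beta>)" by (simp add: Q_def algebra_simps add_divide_distrib)
    also have "\<dots> \<le> (4 * \<beta> + 1) * (4 / T) * ((4 * \<beta> + 1) * (1 + norm x))"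
      using beta T by (intro mult_left_mono) (auto simp: algebra_simps)
    also have "\<dots> = (4 * \<beta> + 1)\<^sup>2 * (4 / T) * (1 + norm x)" by (simp only: power2_eq_square mult_ac)
    finally have 1: "2 * sqrt (\<beta>\<^sup>2 + 1 / lam) * Q + Q \<le> (4 * \<beta> + 1)\<^sup>2 * (4 / T) * (1 + norm x)" .
    have 2: "L + CARD('m) \<le> (L + CARD('m)) * (1 + norm x)" using L mult_left_mono[OF nx, of "L + CARD('m)"] by simp
    have "(2 * K * \<beta> + CARD('m) + (4 * \<beta> + 1)\<^sup>2 * (4 / T)) = 16 / \<beta>\<^sup>2 * (2 * K * \<beta> + CARD('m) + (4 * \<beta> + 1)\<^sup>2 * (4 / T)) * (\<beta>\<^sup>2 / 16)"
      using beta by simp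
    also have "\<dots> \<le> back_rate * (\<beta>\<^sup>2 / 16)" by (intro mult_right_mono back_rate(3)) simp
    finally have "(L + CARD('m) + (4 * \<beta> + 1)\<^sup>2 * (4 / T)) * (1 + norm x) \<le> back_rate * (\<beta>\<^sup>2 / 16) * (1 + norm x)"
      unfolding L_def by (rule mult_right_mono) simp
    also have "\<dots> = lam * \<beta>\<^sup>2 / 16" by (simp add: lam_def mult_ac)
    finally have 3: "(L + CARD('m)) * (1 + norm x) + (4 * \<beta> + 1)\<^sup>2 * (4 / T) * (1 + norm x) \<le> lam * \<beta>\<^sup>2 / 16"
      by (simp only: distrib_right)
    show ?thesis using 1 2 3 by linarith
  qed
  have conds: "1 / back_window \<le> lam\<^sup>2 * \<beta>\<^sup>2 / 48"
  proof -
    have "7 / (\<beta> * sqrt back_window) \<le> lam" using back_rate(4) lam(2) by linarith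
    then have "7 / sqrt back_window \<le> lam * \<beta>" using beta back_window by (simp add: field_simps)
    then have "(7 / sqrt back_window)\<^sup>2 \<le> (lam * \<beta>)\<^sup>2" using back_window by (intro power_mono) auto
    then have "49 / back_window \<le> lam\<^sup>2 * \<beta>\<^sup>2" using back_window by (simp add: power_divide power_mult_distrib)
    moreover have "48 / back_window \<le> 49 / back_window" using back_window by (simp add: divide_right_mono)
    ultimately show ?thesis by simp
  qed
  obtain g where g: "g \<in> frontier (D t)" "dist x g = bdist t x"
    using nearest_frontier_point[OF tp t(2) x(1)] .
  obtain y where y: "ball y \<beta> \<inter> D t = {}" "dist y g = \<beta>" using ext_ball[OF tp t(2) g(1)] by blast
  have xy: "norm (x - y) \<le> \<beta> + bdist t x"
    using dist_triangle[of x y g] g(2) y(2) by (simp add: dist_norm norm_minus_commute)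
  show ?thesis
  proof (rule avoid_bound[where 'm = 'm, OF beta L Q lam(1) back_window(1) eta cond conds])
    fix h0 :: real
    assume h0: "0 < h0" and av: "\<And>h n a v p (y :: real ^ 'm) x. 0 < h \<Longrightarrow> h < h0 \<Longrightarrow> back_window \<le> real n * h \<Longrightarrow> 2 * L * (real n * h) \<le> \<beta>\<^sup>2 \<Longrightarrow>
      (\<And>j. j < n \<Longrightarrow> h / 2 \<le> v j \<and> v j \<le> h) \<Longrightarrow>
      (\<And>j z. j < n \<Longrightarrow> (norm (z - y))\<^sup>2 \<le> \<beta>\<^sup>2 + 1 / lam \<Longrightarrow> norm ((a j - 1) *\<^sub>R z) \<le> Q * h) \<Longrightarrow>
      (\<And>j. j \<le> n \<Longrightarrow> p j \<in> borel_measurable borel) \<Longrightarrow>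
      (\<And>j z. j \<le> n \<Longrightarrow> p j z \<le> 1) \<Longrightarrow>
      (\<And>j z. j \<le> n \<Longrightarrow> (norm (z - y))\<^sup>2 < \<beta>\<^sup>2 - L * (real j * h) \<Longrightarrow> p j z = 0) \<Longrightarrow>
      (\<And>j z. j < n \<Longrightarrow> p j z \<le> (\<integral>\<^sup>+ x. p (Suc j) (a j *\<^sub>R z + x) \<partial>gauss_measure (v j))) \<Longrightarrow>
      p 0 x \<le> ennreal (2 * lam * max 0 ((norm (x - y))\<^sup>2 - \<beta>\<^sup>2) + 2 * (exp (lam * eta) - 1))"
    have "(\<lambda>n. back_window / real (Suc n)) \<longlonglongrightarrow> 0" by (intro LIMSEQ_Suc[OF lim_const_over_n])
    then have "eventually (\<lambda>n. back_window / real (Suc n) < h0) sequentially"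
      using h0 by (rule order_tendstoD(2))
    then show ?thesis
    proof eventually_elim
      case (elim n)
      define N where "N = Suc n"
      define h where "h = back_window / real N"
      have N: "0 < N" "1 \<le> real N" by (auto simp: N_def)
      have h: "0 < h" "h < h0" using elim back_window by (auto simp: h_def N_def)
      have Nh: "real N * h = back_window" using N by (simp add: h_def)
      have hr: "h \<le> r"
      proof -
        have "h \<le> back_window" using N back_window by (simp add: h_def divide_le_eq)
        then show ?thesis using r(1) back_window(2) by linarith
      qed
      define C where "C = grid_sets t N"
      \<comment> \<open>The index \<open>j\<close> counts steps back from time \<open>t\<close>, so
        \<open>avoid_bound\<close> sees time running backwards.\<close>
      define p where "p j = backward_kernel r h C (N - j)" for j
      define a where "a j = (r + real (N - Suc j) * h) / (r + real (N - j) * h)" for j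
      have den: "r \<le> r + real i * h" "0 < r + real i * h" for i using r(2) h(1) by (auto simp: add_pos_nonneg)
      have Cm: "C i \<in> sets borel" for i
      proof (cases "i < N")
        case True
        then have "real i * h \<le> real N * h" using h by (intro mult_right_mono) auto
        then have "0 < r + real i * h" "r + real i * h < T" using den[of i] Nh t by (auto simp: r_def)
        then show ?thesis using open_D[of "r + real i * h"] True by (simp add: C_def grid_sets_def r_def h_def)
      qed (simp add: C_def grid_sets_def)
      have rec: "p j z = indicator (C (N - j)) z * (\<integral>\<^sup>+ x. p (Suc j) (a j *\<^sub>R z + x) \<partial>gauss_measure (h * a j))"
        if "j < N" for j z
      proof -
        have "N - j = Suc (N - Suc j)" using that by simp
        then show ?thesis by (simp add: p_def a_def Let_def del: of_nat_Suc)
      qed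
      have a: "1 / 2 \<le> a j" "a j \<le> 1" "norm ((a j - 1) *\<^sub>R z) \<le> 4 / T * norm z * h" if "j < N" for j and z :: "real ^ 'm"
      proof -
        define k where "k = N - Suc j"
        have k: "N - j = Suc k" "N - Suc j = k" using that by (auto simp: k_def)
        have d: "0 < r + real (Suc k) * h" "r \<le> r + real (Suc k) * h" "0 < r + real k * h" by (rule den)+
        have kh: "0 \<le> real k * h" using h by simp
        have kS: "real (Suc k) * h = real k * h + h" by (simp add: algebra_simps)
        show "1 / 2 \<le> a j" unfolding a_def k kS using hr d(1,3) kh unfolding kS by (simp add: le_divide_eq mult.commute)
        show "a j \<le> 1" unfolding a_def k kS using h d(1) unfolding kS by (simp add: divide_le_eq)
        have "a j - 1 = - h / (r + real (Suc k) * h)" unfolding a_def k kS using d(1) unfolding kS by (simp add: field_simps)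
        then have "\<bar>a j - 1\<bar> = h / (r + real (Suc k) * h)" using h d(1) by simp
        also have "\<dots> \<le> h / (T / 4)" using h d r T by (intro divide_left_mono mult_pos_pos) linarith+
        finally have "\<bar>a j - 1\<bar> * norm z \<le> h / (T / 4) * norm z" by (rule mult_right_mono) simp
        then show "norm ((a j - 1) *\<^sub>R z) \<le> 4 / T * norm z * h" by (simp add: mult_ac)
      qed
      have "p 0 x \<le> ennreal (2 * lam * max 0 ((norm (x - y))\<^sup>2 - \<beta>\<^sup>2) + 2 * (exp (lam * eta) - 1))"
      proof (rule av[of h N "\<lambda>j. h * a j" y a p x, OF h])
        show "back_window \<le> real N * h" using Nh by simp
        have "2 * L * (real N * h) = (4 * K * back_window) * \<beta>" by (simp add: Nh L_def)
        also have "\<dots> \<le> \<beta> * \<beta>" using back_window(3) beta by (intro mult_right_mono) auto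
        finally show "2 * L * (real N * h) \<le> \<beta>\<^sup>2" by (simp add: power2_eq_square)
      next
        fix j
        show "p j \<in> borel_measurable borel"
          unfolding p_def by (rule borel_measurable_backward_kernel[OF r(2) h(1) Cm])
        fix z :: "real ^ 'm"
        show "p j z \<le> 1" unfolding p_def by (rule backward_kernel_le_1[OF r(2) h(1)])
        {
          assume j: "j < N"
          show "h / 2 \<le> h * a j \<and> h * a j \<le> h"
            using mult_left_mono[OF a(1)[OF j], of h] mult_left_mono[OF a(2)[OF j], of h] h by simp
          have "p j z \<le> 1 * (\<integral>\<^sup>+ x. p (Suc j) (a j *\<^sub>R z + x) \<partial>gauss_measure (h * a j))"
            unfolding rec[OF j] by (intro mult_right_mono) (auto simp: indicator_def)
          then show "p j z \<le> (\<integral>\<^sup>+ x. p (Suc j) (a j *\<^sub>R z + x) \<partial>gauss_measure (h * a j))" by simp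
          assume z: "(norm (z - y))\<^sup>2 \<le> \<beta>\<^sup>2 + 1 / lam"
          have "norm (z - y) \<le> sqrt (\<beta>\<^sup>2 + 1 / lam)" using z by (rule real_le_rsqrt)
          then have "norm (z - y) \<le> 2 * \<beta>" using sq by linarith
          moreover have "norm z \<le> norm (z - y) + norm (x - y) + norm x"
            using norm_triangle_ineq[of "z - y" "y - x + x"] norm_triangle_ineq[of "y - x" x] by (simp add: norm_minus_commute)
          ultimately have "norm z \<le> norm x + 4 * \<beta>" using xy x(2) by linarith
          then have "4 / T * norm z * h \<le> 4 / T * (norm x + 4 * \<beta>) * h"
            using T h by (intro mult_right_mono mult_left_mono) auto
          then show "norm ((a j - 1) *\<^sub>R z) \<le> Q * h" using a(3)[OF j, of z] by (simp add: Q_def)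
        }
        {
          assume j: "j \<le> N" and z: "(norm (z - y))\<^sup>2 < \<beta>\<^sup>2 - L * (real j * h)"
          have "z \<notin> C (N - j)"
          \<comment> \<open>At time \<open>t\<close> itself the set is a closure, but an open ball
            that misses the section also misses its closure.\<close>
          proof (cases "j = 0")
            case True
            then have "(norm (z - y))\<^sup>2 < \<beta>\<^sup>2" using z by simp
            then have "norm (z - y) < \<beta>" by (rule power2_less_imp_less) (use beta in simp)
            then have "z \<in> ball y \<beta>" by (simp add: dist_norm norm_minus_commute)
            moreover have "ball y \<beta> \<inter> closure (D t) = {}" using y(1) by (simp add: open_Int_closure_eq_empty)
            ultimately show ?thesis using True by (auto simp: C_def grid_sets_def)
          next
            case False
            show ?thesis
            proof
              assume "z \<in> C (N - j)"
              then have zD: "z \<in> D (r + real (N - j) * h)"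
                using False j N by (simp add: C_def grid_sets_def r_def h_def)
              have u: "r + real (N - j) * h = t - real j * h"
                using j Nh by (simp add: r_def of_nat_diff left_diff_distrib)
              have jh: "0 \<le> real j * h" using h by simp
              have "\<beta> - K * \<bar>(r + real (N - j) * h) - t\<bar> \<le> norm (z - y)"
              proof (rule avoids_shrinking_ball[OF tp t(2) _ _ y(1) zD])
                show "0 < r + real (N - j) * h" by (rule den)
                show "r + real (N - j) * h < T" using u jh t by linarith
              qed
              then have "\<beta> - K * (real j * h) \<le> norm (z - y)" unfolding u using jh by simp
              then have "\<beta>\<^sup>2 - 2 * \<beta> * (K * (real j * h)) \<le> (norm (z - y))\<^sup>2"
                using beta K jh by (intro power2_ge_diff) auto
              then show False using z by (simp add: L_def mult_ac)
            qed
          qed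
          then show "p j z = 0" unfolding p_def by (cases "N - j") (auto simp: Let_def)
        }
      qed
      also have "p 0 x = backward_kernel r h C N x" by (simp add: p_def)
      also have "ennreal (2 * lam * max 0 ((norm (x - y))\<^sup>2 - \<beta>\<^sup>2) + 2 * (exp (lam * eta) - 1)) \<le>
          ennreal (6 * \<beta> * back_rate * (1 + norm x) * bdist t x + 2 * (exp (back_rate * (1 + norm x) * eta) - 1))"
      proof (intro ennreal_leI add_mono)
        have "(norm (x - y))\<^sup>2 \<le> (\<beta> + bdist t x)\<^sup>2" using xy by (intro power_mono) auto
        also have "(\<beta> + bdist t x)\<^sup>2 = \<beta>\<^sup>2 + 2 * \<beta> * bdist t x + bdist t x * bdist t x"
          by (simp add: power2_eq_square algebra_simps)
        \<comment> \<open>The quadratic term is absorbed by restricting to distances at most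
          \<beta>; this gives 3 and, with the leading 2 of the barrier, the constant 6.\<close>
        also have "bdist t x * bdist t x \<le> \<beta> * bdist t x" using x(2) by (intro mult_right_mono bdist_nonneg)
        finally have "(norm (x - y))\<^sup>2 - \<beta>\<^sup>2 \<le> 3 * \<beta> * bdist t x" by simp
        moreover have "0 \<le> 3 * \<beta> * bdist t x" using beta by simp
        ultimately have "max 0 ((norm (x - y))\<^sup>2 - \<beta>\<^sup>2) \<le> 3 * \<beta> * bdist t x" by simp
        then have "2 * lam * max 0 ((norm (x - y))\<^sup>2 - \<beta>\<^sup>2) \<le> 2 * lam * (3 * \<beta> * bdist t x)"
          using lam by (intro mult_left_mono) auto
        then show "2 * lam * max 0 ((norm (x - y))\<^sup>2 - \<beta>\<^sup>2) \<le> 6 * \<beta> * back_rate * (1 + norm x) * bdist t x"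
          by (simp add: lam_def mult_ac)
      qed (simp add: lam_def)
      finally show ?case by (simp only: r_def h_def C_def N_def)
    qed
  qed
qed

text \<open>Seen backwards from time t, a path that has stayed in the domain must avoid the exterior ball
  touching the boundary near its endpoint; this costs a factor proportional to the distance to the boundary.\<close>
lemma stay_backward_bound:
  assumes t: "T / 2 \<le> t" "t < T" and f [measurable]: "f \<in> borel_measurable borel" and f1: "\<And>x. f x \<le> 1"
  shows "(\<integral>\<^sup>+ \<omega>. indicator (Stay t) \<omega> * f (W t \<omega>) \<partial>M) \<le>
    (\<integral>\<^sup>+ \<omega>. ennreal (min 1 (6 * \<beta> * back_rate * (1 + norm (W t \<omega>)) * bdist t (W t \<omega>))) * f (W t \<omega>) \<partial>M)"
proof -
  define r where "r = t - back_window"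
  define h where "h n = back_window / real (Suc n)" for n
  define bk where "bk n = backward_kernel r (h n) (grid_sets t (Suc n)) (Suc n)" for n
  define c where "c x = 6 * \<beta> * back_rate * (1 + norm x) * bdist t x" for x
  have tp: "0 < t" using t T by simp
  have r: "0 < r" using t T back_window by (auto simp: r_def)
  have h: "0 < h n" for n using back_window by (simp add: h_def)
  have time: "0 < r + real i * h n" "i < Suc n \<Longrightarrow> r + real i * h n < t" for i n
  proof -
    show "0 < r + real i * h n" using r h[of n] by (simp add: add_pos_nonneg)
    assume "i < Suc n"
    then have "real i * h n < real (Suc n) * h n" using h[of n] by (intro mult_strict_right_mono) auto
    also have "\<dots> = back_window" by (simp add: h_def del: of_nat_Suc)
    finally show "r + real i * h n < t" by (simp add: r_def)
  qed
  have rt: "r + real (Suc n) * h n = t" for n by (simp add: r_def h_def del: of_nat_Suc)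
  have Cm: "grid_sets t (Suc n) i \<in> sets borel" for n i
    using time[of i n] t open_D[of "r + real i * h n"] by (auto simp: grid_sets_def r_def h_def)
  have [measurable]: "W t \<in> borel_measurable M" using W_measurable tp by simp
  have [measurable]: "bk n \<in> borel_measurable borel" for n
    unfolding bk_def by (rule borel_measurable_backward_kernel[OF r h Cm])
  have le: "(\<integral>\<^sup>+ \<omega>. indicator (Stay t) \<omega> * f (W t \<omega>) \<partial>M) \<le> (\<integral>\<^sup>+ \<omega>. bk n (W t \<omega>) * f (W t \<omega>) \<partial>M)" for n
  proof -
    have "Stay t \<subseteq> {\<omega> \<in> space M. \<forall>i\<le>Suc n. W (r + real i * h n) \<omega> \<in> grid_sets t (Suc n) i}"
    proof
      fix \<omega> assume w: "\<omega> \<in> Stay t"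
      then have sp: "\<omega> \<in> space M" and st: "\<And>u. 0 < u \<Longrightarrow> u < t \<Longrightarrow> W u \<omega> \<in> D u" by (auto simp: Stay_def)
      have "W (r + real i * h n) \<omega> \<in> grid_sets t (Suc n) i" if i: "i \<le> Suc n" for i
      proof (cases "i < Suc n")
        case True
        then show ?thesis using st[OF time(1)[of i n] time(2)[OF True]] by (simp add: grid_sets_def r_def h_def)
      next
        case False
        then have "i = Suc n" using i by simp
        have "W t \<omega> \<in> closure (D t)"
        proof (rule closure_approachable[THEN iffD2], intro allI impI)
          fix e :: real assume e: "0 < e"
          have "continuous_on {0..} (\<lambda>u. W u \<omega>)" by (rule W_continuous[OF sp])
          then obtain d where d: "0 < d" "\<And>u. 0 \<le> u \<Longrightarrow> dist u t < d \<Longrightarrow> dist (W u \<omega>) (W t \<omega>) < e / 2"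
            using e tp unfolding continuous_on_iff by (metis atLeast_iff half_gt_zero less_imp_le)
          define u where "u = t - min (t / 2) (min (d / 2) (e / (4 * K)))"
          have m: "0 < min (t / 2) (min (d / 2) (e / (4 * K)))" using tp d e K by simp
          have m2: "min (t / 2) (min (d / 2) (e / (4 * K))) \<le> t / 2" "min (t / 2) (min (d / 2) (e / (4 * K))) \<le> d / 2"
            "min (t / 2) (min (d / 2) (e / (4 * K))) \<le> e / (4 * K)" by (auto intro: min.coboundedI1 min.coboundedI2)
          have u: "0 < u" "u < t" "t - u \<le> d / 2" "t - u \<le> e / (4 * K)"
            using m m2 tp unfolding u_def by linarith+
          have "K * \<bar>u - t\<bar> \<le> K * (e / (4 * K))" using u K by (intro mult_left_mono) auto
          also have "\<dots> < e / 2" using K e by simp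
          finally obtain z where z: "z \<in> D t" "dist (W u \<omega>) z < e / 2"
            using D_near[of u t "W u \<omega>" "e / 2"] u st[OF u(1,2)] tp t by auto
          have "dist (W u \<omega>) (W t \<omega>) < e / 2" using d u by (auto simp: dist_real_def)
          then have "dist z (W t \<omega>) < e"
            using z(2) dist_triangle[of z "W t \<omega>" "W u \<omega>"] by (simp add: dist_commute)
          then show "\<exists>y\<in>D t. dist y (W t \<omega>) < e" using z(1) by blast
        qed
        then show ?thesis using \<open>i = Suc n\<close> rt by (simp add: grid_sets_def del: of_nat_Suc)
      qed
      then show "\<omega> \<in> {\<omega> \<in> space M. \<forall>i\<le>Suc n. W (r + real i * h n) \<omega> \<in> grid_sets t (Suc n) i}" using sp by blast
    qed
    then have "(\<integral>\<^sup>+ \<omega>. indicator (Stay t) \<omega> * f (W t \<omega>) \<partial>M) \<le>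
        (\<integral>\<^sup>+ \<omega>. indicator {\<omega> \<in> space M. \<forall>i\<le>Suc n. W (r + real i * h n) \<omega> \<in> grid_sets t (Suc n) i} \<omega> * f (W (r + real (Suc n) * h n) \<omega>) \<partial>M)"
      unfolding rt by (intro nn_integral_mono mult_right_mono indicator_leI) auto
    also have "\<dots> = (\<integral>\<^sup>+ \<omega>. bk n (W t \<omega>) * f (W t \<omega>) \<partial>M)"
      using backward_kernel_stay[where C = "grid_sets t (Suc n)" and h = "h n" and k = "Suc n", OF r h Cm f] unfolding bk_def rt .
    finally show ?thesis .
  qed
  have bk1: "bk n x \<le> 1" for n x unfolding bk_def by (rule backward_kernel_le_1[OF r h])
  have lim: "limsup (\<lambda>n. bk n x * f x) \<le> ennreal (min 1 (c x)) * f x" for x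
  proof (cases "x \<in> closure (D t)")
    case False
    then have "bk n x = 0" for n unfolding bk_def by (simp add: grid_sets_def Let_def)
    then show ?thesis by (simp add: Limsup_const)
  next
    case True
    show ?thesis
    \<comment> \<open>A distance above \<beta> already forces \<open>c x \<ge> 1\<close>, because
      \<open>back_rate \<ge> 1 / \<beta>\<^sup>2\<close>. So whenever one of the two conditions
      fails, the minimum is 1 and the trivial kernel bound suffices.\<close>
    proof (cases "bdist t x \<le> \<beta> \<and> c x \<le> 1")
      case False
      have "1 \<le> c x"
      proof (rule ccontr)
        assume n: "\<not> 1 \<le> c x"
        then have b: "\<beta> < bdist t x" using False by auto
        have "1 = \<beta> * (1 / \<beta>\<^sup>2) * \<beta>" using beta by (simp add: power2_eq_square)
        also have "\<dots> \<le> \<beta> * back_rate * bdist t x" using beta b back_rate by (intro mult_mono mult_left_mono) auto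
        also have "\<dots> \<le> (6 * (1 + norm x)) * (\<beta> * back_rate * bdist t x)"
        proof -
          have "0 \<le> \<beta> * back_rate * bdist t x" using beta back_rate by simp
          moreover have "1 \<le> 6 * (1 + norm x)" using norm_ge_zero[of x] unfolding distrib_left by linarith
          ultimately show ?thesis using mult_right_mono[of 1 "6 * (1 + norm x)" "\<beta> * back_rate * bdist t x"] by simp
        qed
        also have "\<dots> = c x" by (simp add: c_def mult_ac)
        finally show False using n by simp
      qed
      then have "min 1 (c x) = 1" by simp
      then have "bk n x * f x \<le> ennreal (min 1 (c x)) * f x" for n
        using mult_right_mono[OF bk1[of n x], of "f x"] by simp
      then show ?thesis by (intro Limsup_bounded always_eventually allI)
    next
      case small: True
      then have mc: "min 1 (c x) = c x" by simp
      have c0: "0 \<le> c x" using beta back_rate by (simp add: c_def)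
      show ?thesis
      proof (rule ennreal_le_epsilon)
        fix e :: real assume e: "0 < e"
        define lam where "lam = back_rate * (1 + norm x)"
        have lam: "0 < lam" using back_rate by (simp add: lam_def add_pos_nonneg)
        define eta where "eta = ln (1 + e / 2) / lam"
        have eta: "0 < eta" "2 * (exp (lam * eta) - 1) = e" using e lam by (auto simp: eta_def)
        have "eventually (\<lambda>n. bk n x \<le> ennreal (c x + e)) sequentially"
          using backward_kernel_bound[OF t True conjunct1[OF small] eta(1)] eta(2)
          unfolding bk_def r_def h_def c_def lam_def by simp
        then have "eventually (\<lambda>n. bk n x * f x \<le> ennreal (min 1 (c x)) * f x + ennreal e) sequentially"
        proof eventually_elim
          case (elim n)
          then have "bk n x * f x \<le> (ennreal (c x) + ennreal e) * f x" using c0 e by (intro mult_right_mono) (auto simp: ennreal_plus)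
          also have "\<dots> = ennreal (c x) * f x + ennreal e * f x" by (simp add: distrib_right)
          also have "\<dots> \<le> ennreal (c x) * f x + ennreal e * 1" by (intro add_left_mono mult_left_mono f1) auto
          finally show ?case unfolding mc by simp
        qed
        then show "limsup (\<lambda>n. bk n x * f x) \<le> ennreal (min 1 (c x)) * f x + ennreal e"
          by (rule Limsup_bounded)
      qed
    qed
  qed
  have "(\<integral>\<^sup>+ \<omega>. indicator (Stay t) \<omega> * f (W t \<omega>) \<partial>M) \<le> limsup (\<lambda>n. \<integral>\<^sup>+ \<omega>. bk n (W t \<omega>) * f (W t \<omega>) \<partial>M)"
    using Limsup_mono[of "\<lambda>n. \<integral>\<^sup>+ \<omega>. indicator (Stay t) \<omega> * f (W t \<omega>) \<partial>M" _ sequentially] le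
    by (simp add: Limsup_const)
  \<comment> \<open>Reverse Fatou with the dominating function 1. The kernel bound holds only from
    an index depending on the endpoint, so no uniform estimate could be inserted before the
    limit.\<close>
  also have "\<dots> \<le> (\<integral>\<^sup>+ \<omega>. limsup (\<lambda>n. bk n (W t \<omega>) * f (W t \<omega>)) \<partial>M)"
  proof (rule nn_integral_limsup[where w = "\<lambda>_. 1"])
    show "AE \<omega> in M. bk n (W t \<omega>) * f (W t \<omega>) \<le> 1" for n
      using mult_mono[OF bk1 f1] by (intro AE_I2) auto
    show "(\<integral>\<^sup>+ \<omega>. 1 \<partial>M) < \<infinity>" using emeasure_space_1 by simp
  qed measurable
  also have "\<dots> \<le> (\<integral>\<^sup>+ \<omega>. ennreal (min 1 (c (W t \<omega>))) * f (W t \<omega>) \<partial>M)"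
    by (intro nn_integral_mono lim)
  finally show ?thesis unfolding c_def .
qed

end

section \<open>Summation over layers near the boundary and gluing of local bounds\<close>

text \<open>The third condition on the class is stated with \<open>LINT\<close>, which is 0 by
  convention for non-integrable functions. Integrability has to be known before that condition
  bounds a nonnegative integral.\<close>

lemma nn_integral_norm_gauss_finite:
  assumes v: "0 < v"
  shows "(\<integral>\<^sup>+ x. ennreal (1 + norm (x :: real ^ 'm)) \<partial>gauss_measure v) < \<infinity>"
proof -
  have le: "1 + norm x \<le> (2 + 4 * v) * exp ((norm x)\<^sup>2 / (4 * v))" for x :: "real ^ 'm"
  proof -
    have "0 \<le> (norm x - 1)\<^sup>2" by simp
    then have "2 * norm x \<le> 1 + (norm x)\<^sup>2" by (simp add: power2_diff)
    moreover have "0 \<le> norm x" "0 \<le> (norm x)\<^sup>2" by simp_all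
    ultimately have "1 + norm x \<le> 2 + (norm x)\<^sup>2" by linarith
    also have "(norm x)\<^sup>2 = 4 * v * ((norm x)\<^sup>2 / (4 * v))" using v by simp
    also have "\<dots> \<le> 4 * v * exp ((norm x)\<^sup>2 / (4 * v))"
    proof (rule mult_left_mono)
      show "(norm x)\<^sup>2 / (4 * v) \<le> exp ((norm x)\<^sup>2 / (4 * v))"
        using exp_ge_add_one_self[of "(norm x)\<^sup>2 / (4 * v)"] by linarith
    qed (use v in simp)
    also have "2 \<le> 2 * exp ((norm x)\<^sup>2 / (4 * v))" using v by simp
    finally show ?thesis by (simp add: distrib_right)
  qed
  have "(\<integral>\<^sup>+ x. ennreal (1 + norm (x :: real ^ 'm)) \<partial>gauss_measure v) \<le>
      (\<integral>\<^sup>+ x. ennreal (2 + 4 * v) * ennreal (exp ((norm (x :: real ^ 'm))\<^sup>2 / (4 * v))) \<partial>gauss_measure v)"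
  proof (rule nn_integral_mono)
    fix x :: "real ^ 'm"
    have "ennreal (1 + norm x) \<le> ennreal ((2 + 4 * v) * exp ((norm x)\<^sup>2 / (4 * v)))"
      by (rule ennreal_leI[OF le])
    also have "\<dots> = ennreal (2 + 4 * v) * ennreal (exp ((norm x)\<^sup>2 / (4 * v)))"
      by (rule ennreal_mult) (use v in auto)
    finally show "ennreal (1 + norm x) \<le> ennreal (2 + 4 * v) * ennreal (exp ((norm x)\<^sup>2 / (4 * v)))" .
  qed
  also have "\<dots> = ennreal (2 + 4 * v) * (\<integral>\<^sup>+ x. ennreal (exp ((norm (x :: real ^ 'm))\<^sup>2 / (4 * v))) \<partial>gauss_measure v)"
    by (rule nn_integral_cmult) measurable
  also have "\<dots> \<le> ennreal (2 + 4 * v) * ennreal (sqrt 2 ^ CARD('m))"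
    by (intro mult_left_mono nn_integral_gauss_measure_exp_sq v order_refl) simp
  also have "\<dots> < \<infinity>" by (simp add: ennreal_mult_less_top)
  finally show ?thesis .
qed

text \<open>The weight \<^term>\<open>r * exp (- r\<^sup>2 / (32 * h))\<close> is bounded on each layer
  i * sqrt h <= r < (i + 1) * sqrt h; this constant dominates the resulting sum over i.\<close>
definition layer_const :: real where
  "layer_const = 2048 * exp (1 / 16) / (1 - exp (- 1 / 32))"

lemma layer_const_pos: "0 < layer_const"
  by (simp add: layer_const_def)

lemma layer_sum_le: "(\<Sum>i<N. (real i + 1)\<^sup>2 * exp (- (real i)\<^sup>2 / 32)) \<le> layer_const"
proof -
  let ?q = "exp (- 1 / 32) :: real"
  have q: "0 < ?q" "?q < 1" by auto
  \<comment> \<open>Comparison with a geometric series: \<open>2048 = 2 * 32\<^sup>2\<close> comes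
    from absorbing the square into \<open>exp ((i + 1) / 32)\<close>, and
    \<open>i\<^sup>2 \<ge> 2 * i - 1\<close> makes the Gaussian exponent linear. Together the
    exponents give \<open>1 / 16 - i / 32\<close>.\<close>
  have gterm: "(real i + 1)\<^sup>2 * exp (- (real i)\<^sup>2 / 32) \<le> 2048 * exp (1 / 16) * ?q ^ i" for i
  proof -
    have "((real i + 1) / 32)\<^sup>2 / 2 \<le> exp ((real i + 1) / 32)"
    proof -
      have "0 \<le> (real i + 1) / 32" by simp
      then show ?thesis using exp_lower_Taylor_quadratic[of "(real i + 1) / 32"] by linarith
    qed
    then have 1: "(real i + 1)\<^sup>2 \<le> 2048 * exp ((real i + 1) / 32)" by (simp add: power_divide)
    have "0 \<le> (real i - 1)\<^sup>2" by simp
    then have "2 * real i - 1 \<le> (real i)\<^sup>2" by (simp add: power2_diff)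
    then have 2: "exp (- (real i)\<^sup>2 / 32) \<le> exp ((1 - 2 * real i) / 32)" by simp
    have "(real i + 1)\<^sup>2 * exp (- (real i)\<^sup>2 / 32) \<le> 2048 * exp ((real i + 1) / 32) * exp ((1 - 2 * real i) / 32)"
      using 1 2 by (intro mult_mono) auto
    also have "\<dots> = 2048 * exp ((real i + 1) / 32 + (1 - 2 * real i) / 32)" by (simp add: mult_exp_exp)
    also have "(real i + 1) / 32 + (1 - 2 * real i) / 32 = 1 / 16 + real i * (- 1 / 32)" by (simp add: field_simps)
    also have "2048 * exp (1 / 16 + real i * (- 1 / 32)) = 2048 * exp (1 / 16) * ?q ^ i"
      by (simp only: exp_add exp_of_nat_mult mult.assoc)
    finally show ?thesis .
  qed
  have "(\<Sum>i<N. (real i + 1)\<^sup>2 * exp (- (real i)\<^sup>2 / 32)) \<le> (\<Sum>i<N. 2048 * exp (1 / 16) * ?q ^ i)"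
    by (intro sum_mono gterm)
  also have "\<dots> = 2048 * exp (1 / 16) * (\<Sum>i<N. ?q ^ i)" by (simp only: sum_distrib_left)
  also have "(\<Sum>i<N. ?q ^ i) \<le> 1 / (1 - ?q)"
  proof -
    have "(\<Sum>i<N. ?q ^ i) \<le> (\<Sum>i. ?q ^ i)" using q by (intro sum_le_suminf summable_geometric) auto
    then show ?thesis using q by (simp add: suminf_geometric)
  qed
  then have "2048 * exp (1 / 16) * (\<Sum>i<N. ?q ^ i) \<le> 2048 * exp (1 / 16) * (1 / (1 - ?q))"
    by (intro mult_left_mono) auto
  finally show ?thesis by (simp add: layer_const_def)
qed

text \<open>The threshold \<open>h0\<close> may depend on \<open>t\<close> without any uniformity, so no uniform partition of the
  interval is available and the local bounds are glued by a supremum argument.\<close>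
lemma increment_bound:
  fixes H :: "real \<Rightarrow> real \<Rightarrow> real"
  assumes sub: "\<And>a c b. l \<le> a \<Longrightarrow> a \<le> c \<Longrightarrow> c \<le> b \<Longrightarrow> b < r \<Longrightarrow> H a b \<le> H a c + H c b"
    and right: "\<And>t. l \<le> t \<Longrightarrow> t < r \<Longrightarrow> \<exists>h0>0. \<forall>h. 0 < h \<and> h < h0 \<longrightarrow> H t (t + h) \<le> C * h"
    and left: "\<And>a b. l \<le> a \<Longrightarrow> a < b \<Longrightarrow> b < r \<Longrightarrow> (\<And>x. a \<le> x \<Longrightarrow> x < b \<Longrightarrow> H a x \<le> C * (x - a)) \<Longrightarrow> H a b \<le> C * (b - a)"
    and zero: "\<And>a. l \<le> a \<Longrightarrow> a < r \<Longrightarrow> H a a \<le> 0"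
    and ab: "l \<le> a" "a \<le> b" "b < r"
  shows "H a b \<le> C * (b - a)"
proof -
  \<comment> \<open>The right end points up to which the bound holds. By \<open>left\<close> the
    bound survives at the supremum; there \<open>right\<close> together with \<open>sub\<close>
    would push it further, unless the supremum is \<open>b\<close>.\<close>
  define S where "S = {x \<in> {a..b}. \<forall>y\<in>{a..x}. H a y \<le> C * (y - a)}"
  define c where "c = Sup S"
  have aS: "a \<in> S" using ab zero[of a] by (auto simp: S_def)
  have bdd: "bdd_above S" by (rule bdd_aboveI[of _ b]) (auto simp: S_def)
  have "S \<noteq> {}" using aS by blast
  then have "Sup S \<le> b" by (rule cSup_least) (auto simp: S_def)
  with cSup_upper[OF aS bdd] have c: "a \<le> c" "c \<le> b" by (auto simp: c_def)
  have below: "H a y \<le> C * (y - a)" if y: "a \<le> y" "y < c" for y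
  proof -
    obtain x where "x \<in> S" "y < x" using less_cSupD[OF \<open>S \<noteq> {}\<close>, of y] y(2) unfolding c_def by blast
    then show ?thesis using y by (auto simp: S_def)
  qed
  have Hc: "H a c \<le> C * (c - a)"
  proof (cases "a = c")
    case False
    show ?thesis
    proof (rule left[OF ab(1)])
      show "a < c" "c < r" using False c ab by auto
    qed (rule below)
  next
    case True
    then show ?thesis using zero[of a] ab by simp
  qed
  have "c = b"
  proof (rule ccontr)
    assume "c \<noteq> b"
    then have cb: "c < b" using c by simp
    obtain h0 where h0: "0 < h0" "\<And>h. 0 < h \<Longrightarrow> h < h0 \<Longrightarrow> H c (c + h) \<le> C * h"
      using right[of c] c ab by auto
    define d where "d = min (h0 / 2) (b - c)"
    have d: "0 < d" "d < h0" "c + d \<le> b" using h0 cb by (auto simp: d_def min_def)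
    have "c + d \<in> S"
      unfolding S_def
    proof (intro CollectI conjI ballI)
      show "c + d \<in> {a..b}" using c d by auto
      fix y assume y: "y \<in> {a..c + d}"
      show "H a y \<le> C * (y - a)"
      proof (cases "y < c")
        case True
        then show ?thesis using below y by auto
      next
        case False
        show ?thesis
        proof (cases "y = c")
          case False
          then have yc: "c < y" using \<open>\<not> y < c\<close> by simp
          have "H c y \<le> C * (y - c)" using h0(2)[of "y - c"] yc y d by simp
          moreover have "H a y \<le> H a c + H c y" using sub[of a c y] c y d ab yc by simp
          ultimately show ?thesis using Hc by (simp add: right_diff_distrib)
        qed (use Hc in simp)
      qed
    qed
    then have "c + d \<le> c" unfolding c_def using bdd by (intro cSup_upper)
    then show False using d by simp
  qed
  then show ?thesis using Hc by simp
qed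

section \<open>The exit probability during a short time interval\<close>

context regular_domain
begin

definition boundary_regular :: "real \<Rightarrow> bool" where
  "boundary_regular \<gamma> \<longleftrightarrow> (\<forall>t\<in>{0<..<T}. \<exists>v0>0. \<forall>v. 0 < v \<and> v < v0 \<longrightarrow>
     (\<integral>\<^sup>+ \<omega>. indicator {\<omega>. 0 < bdist t (W t \<omega>) \<and> bdist t (W t \<omega>) < v} \<omega> * ennreal (1 + norm (W t \<omega>)) \<partial>M) \<le> ennreal (\<gamma> * v))"

text \<open>The first factor adds paths that start within \<open>K * h\<close> of the boundary to
  those that must travel, the latter with the constant of the maximal inequality. The exponential
  compensates the motion of the boundary, the inner 1 is the contribution of starting points far
  from it, and the rest is the sum over layers.\<close>

definition exit_rate :: "real \<Rightarrow> real" where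
  "exit_rate \<gamma> = (1 + sqrt 2 ^ CARD('m)) * (exp (K\<^sup>2 * T / 16) * (1 + 6 * \<beta> * back_rate * \<gamma> * layer_const))"

lemma exit_rate_pos: "0 < \<gamma> \<Longrightarrow> 0 < exit_rate \<gamma>"
  unfolding exit_rate_def using beta back_rate(1) layer_const_pos
  by (intro mult_pos_pos add_pos_nonneg) (auto intro!: mult_nonneg_nonneg)

lemma Stay_M: "0 < t \<Longrightarrow> t \<le> T \<Longrightarrow> Stay t \<in> sets M"
  using Stay_past sets_past_subset by blast

lemma Exit_M: "0 < a \<Longrightarrow> a \<le> b \<Longrightarrow> b < T \<Longrightarrow> Exit a b \<in> sets M"
  using Exit_past sets_past_subset by blast

text \<open>Layers of width \<open>sqrt h\<close>: the linear weight is at most of order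
  \<open>(i + 1) * sqrt h\<close> on layer i and the third condition bounds its measure by
  \<open>\<gamma> * (i + 1) * sqrt h\<close>; the Gaussian factor makes the sum over i
  converge.\<close>

lemma weighted_layer_bound:
  assumes t: "T / 2 \<le> t" "t < T" and g: "0 < \<gamma>" and reg: "boundary_regular \<gamma>"
  shows "\<exists>h0>0. \<forall>h. 0 < h \<and> h < h0 \<longrightarrow>
    (\<integral>\<^sup>+ \<omega>. ennreal (min 1 (6 * \<beta> * back_rate * (1 + norm (W t \<omega>)) * bdist t (W t \<omega>))) * ennreal (exp (- (bdist t (W t \<omega>))\<^sup>2 / (32 * h))) \<partial>M)
      \<le> ennreal ((1 + 6 * \<beta> * back_rate * \<gamma> * layer_const) * h)"
proof -
  define Cb where "Cb = 6 * \<beta> * back_rate"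
  have Cb: "0 < Cb" using beta back_rate by (simp add: Cb_def)
  have tp: "0 < t" using t T by simp
  define d where "d \<omega> = bdist t (W t \<omega>)" for \<omega>
  have [measurable]: "W t \<in> borel_measurable M" using W_measurable tp by simp
  have [measurable]: "d \<in> borel_measurable M" unfolding d_def by measurable
  have d0: "0 \<le> d \<omega>" for \<omega> by (simp add: d_def)
  have tin: "t \<in> {0<..<T}" using tp t by simp
  obtain v0 where v0: "0 < v0" and v: "\<And>v. 0 < v \<Longrightarrow> v < v0 \<Longrightarrow>
      (\<integral>\<^sup>+ \<omega>. indicator {\<omega>. 0 < d \<omega> \<and> d \<omega> < v} \<omega> * ennreal (1 + norm (W t \<omega>)) \<partial>M) \<le> ennreal (\<gamma> * v)"
    using bspec[OF reg[unfolded boundary_regular_def] tin] unfolding d_def by blast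
  \<comment> \<open>At distance \<open>v0 / 2\<close> the exponent is
    \<open>(v0 / 2)\<^sup>2 / (32 * h) = c / h\<close>. The second entry of \<open>h0\<close> makes
    \<open>exp (- (c / h))\<close> at most \<open>h\<close>, the first one makes a layer thinner
    than \<open>v0 / 2\<close>.\<close>
  define c where "c = v0\<^sup>2 / 128"
  have c: "0 < c" using v0 by (simp add: c_def)
  define h0 where "h0 = min (v0\<^sup>2 / 4) (c\<^sup>2 / 2)"
  have "0 < h0" using v0 c by (simp add: h0_def)
  moreover have "(\<integral>\<^sup>+ \<omega>. ennreal (min 1 (Cb * (1 + norm (W t \<omega>)) * d \<omega>)) * ennreal (exp (- (d \<omega>)\<^sup>2 / (32 * h))) \<partial>M)
      \<le> ennreal ((1 + Cb * \<gamma> * layer_const) * h)" if h: "0 < h" "h < h0" for h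
  proof -
    define q where "q = sqrt h"
    have q: "0 < q" "q\<^sup>2 = h" using h by (auto simp: q_def)
    have "h < v0\<^sup>2 / 4" "h < c\<^sup>2 / 2" using h by (auto simp: h0_def)
    then have "q\<^sup>2 < (v0 / 2)\<^sup>2" using q by (simp add: power_divide)
    then have qv: "q < v0 / 2" by (rule power2_less_imp_less) (use v0 in simp)
    \<comment> \<open>The layers reach up to \<open>v0 / 2\<close>; rounding up adds less than one
      layer, so all outer radii stay below \<open>v0\<close>, where the third condition
      applies.\<close>
    define N where "N = nat \<lceil>v0 / (2 * q)\<rceil>"
    have N: "v0 / (2 * q) \<le> real N" "real N < v0 / (2 * q) + 1"
    proof -
      have "0 \<le> v0 / (2 * q)" using v0 q by simp
      then show "v0 / (2 * q) \<le> real N" "real N < v0 / (2 * q) + 1" unfolding N_def by linarith+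
    qed
    have tail: "exp (- (c / h)) \<le> h"
    proof -
      have "0 < c / h" using c h by simp
      then have "(c / h)\<^sup>2 / 2 \<le> exp (c / h)"
        using exp_lower_Taylor_quadratic[of "c / h"] by linarith
      then have "exp (- (c / h)) \<le> 2 * h\<^sup>2 / c\<^sup>2"
        using c h by (simp add: exp_minus field_simps)
      also have "\<dots> = h * (2 * h / c\<^sup>2)" by (simp add: power2_eq_square)
      also have "\<dots> \<le> h * 1" using \<open>h < c\<^sup>2 / 2\<close> h c by (intro mult_left_mono) (auto simp: field_simps)
      finally show ?thesis by simp
    qed
    let ?I = "\<lambda>i \<omega>. indicator {\<omega>. 0 < d \<omega> \<and> d \<omega> < (real i + 1) * q} \<omega> * ennreal (1 + norm (W t \<omega>))"
    let ?w = "\<lambda>i::nat. Cb * ((real i + 1) * q) * exp (- (real i)\<^sup>2 / 32)"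
    have w0: "0 \<le> ?w i" for i using Cb q by simp
    have pw: "ennreal (min 1 (Cb * (1 + norm (W t \<omega>)) * d \<omega>)) * ennreal (exp (- (d \<omega>)\<^sup>2 / (32 * h)))
        \<le> ennreal h + (\<Sum>i<N. ennreal (?w i) * ?I i \<omega>)" for \<omega>
    \<comment> \<open>The third condition excludes distance 0; there the linear weight
      vanishes.\<close>
    proof (cases "d \<omega> = 0")
      case True
      then show ?thesis by simp
    next
      case False
      then have dp: "0 < d \<omega>" using d0[of \<omega>] by simp
      show ?thesis
      proof (cases "d \<omega> < v0 / 2")
        case False
        then have "(v0 / 2)\<^sup>2 \<le> (d \<omega>)\<^sup>2" using v0 by (intro power_mono) auto
        then have "4 * c * 8 \<le> (d \<omega>)\<^sup>2" by (simp add: c_def power_divide)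
        then have "c / h \<le> (d \<omega>)\<^sup>2 / (32 * h)" using h by (simp add: field_simps)
        then have "exp (- (d \<omega>)\<^sup>2 / (32 * h)) \<le> exp (- (c / h))" by simp
        then have "exp (- (d \<omega>)\<^sup>2 / (32 * h)) \<le> h" using tail by linarith
        then have "ennreal (min 1 (Cb * (1 + norm (W t \<omega>)) * d \<omega>)) * ennreal (exp (- (d \<omega>)\<^sup>2 / (32 * h))) \<le> 1 * ennreal h"
          by (intro mult_mono ennreal_leI) (auto simp: ennreal_le_1)
        also have "\<dots> \<le> ennreal h + (\<Sum>i<N. ennreal (?w i) * ?I i \<omega>)" by simp
        finally show ?thesis .
      next
        case small: True
        define i where "i = nat \<lfloor>d \<omega> / q\<rfloor>"
        have "0 \<le> d \<omega> / q" using dp q by simp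
        then have "real i \<le> d \<omega> / q" "d \<omega> / q < real i + 1" unfolding i_def by linarith+
        then have i: "real i * q \<le> d \<omega>" "d \<omega> < (real i + 1) * q" using q by (auto simp: field_simps)
        have "d \<omega> / q < v0 / (2 * q)" using small q by (simp add: field_simps)
        then have iN: "i < N" using \<open>real i \<le> d \<omega> / q\<close> N(1) by linarith
        have "(real i)\<^sup>2 * h \<le> (d \<omega>)\<^sup>2"
          using power_mono[OF i(1), of 2] q by (simp add: power_mult_distrib)
        then have "(real i)\<^sup>2 / 32 \<le> (d \<omega>)\<^sup>2 / (32 * h)" using h by (simp add: field_simps)
        then have e: "exp (- (d \<omega>)\<^sup>2 / (32 * h)) \<le> exp (- (real i)\<^sup>2 / 32)" by simp
        have "min 1 (Cb * (1 + norm (W t \<omega>)) * d \<omega>) * exp (- (d \<omega>)\<^sup>2 / (32 * h)) \<le>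
            (Cb * (1 + norm (W t \<omega>)) * ((real i + 1) * q)) * exp (- (real i)\<^sup>2 / 32)"
        proof (rule mult_mono[OF _ e])
          have "Cb * (1 + norm (W t \<omega>)) * d \<omega> \<le> Cb * (1 + norm (W t \<omega>)) * ((real i + 1) * q)"
            using i(2) Cb by (intro mult_left_mono) auto
          then show "min 1 (Cb * (1 + norm (W t \<omega>)) * d \<omega>) \<le> Cb * (1 + norm (W t \<omega>)) * ((real i + 1) * q)"
            by linarith
        qed (use Cb q in auto)
        then have "ennreal (min 1 (Cb * (1 + norm (W t \<omega>)) * d \<omega>)) * ennreal (exp (- (d \<omega>)\<^sup>2 / (32 * h))) \<le>
            ennreal (?w i * (1 + norm (W t \<omega>)))"
          using Cb dp by (subst ennreal_mult [symmetric]) (auto intro!: ennreal_leI simp: mult_ac)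
        also have "\<dots> = ennreal (?w i) * ennreal (1 + norm (W t \<omega>))"
          by (rule ennreal_mult[OF w0]) simp
        also have "\<dots> = ennreal (?w i) * ?I i \<omega>"
        proof -
          have ind: "indicator {\<omega>. 0 < d \<omega> \<and> d \<omega> < (real i + 1) * q} \<omega> = (1 :: ennreal)" using i dp by simp
          show ?thesis by (simp only: ind mult_1_left)
        qed
        also have "\<dots> \<le> (\<Sum>i<N. ennreal (?w i) * ?I i \<omega>)"
          using iN by (intro member_le_sum[of i "{..<N}" "\<lambda>i. ennreal (?w i) * ?I i \<omega>"]) auto
        also have "\<dots> \<le> ennreal h + (\<Sum>i<N. ennreal (?w i) * ?I i \<omega>)" by simp
        finally show ?thesis .
      qed
    qed
    have Im: "?I i \<in> borel_measurable M" for i by measurable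
    have "(\<integral>\<^sup>+ \<omega>. ennreal (min 1 (Cb * (1 + norm (W t \<omega>)) * d \<omega>)) * ennreal (exp (- (d \<omega>)\<^sup>2 / (32 * h))) \<partial>M)
        \<le> (\<integral>\<^sup>+ \<omega>. ennreal h + (\<Sum>i<N. ennreal (?w i) * ?I i \<omega>) \<partial>M)"
      by (intro nn_integral_mono pw)
    also have "\<dots> = (\<integral>\<^sup>+ \<omega>. ennreal h \<partial>M) + (\<integral>\<^sup>+ \<omega>. (\<Sum>i<N. ennreal (?w i) * ?I i \<omega>) \<partial>M)"
      by (rule nn_integral_add) measurable
    also have "(\<integral>\<^sup>+ \<omega>. ennreal h \<partial>M) = ennreal h" using emeasure_space_1 by simp
    also have "(\<integral>\<^sup>+ \<omega>. (\<Sum>i<N. ennreal (?w i) * ?I i \<omega>) \<partial>M) = (\<Sum>i<N. \<integral>\<^sup>+ \<omega>. ennreal (?w i) * ?I i \<omega> \<partial>M)"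
      by (rule nn_integral_sum) measurable
    also have "\<dots> \<le> (\<Sum>i<N. ennreal (Cb * \<gamma> * h * ((real i + 1)\<^sup>2 * exp (- (real i)\<^sup>2 / 32))))"
    proof (rule sum_mono)
      fix i assume "i \<in> {..<N}"
      then have "real i + 1 \<le> real N" by simp
      then have "real i + 1 < v0 / (2 * q) + 1" using N(2) by linarith
      then have "(real i + 1) * q < (v0 / (2 * q) + 1) * q" using q by (intro mult_strict_right_mono) auto
      also have "\<dots> = v0 / 2 + q" using q by (simp add: field_simps)
      also have "\<dots> < v0" using qv by simp
      finally have iv: "(real i + 1) * q < v0" .
      have "(\<integral>\<^sup>+ \<omega>. ennreal (?w i) * ?I i \<omega> \<partial>M) = ennreal (?w i) * (\<integral>\<^sup>+ \<omega>. ?I i \<omega> \<partial>M)"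
        by (rule nn_integral_cmult[OF Im])
      also have "\<dots> \<le> ennreal (?w i) * ennreal (\<gamma> * ((real i + 1) * q))"
        using q iv by (intro mult_left_mono v mult_pos_pos) auto
      also have "\<dots> = ennreal (?w i * (\<gamma> * ((real i + 1) * q)))"
        using g q by (intro ennreal_mult [symmetric] w0 mult_nonneg_nonneg[of \<gamma>]) auto
      also have "?w i * (\<gamma> * ((real i + 1) * q)) = Cb * \<gamma> * q\<^sup>2 * ((real i + 1)\<^sup>2 * exp (- (real i)\<^sup>2 / 32))"
        by (simp only: power2_eq_square mult_ac)
      finally show "(\<integral>\<^sup>+ \<omega>. ennreal (?w i) * ?I i \<omega> \<partial>M) \<le> ennreal (Cb * \<gamma> * h * ((real i + 1)\<^sup>2 * exp (- (real i)\<^sup>2 / 32)))"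
        by (simp only: q(2))
    qed
    also have "\<dots> = ennreal (Cb * \<gamma> * h * (\<Sum>i<N. (real i + 1)\<^sup>2 * exp (- (real i)\<^sup>2 / 32)))"
      using Cb g h by (subst sum_ennreal) (auto simp: sum_distrib_left)
    also have "\<dots> \<le> ennreal (Cb * \<gamma> * h * layer_const)"
      using Cb g h by (intro ennreal_leI mult_left_mono layer_sum_le) auto
    also have "ennreal h + ennreal (Cb * \<gamma> * h * layer_const) = ennreal ((1 + Cb * \<gamma> * layer_const) * h)"
      using Cb g h layer_const_pos by (subst ennreal_plus [symmetric]) (auto simp: algebra_simps)
    finally show ?thesis by (simp add: add_left_mono)
  qed
  ultimately show ?thesis unfolding Cb_def d_def by blast
qed

text \<open>To exit during the next \<open>h\<close> time units, the path must cover its distance to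
  the complement minus the boundary motion \<open>K * h\<close>. The maximal inequality prices this
  displacement, and \<open>stay_backward_bound\<close> prices having stayed and being that close to
  the boundary.\<close>

lemma exit_rate_local:
  assumes t: "T / 2 \<le> t" "t < T" and g: "0 < \<gamma>" and reg: "boundary_regular \<gamma>"
  shows "\<exists>h0>0. \<forall>h. 0 < h \<and> h < h0 \<longrightarrow> measure M (Stay t \<inter> Exit t (t + h)) \<le> exit_rate \<gamma> * h"
proof -
  have tp: "0 < t" using t T by simp
  obtain h1 where h1: "0 < h1" and wl: "\<And>h. 0 < h \<Longrightarrow> h < h1 \<Longrightarrow>
    (\<integral>\<^sup>+ \<omega>. ennreal (min 1 (6 * \<beta> * back_rate * (1 + norm (W t \<omega>)) * bdist t (W t \<omega>))) * ennreal (exp (- (bdist t (W t \<omega>))\<^sup>2 / (32 * h))) \<partial>M)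
      \<le> ennreal ((1 + 6 * \<beta> * back_rate * \<gamma> * layer_const) * h)"
    using weighted_layer_bound[OF t g reg] by blast
  define h0 where "h0 = min h1 (T - t)"
  have "0 < h0" using h1 t by (simp add: h0_def)
  moreover have "measure M (Stay t \<inter> Exit t (t + h)) \<le> exit_rate \<gamma> * h" if h: "0 < h" "h < h0" for h
  proof -
    have hh: "h < h1" "h < T - t" using h by (auto simp: h0_def)
    have [measurable]: "W t \<in> borel_measurable M" using W_measurable tp by simp
    \<comment> \<open>Halving turns the required displacement into a strict excess over the
      threshold, as the maximal inequality demands. If the distance is at most \<open>K * h\<close>,
      an exit may need no displacement; there \<open>d\<close> is 0 and \<open>f\<close> is
      1.\<close>
    define d where "d x = max 0 ((bdist t x - K * h) / 2)" for x
    have [measurable]: "d \<in> borel_measurable borel" unfolding d_def by measurable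
    have d0: "0 \<le> d x" for x by (simp add: d_def)
    define f where "f x = ennreal (exp (- (d x)\<^sup>2 / (4 * h)))" for x
    have fm [measurable]: "f \<in> borel_measurable borel" unfolding f_def by measurable
    have f1: "f x \<le> 1" for x using h by (simp add: f_def)
    have [measurable]: "Stay t \<in> sets M" using Stay_M tp t by simp
    have Sp: "Stay t \<in> sets (past t)" using Stay_past tp t by simp
    let ?B = "{\<omega> \<in> space M. bdist t (W t \<omega>) \<le> K * h}"
    let ?X = "{\<omega> \<in> space M. \<exists>u\<in>{t..t + h}. d (W t \<omega>) < norm (W u \<omega> - W t \<omega>)}"
    have Bm: "?B \<in> sets M" by measurable
    \<comment> \<open>A strict inequality at some time is a countable union of inequalities with a
      margin, to which \<open>measurable_Ex_le\<close> applies.\<close>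
    have Xm: "?X \<in> sets M"
    proof -
      have "{\<omega> \<in> space M. \<exists>u\<in>{t..t + h}. d (W t \<omega>) - norm (W u \<omega> - W t \<omega>) \<le> - 1 / real (Suc k)} \<in> sets M" for k
      proof (rule measurable_Ex_le)
        fix u assume "t \<le> u" "u \<le> t + h"
        then have [measurable]: "W u \<in> borel_measurable M" using W_measurable tp by simp
        show "(\<lambda>\<omega>. d (W t \<omega>) - norm (W u \<omega> - W t \<omega>)) \<in> borel_measurable M" by measurable
      next
        fix \<omega> assume "\<omega> \<in> space M"
        from continuous_on_subset[OF W_continuous[OF this], of "{t..t + h}"]
        have "continuous_on {t..t + h} (\<lambda>u. W u \<omega>)" using tp by auto
        then show "continuous_on {t..t + h} (\<lambda>u. d (W t \<omega>) - norm (W u \<omega> - W t \<omega>))"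
          by (intro continuous_intros)
      qed (use h in simp)
      then have "(\<Union>k. {\<omega> \<in> space M. \<exists>u\<in>{t..t + h}. d (W t \<omega>) - norm (W u \<omega> - W t \<omega>) \<le> - 1 / real (Suc k)}) \<in> sets M"
        by (intro sets.countable_UN image_subsetI)
      also have "(\<Union>k. {\<omega> \<in> space M. \<exists>u\<in>{t..t + h}. d (W t \<omega>) - norm (W u \<omega> - W t \<omega>) \<le> - 1 / real (Suc k)}) = ?X"
      proof (intro set_eqI iffI)
        fix \<omega> assume "\<omega> \<in> (\<Union>k. {\<omega> \<in> space M. \<exists>u\<in>{t..t + h}. d (W t \<omega>) - norm (W u \<omega> - W t \<omega>) \<le> - 1 / real (Suc k)})"
        then obtain k u where u: "\<omega> \<in> space M" "u \<in> {t..t + h}" "d (W t \<omega>) - norm (W u \<omega> - W t \<omega>) \<le> - 1 / real (Suc k)" by blast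
        have "- 1 / real (Suc k) < 0" by (simp add: divide_neg_pos)
        then have "d (W t \<omega>) < norm (W u \<omega> - W t \<omega>)" using u(3) by linarith
        then show "\<omega> \<in> ?X" using u by blast
      next
        fix \<omega> assume "\<omega> \<in> ?X"
        then obtain u where u: "\<omega> \<in> space M" "u \<in> {t..t + h}" "0 < norm (W u \<omega> - W t \<omega>) - d (W t \<omega>)" by auto
        obtain k where "inverse (real (Suc k)) < norm (W u \<omega> - W t \<omega>) - d (W t \<omega>)" using reals_Archimedean[OF u(3)] by blast
        then have "d (W t \<omega>) - norm (W u \<omega> - W t \<omega>) \<le> - 1 / real (Suc k)" by (simp add: inverse_eq_divide del: of_nat_Suc)
        then show "\<omega> \<in> (\<Union>k. {\<omega> \<in> space M. \<exists>u\<in>{t..t + h}. d (W t \<omega>) - norm (W u \<omega> - W t \<omega>) \<le> - 1 / real (Suc k)})" using u by blast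
      qed
      finally show ?thesis .
    qed
    have sub: "Exit t (t + h) \<subseteq> ?B \<union> ?X"
    proof
      fix \<omega> assume "\<omega> \<in> Exit t (t + h)"
      then obtain u where u: "\<omega> \<in> space M" "u \<in> {t..t + h}" "W u \<omega> \<notin> D u" by (auto simp: Exit_def)
      have uT: "0 < u" "u < T" using u tp hh by auto
      have "bdist t (W t \<omega>) \<le> bdist u (W u \<omega>) + dist (W t \<omega>) (W u \<omega>) + K * \<bar>u - t\<bar>"
        using uT tp t by (intro bdist_lipschitz)
      moreover have "bdist u (W u \<omega>) = 0" using bdist_eq_0[OF uT] u by simp
      moreover have "K * \<bar>u - t\<bar> \<le> K * h" using u K by (intro mult_left_mono) auto
      ultimately have le: "bdist t (W t \<omega>) - K * h \<le> norm (W u \<omega> - W t \<omega>)" by (simp add: dist_norm norm_minus_commute)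
      show "\<omega> \<in> ?B \<union> ?X"
      proof (cases "bdist t (W t \<omega>) \<le> K * h")
        case False
        then have "d (W t \<omega>) < bdist t (W t \<omega>) - K * h" by (simp add: d_def max_def)
        then have "d (W t \<omega>) < norm (W u \<omega> - W t \<omega>)" using le by linarith
        then show ?thesis using u by blast
      qed (use u in simp)
    qed
    have BX: "emeasure M (Stay t \<inter> ?B) \<le> (\<integral>\<^sup>+ \<omega>. indicator (Stay t) \<omega> * f (W t \<omega>) \<partial>M)"
    proof -
      have "emeasure M (Stay t \<inter> ?B) = (\<integral>\<^sup>+ \<omega>. indicator (Stay t \<inter> ?B) \<omega> \<partial>M)"
        using Bm by (subst nn_integral_indicator) auto
      also have "\<dots> \<le> (\<integral>\<^sup>+ \<omega>. indicator (Stay t) \<omega> * f (W t \<omega>) \<partial>M)"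
        by (intro nn_integral_mono) (auto simp: indicator_def f_def d_def max_def)
      finally show ?thesis .
    qed
    have "emeasure M (Stay t \<inter> Exit t (t + h)) \<le> emeasure M ((Stay t \<inter> ?B) \<union> (Stay t \<inter> ?X))"
      using sub Bm Xm by (intro emeasure_mono sets.Un sets.Int) auto
    also have "\<dots> \<le> emeasure M (Stay t \<inter> ?B) + emeasure M (Stay t \<inter> ?X)"
      using Bm Xm by (intro emeasure_subadditive sets.Int) auto
    also have "\<dots> \<le> (\<integral>\<^sup>+ \<omega>. indicator (Stay t) \<omega> * f (W t \<omega>) \<partial>M) + ennreal (sqrt 2 ^ CARD('m)) * (\<integral>\<^sup>+ \<omega>. indicator (Stay t) \<omega> * f (W t \<omega>) \<partial>M)"
      unfolding f_def
      by (intro add_mono BX[unfolded f_def] maximal_inequality[OF less_imp_le[OF tp] h(1) Sp _ d0]) measurable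
    also have "\<dots> = ennreal (1 + sqrt 2 ^ CARD('m)) * (\<integral>\<^sup>+ \<omega>. indicator (Stay t) \<omega> * f (W t \<omega>) \<partial>M)"
      by (simp add: distrib_right ennreal_plus)
    also have "\<dots> \<le> ennreal (1 + sqrt 2 ^ CARD('m)) * (ennreal (exp (K\<^sup>2 * T / 16)) * ennreal ((1 + 6 * \<beta> * back_rate * \<gamma> * layer_const) * h))"
    proof (intro mult_left_mono)
      let ?m = "\<lambda>\<omega>. ennreal (min 1 (6 * \<beta> * back_rate * (1 + norm (W t \<omega>)) * bdist t (W t \<omega>)))"
      have "(\<integral>\<^sup>+ \<omega>. indicator (Stay t) \<omega> * f (W t \<omega>) \<partial>M) \<le> (\<integral>\<^sup>+ \<omega>. ?m \<omega> * f (W t \<omega>) \<partial>M)"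
        by (rule stay_backward_bound[OF t fm f1])
      also have "\<dots> \<le> (\<integral>\<^sup>+ \<omega>. ennreal (exp (K\<^sup>2 * T / 16)) * (?m \<omega> * ennreal (exp (- (bdist t (W t \<omega>))\<^sup>2 / (32 * h)))) \<partial>M)"
      proof (intro nn_integral_mono)
        fix \<omega>
        define \<rho> where "\<rho> = bdist t (W t \<omega>)"
        have rho: "0 \<le> \<rho>" by (simp add: \<rho>_def)
        \<comment> \<open>Equivalent to \<open>(\<rho> - 2 * (K * h))\<^sup>2 \<ge> 0\<close> when
          the distance exceeds \<open>K * h\<close>. Division by \<open>4 * h\<close> produces the
          rate \<open>1 / (32 * h)\<close> and the harmless summand
          \<open>K\<^sup>2 * h / 16\<close>.\<close>
        have "\<rho>\<^sup>2 / 8 - (K * h)\<^sup>2 / 4 \<le> (d (W t \<omega>))\<^sup>2"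
        proof (cases "K * h \<le> \<rho>")
          case True
          have "0 \<le> (\<rho> - 2 * (K * h))\<^sup>2" by simp
          then have "\<rho>\<^sup>2 / 8 - (K * h)\<^sup>2 / 4 \<le> ((\<rho> - K * h) / 2)\<^sup>2" by (simp add: power2_eq_square field_simps)
          then show ?thesis using True by (simp add: d_def \<rho>_def)
        next
          case False
          then have "\<rho>\<^sup>2 \<le> (K * h)\<^sup>2" using rho by (intro power_mono) auto
          moreover have "0 \<le> (K * h)\<^sup>2" "0 \<le> (d (W t \<omega>))\<^sup>2" by simp_all
          ultimately show ?thesis by linarith
        qed
        then have "(\<rho>\<^sup>2 / 8 - (K * h)\<^sup>2 / 4) / (4 * h) \<le> (d (W t \<omega>))\<^sup>2 / (4 * h)" using h by (intro divide_right_mono) auto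
        moreover have "(\<rho>\<^sup>2 / 8 - (K * h)\<^sup>2 / 4) / (4 * h) = \<rho>\<^sup>2 / (32 * h) - K\<^sup>2 * h / 16"
          using h by (simp add: field_simps power2_eq_square)
        moreover have "K\<^sup>2 * h / 16 \<le> K\<^sup>2 * T / 16" using hh tp by (intro divide_right_mono mult_left_mono) auto
        ultimately have "- (d (W t \<omega>))\<^sup>2 / (4 * h) \<le> K\<^sup>2 * T / 16 + - \<rho>\<^sup>2 / (32 * h)" by simp
        then have "exp (- (d (W t \<omega>))\<^sup>2 / (4 * h)) \<le> exp (K\<^sup>2 * T / 16) * exp (- \<rho>\<^sup>2 / (32 * h))"
          unfolding mult_exp_exp by (rule iffD2[OF exp_le_cancel_iff])
        then have "f (W t \<omega>) \<le> ennreal (exp (K\<^sup>2 * T / 16)) * ennreal (exp (- \<rho>\<^sup>2 / (32 * h)))"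
          unfolding f_def by (subst ennreal_mult [symmetric]) (auto intro: ennreal_leI)
        then have "?m \<omega> * f (W t \<omega>) \<le> ?m \<omega> * (ennreal (exp (K\<^sup>2 * T / 16)) * ennreal (exp (- \<rho>\<^sup>2 / (32 * h))))"
          by (rule mult_left_mono) simp
        then show "?m \<omega> * f (W t \<omega>) \<le> ennreal (exp (K\<^sup>2 * T / 16)) * (?m \<omega> * ennreal (exp (- (bdist t (W t \<omega>))\<^sup>2 / (32 * h))))"
          by (simp only: \<rho>_def mult_ac)
      qed
      also have "\<dots> = ennreal (exp (K\<^sup>2 * T / 16)) * (\<integral>\<^sup>+ \<omega>. ?m \<omega> * ennreal (exp (- (bdist t (W t \<omega>))\<^sup>2 / (32 * h))) \<partial>M)"
        by (rule nn_integral_cmult) measurable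
      also have "\<dots> \<le> ennreal (exp (K\<^sup>2 * T / 16)) * ennreal ((1 + 6 * \<beta> * back_rate * \<gamma> * layer_const) * h)"
        by (intro mult_left_mono wl h(1) hh(1)) simp
      finally show "(\<integral>\<^sup>+ \<omega>. indicator (Stay t) \<omega> * f (W t \<omega>) \<partial>M) \<le> ennreal (exp (K\<^sup>2 * T / 16)) * ennreal ((1 + 6 * \<beta> * back_rate * \<gamma> * layer_const) * h)" .
    qed simp
    also have "\<dots> = ennreal (exit_rate \<gamma> * h)"
    proof -
      have "0 \<le> 1 + 6 * \<beta> * back_rate * \<gamma> * layer_const"
        using beta back_rate(1) g layer_const_pos by (intro add_nonneg_nonneg mult_nonneg_nonneg) auto
      then have "ennreal (exp (K\<^sup>2 * T / 16)) * ennreal ((1 + 6 * \<beta> * back_rate * \<gamma> * layer_const) * h) =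
          ennreal (exp (K\<^sup>2 * T / 16) * ((1 + 6 * \<beta> * back_rate * \<gamma> * layer_const) * h))"
        using \<open>0 \<le> 1 + 6 * \<beta> * back_rate * \<gamma> * layer_const\<close> h
        by (intro ennreal_mult [symmetric] mult_nonneg_nonneg[of "1 + 6 * \<beta> * back_rate * \<gamma> * layer_const" h]) auto
      also have "ennreal (1 + sqrt 2 ^ CARD('m)) * \<dots> = ennreal ((1 + sqrt 2 ^ CARD('m)) * (exp (K\<^sup>2 * T / 16) * ((1 + 6 * \<beta> * back_rate * \<gamma> * layer_const) * h)))"
        using \<open>0 \<le> 1 + 6 * \<beta> * back_rate * \<gamma> * layer_const\<close> h
        by (intro ennreal_mult [symmetric]) auto
      finally show ?thesis unfolding exit_rate_def by (simp only: mult.assoc)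
    qed
    finally have "emeasure M (Stay t \<inter> Exit t (t + h)) \<le> ennreal (exit_rate \<gamma> * h)" .
    then show ?thesis using exit_rate_pos[OF g] h by (simp add: emeasure_eq_measure)
  qed
  ultimately show ?thesis by blast
qed

text \<open>\<open>increment_bound\<close> for the probability of surviving up to \<open>a\<close>
  and exiting in the closed interval. A path with no exit up to \<open>c\<close> has survived to
  \<open>c\<close>, which gives subadditivity; closedness from the left follows by continuity of the
  measure, once an exit exactly at the end point is known to be negligible.\<close>

lemma exit_rate_bound:
  assumes g: "0 < \<gamma>" and reg: "boundary_regular \<gamma>" and ab: "T / 2 \<le> a" "a \<le> b" "b < T"
  shows "measure M (Stay a \<inter> Exit a b) \<le> exit_rate \<gamma> * (b - a)"
proof (rule increment_bound[where l = "T / 2" and r = T, OF _ _ _ _ ab])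
  have pos: "0 < x" if "T / 2 \<le> x" for x using that T by simp
  have SE: "Stay a \<inter> Exit a b \<in> sets M" if "T / 2 \<le> a" "a \<le> b" "b < T" for a b
    using that pos[OF that(1)] by (intro sets.Int Stay_M Exit_M) auto
  \<comment> \<open>A first exit at a fixed time is contained in the exits during an arbitrarily
    short interval, whose probability is of the order of its length.\<close>
  have diag: "measure M (Stay t \<inter> Exit t t) \<le> 0" if t: "T / 2 \<le> t" "t < T" for t
  proof (rule field_le_epsilon)
    fix e :: real assume e: "0 < e"
    obtain h0 where h0: "0 < h0" "\<And>h. 0 < h \<Longrightarrow> h < h0 \<Longrightarrow> measure M (Stay t \<inter> Exit t (t + h)) \<le> exit_rate \<gamma> * h"
      using exit_rate_local[OF t g reg] by blast
    define h where "h = min (h0 / 2) (min ((T - t) / 2) (e / exit_rate \<gamma>))"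
    have h: "0 < h" "h < h0" "t + h < T" "h \<le> e / exit_rate \<gamma>"
    proof -
      show "0 < h" using h0 t e exit_rate_pos[OF g] by (simp add: h_def)
      have "h \<le> h0 / 2" unfolding h_def by (rule min.cobounded1)
      moreover have "h \<le> (T - t) / 2" unfolding h_def by (rule min.coboundedI2[OF min.cobounded1])
      ultimately
      show "h < h0" "t + h < T" using h0 t by auto
      show "h \<le> e / exit_rate \<gamma>" unfolding h_def by (rule min.coboundedI2[OF min.cobounded2])
    qed
    have "measure M (Stay t \<inter> Exit t t) \<le> measure M (Stay t \<inter> Exit t (t + h))"
      using h t by (intro finite_measure_mono SE) (auto simp: Exit_def)
    also have "\<dots> \<le> exit_rate \<gamma> * h" using h0 h by simp
    also have "\<dots> \<le> e" using h(4) exit_rate_pos[OF g] by (simp add: field_simps)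
    finally show "measure M (Stay t \<inter> Exit t t) \<le> 0 + e" by simp
  qed
  show "measure M (Stay a \<inter> Exit a a) \<le> 0" if "T / 2 \<le> a" "a < T" for a using diag that .
  show "\<exists>h0>0. \<forall>h. 0 < h \<and> h < h0 \<longrightarrow> measure M (Stay t \<inter> Exit t (t + h)) \<le> exit_rate \<gamma> * h"
    if "T / 2 \<le> t" "t < T" for t using exit_rate_local[OF that g reg] .
  show "measure M (Stay a \<inter> Exit a b) \<le> measure M (Stay a \<inter> Exit a c) + measure M (Stay c \<inter> Exit c b)"
    if "T / 2 \<le> a" "a \<le> c" "c \<le> b" "b < T" for a b c
  proof -
    have sets: "Stay a \<inter> Exit a c \<in> sets M" "Stay c \<inter> Exit c b \<in> sets M" using that by (auto intro!: SE)
    have "Stay a \<inter> Exit a b \<subseteq> (Stay a \<inter> Exit a c) \<union> (Stay c \<inter> Exit c b)"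
    proof
      fix \<omega> assume w: "\<omega> \<in> Stay a \<inter> Exit a b"
      show "\<omega> \<in> (Stay a \<inter> Exit a c) \<union> (Stay c \<inter> Exit c b)"
      proof (cases "\<omega> \<in> Exit a c")
        case False
        have "W u \<omega> \<in> D u" if "0 < u" "u < c" for u
          using w False that by (cases "u < a") (auto simp: Stay_def Exit_def)
        moreover obtain u where "u \<in> {a..b}" "W u \<omega> \<notin> D u" using w by (auto simp: Exit_def)
        moreover from this have "c \<le> u" using w False by (auto simp: Exit_def)
        ultimately show ?thesis using w by (auto simp: Stay_def Exit_def)
      qed (use w in auto)
    qed
    then have "measure M (Stay a \<inter> Exit a b) \<le> measure M ((Stay a \<inter> Exit a c) \<union> (Stay c \<inter> Exit c b))"
      using sets by (intro finite_measure_mono) auto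
    also have "\<dots> \<le> measure M (Stay a \<inter> Exit a c) + measure M (Stay c \<inter> Exit c b)"
      using sets by (rule measure_Un_le)
    finally show ?thesis .
  qed
  show "measure M (Stay a \<inter> Exit a b) \<le> exit_rate \<gamma> * (b - a)"
    if ab: "T / 2 \<le> a" "a < b" "b < T" and below: "\<And>x. a \<le> x \<Longrightarrow> x < b \<Longrightarrow> measure M (Stay a \<inter> Exit a x) \<le> exit_rate \<gamma> * (x - a)" for a b
  proof -
    define x where "x n = b - (b - a) / real (Suc n)" for n
    have x: "a \<le> x n" "x n < b" "x n \<le> x (Suc n)" for n
    proof -
      have "(b - a) / real (Suc n) \<le> (b - a) / 1" using ab by (intro divide_left_mono) auto
      then show "a \<le> x n" by (simp add: x_def)
      show "x n < b" using ab by (simp add: x_def)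
      have "(b - a) / real (Suc (Suc n)) \<le> (b - a) / real (Suc n)" using ab by (intro divide_left_mono) auto
      then show "x n \<le> x (Suc n)" by (simp add: x_def)
    qed
    have sets: "Stay a \<inter> Exit a (x n) \<in> sets M" for n
      using x(1,2)[of n] ab by (intro SE) auto
    have bb: "Stay b \<inter> Exit b b \<in> sets M" using ab by (intro SE) auto
    have "Stay a \<inter> Exit a b \<subseteq> (\<Union>n. Stay a \<inter> Exit a (x n)) \<union> (Stay b \<inter> Exit b b)"
    proof
      fix \<omega> assume w: "\<omega> \<in> Stay a \<inter> Exit a b"
      then obtain u where u: "u \<in> {a..b}" "W u \<omega> \<notin> D u" by (auto simp: Exit_def)
      show "\<omega> \<in> (\<Union>n. Stay a \<inter> Exit a (x n)) \<union> (Stay b \<inter> Exit b b)"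
      proof (cases "\<exists>u\<in>{a..<b}. W u \<omega> \<notin> D u")
        case True
        then obtain u where u: "a \<le> u" "u < b" "W u \<omega> \<notin> D u" by auto
        have "x \<longlonglongrightarrow> b - 0" unfolding x_def by (intro tendsto_diff tendsto_const LIMSEQ_Suc[OF lim_const_over_n])
        then have "eventually (\<lambda>n. u < x n) sequentially" using u by (intro order_tendstoD(1)) auto
        then obtain n where "u < x n" unfolding eventually_sequentially by blast
        then have "\<omega> \<in> Exit a (x n)" using w u by (auto simp: Exit_def intro!: bexI[of _ u])
        then show ?thesis using w by blast
      next
        case False
        have "W v \<omega> \<in> D v" if "0 < v" "v < b" for v
          using w False that by (cases "v < a") (auto simp: Stay_def)
        moreover have "W b \<omega> \<notin> D b" using u False by (cases "u = b") auto
        ultimately show ?thesis using w by (auto simp: Stay_def Exit_def)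
      qed
    qed
    then have "measure M (Stay a \<inter> Exit a b) \<le> measure M ((\<Union>n. Stay a \<inter> Exit a (x n)) \<union> (Stay b \<inter> Exit b b))"
      using sets bb by (intro finite_measure_mono sets.Un sets.countable_UN) auto
    also have "\<dots> \<le> measure M (\<Union>n. Stay a \<inter> Exit a (x n)) + measure M (Stay b \<inter> Exit b b)"
      using sets bb by (intro measure_Un_le sets.countable_UN) auto
    also have "measure M (Stay b \<inter> Exit b b) \<le> 0" using diag[of b] ab by simp
    also have "measure M (\<Union>n. Stay a \<inter> Exit a (x n)) \<le> exit_rate \<gamma> * (b - a)"
    proof (rule LIMSEQ_le_const2)
      show "(\<lambda>n. measure M (Stay a \<inter> Exit a (x n))) \<longlonglongrightarrow> measure M (\<Union>n. Stay a \<inter> Exit a (x n))"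
      proof (rule finite_Lim_measure_incseq)
        show "incseq (\<lambda>n. Stay a \<inter> Exit a (x n))"
        proof (rule incseq_SucI)
          fix n
          have "{a..x n} \<subseteq> {a..x (Suc n)}" using x(3)[of n] by auto
          then show "Stay a \<inter> Exit a (x n) \<subseteq> Stay a \<inter> Exit a (x (Suc n))" unfolding Exit_def by blast
        qed
      qed (use sets in auto)
      have "measure M (Stay a \<inter> Exit a (x n)) \<le> exit_rate \<gamma> * (b - a)" for n
      proof -
        have "measure M (Stay a \<inter> Exit a (x n)) \<le> exit_rate \<gamma> * (x n - a)" using below x by simp
        also have "\<dots> \<le> exit_rate \<gamma> * (b - a)" using x(2)[of n] exit_rate_pos[OF g] by (intro mult_left_mono) auto
        finally show ?thesis .
      qed
      then show "\<exists>N. \<forall>n\<ge>N. measure M (Stay a \<inter> Exit a (x n)) \<le> exit_rate \<gamma> * (b - a)" by blast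
    qed
    finally show ?thesis by simp
  qed
qed

end

section \<open>Comparing staying probabilities\<close>

context regular_domain
begin

text \<open>Exits before \<open>T / 2\<close>, where exit probabilities are bounded by 1, and a
  geometric series of ratio \<open>1 / sqrt 2\<close> for the dyadic intervals approaching
  \<open>T\<close>.\<close>

definition stay_const :: "real \<Rightarrow> real" where
  "stay_const \<gamma> = escape_const / sqrt (T / 2) + escape_const * exit_rate \<gamma> * (sqrt T / 2) / (1 - 1 / sqrt 2)"

lemma escape_const_nonneg: "0 \<le> escape_const"
  unfolding escape_const_def using beta K T
  by (intro mult_nonneg_nonneg add_nonneg_nonneg divide_nonneg_nonneg) auto

lemma stay_const_nonneg: "0 < \<gamma> \<Longrightarrow> 0 \<le> stay_const \<gamma>"
  unfolding stay_const_def using escape_const_nonneg exit_rate_pos[of \<gamma>] T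
  by (intro add_nonneg_nonneg divide_nonneg_nonneg mult_nonneg_nonneg) auto

text \<open>On a dyadic interval of length l, with remaining time l after it, escaping costs
  \<open>\<epsilon> / sqrt l\<close> and exiting costs l, up to constants. The product
  \<open>\<epsilon> * sqrt l\<close> is summable; this is the discrete form of integrating the
  singularity.\<close>

lemma stay_difference_bound:
  assumes g: "0 < \<gamma>" and reg: "boundary_regular \<gamma>" and eps: "0 < \<epsilon>" "\<epsilon> \<le> \<beta> / 2"
    and U: "\<And>t x. 0 < t \<Longrightarrow> t < T \<Longrightarrow> x \<in> U t \<Longrightarrow> \<exists>z\<in>D t. dist x z < \<epsilon>"
    and Um: "\<And>t. 0 < t \<Longrightarrow> t < T \<Longrightarrow> U t \<in> sets borel"
    and SUm: "{\<omega> \<in> space M. \<forall>u\<in>{0<..<T}. W u \<omega> \<in> U u} \<in> sets M"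
  shows "emeasure M ({\<omega> \<in> space M. \<forall>u\<in>{0<..<T}. W u \<omega> \<in> U u} - Stay T) \<le> ennreal (stay_const \<gamma> * \<epsilon>)"
proof -
  define SU where "SU = {\<omega> \<in> space M. \<forall>u\<in>{0<..<T}. W u \<omega> \<in> U u}"
  have SU [measurable]: "SU \<in> sets M" using SUm by (simp only: SU_def)
  note e0 = escape_const_nonneg
  have R: "0 < exit_rate \<gamma>" by (rule exit_rate_pos[OF g])
  have esc: "emeasure M (A \<inter> Exit a b \<inter> SU) \<le> ennreal (escape_const * \<epsilon> / sqrt (T - b)) * emeasure M (A \<inter> Exit a b)"
    if "0 < a" "a < b" "b < T" "A \<in> sets (past a)" for A a b
    unfolding SU_def using escape_Exit[OF that eps U Um] .
  define S1 where "S1 = {\<omega> \<in> SU. \<exists>u\<in>{0<..T / 2}. W u \<omega> \<notin> D u}"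
  have S1: "emeasure M S1 \<le> ennreal (escape_const * \<epsilon> / sqrt (T / 2))"
  proof (rule emeasure_eventually_le)
    \<comment> \<open>Sections are controlled only at positive times. The bound in
      \<open>escape_Exit\<close> does not depend on the left end point, so that end point may tend
      to 0.\<close>
    let ?r = "\<lambda>n. T / (2 * real (n + 2))"
    have r: "0 < ?r n" "?r n < T / 2" for n
    proof -
      show "0 < ?r n" using T by simp
      have "T * 2 < T * (2 * real (n + 2))" using T by (intro mult_strict_left_mono) auto
      then show "?r n < T / 2" using T by (simp add: field_simps)
    qed
    have EM: "Exit (?r n) (T / 2) \<in> sets M" for n using r[of n] T by (intro Exit_M) auto
    show "Exit (?r n) (T / 2) \<inter> SU \<in> sets M" for n using EM SU by (rule sets.Int)
    have "emeasure M (Exit (?r n) (T / 2) \<inter> SU) \<le> ennreal (escape_const * \<epsilon> / sqrt (T / 2))" for n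
    proof -
      have top: "space M \<in> sets (past (?r n))" using sets.top[of "past (?r n)"] by (simp only: space_past)
      have T2: "T / 2 < T" using T by simp
      have sp: "space M \<inter> Exit (?r n) (T / 2) = Exit (?r n) (T / 2)" by (auto simp: Exit_def)
      have "emeasure M (Exit (?r n) (T / 2) \<inter> SU) \<le> ennreal (escape_const * \<epsilon> / sqrt (T - T / 2)) * emeasure M (Exit (?r n) (T / 2))"
        using esc[OF r T2 top] unfolding sp .
      also have "\<dots> \<le> ennreal (escape_const * \<epsilon> / sqrt (T - T / 2)) * 1"
        by (intro mult_left_mono emeasure_le_1) simp
      finally show ?thesis by simp
    qed
    then show "eventually (\<lambda>n. emeasure M (Exit (?r n) (T / 2) \<inter> SU) \<le> ennreal (escape_const * \<epsilon> / sqrt (T / 2))) sequentially"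
      by (intro always_eventually allI)
    fix \<omega> assume "\<omega> \<in> S1"
    then obtain u where u: "\<omega> \<in> SU" "0 < u" "u \<le> T / 2" "W u \<omega> \<notin> D u" by (auto simp: S1_def)
    have sp: "\<omega> \<in> space M" using u(1) by (simp add: SU_def)
    have "(\<lambda>n. (T / 2) / real (n + 2)) \<longlonglongrightarrow> 0" by (rule LIMSEQ_ignore_initial_segment[OF lim_const_over_n])
    then have "eventually (\<lambda>n. (T / 2) / real (n + 2) < u) sequentially" using u by (intro order_tendstoD(2))
    then show "eventually (\<lambda>n. \<omega> \<in> Exit (?r n) (T / 2) \<inter> SU) sequentially"
    proof eventually_elim
      case (elim n)
      then have "?r n \<le> u" by simp
      then show ?case using u sp by (auto simp: Exit_def intro!: bexI[of _ u])
    qed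
  qed
  \<comment> \<open>Each interval is as long as the time remaining after its right end: both equal
    \<open>T / 2 ^ (i + 2)\<close>.\<close>
  define a where "a i = T - T / 2 ^ (i + 1)" for i :: nat
  have a: "T / 2 \<le> a i" "a i < a (Suc i)" "a (Suc i) < T" "0 < a i" "a (Suc i) - a i = T / 2 ^ (i + 2)" "T - a (Suc i) = T / 2 ^ (i + 2)" for i
  proof -
    have "T / 2 ^ (i + 1) \<le> T / 2" using T by (intro divide_left_mono) auto
    then show 1: "T / 2 \<le> a i" by (simp add: a_def)
    then show "0 < a i" using T by linarith
    show 2: "a (Suc i) - a i = T / 2 ^ (i + 2)" by (simp add: a_def field_simps)
    show 3: "T - a (Suc i) = T / 2 ^ (i + 2)" by (simp add: a_def)
    have "0 < T / 2 ^ (i + 2)" using T by simp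
    then show "a i < a (Suc i)" "a (Suc i) < T" using 2 3 by linarith+
  qed
  define B where "B i = Stay (a i) \<inter> Exit (a i) (a (Suc i)) \<inter> SU" for i
  have SM: "Stay (a i) \<in> sets M" for i using a[of i] by (intro Stay_M) auto
  have EM: "Exit (a i) (a (Suc i)) \<in> sets M" for i using a[of i] by (intro Exit_M) auto
  have BM: "B i \<in> sets M" for i unfolding B_def by (intro sets.Int SM EM SU)
  have Bi: "emeasure M (B i) \<le> ennreal (escape_const * \<epsilon> * exit_rate \<gamma> * (sqrt T / 2) * (1 / sqrt 2) ^ i)" for i
  proof -
    define t where "t = T / 2 ^ (i + 2)"
    have t: "0 < t" using T by (simp add: t_def)
    have sp: "Stay (a i) \<in> sets (past (a i))" using a[of i] by (intro Stay_past) auto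
    have nn: "0 \<le> escape_const * \<epsilon> / sqrt t" using e0 eps t by simp
    have "emeasure M (B i) \<le> ennreal (escape_const * \<epsilon> / sqrt t) * emeasure M (Stay (a i) \<inter> Exit (a i) (a (Suc i)))"
      using esc[OF a(4) a(2) a(3) sp] unfolding B_def a(6) t_def .
    also have "emeasure M (Stay (a i) \<inter> Exit (a i) (a (Suc i))) = ennreal (measure M (Stay (a i) \<inter> Exit (a i) (a (Suc i))))"
      by (rule emeasure_eq_measure)
    also have "ennreal (escape_const * \<epsilon> / sqrt t) * \<dots> \<le> ennreal (escape_const * \<epsilon> / sqrt t) * ennreal (exit_rate \<gamma> * t)"
      using exit_rate_bound[OF g reg a(1) less_imp_le[OF a(2)] a(3), of i] unfolding a(5) t_def
      by (intro mult_left_mono ennreal_leI) auto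
    also have "\<dots> = ennreal (escape_const * \<epsilon> / sqrt t * (exit_rate \<gamma> * t))"
      using nn R t by (intro ennreal_mult [symmetric]) auto
    also have "escape_const * \<epsilon> / sqrt t * (exit_rate \<gamma> * t) = escape_const * \<epsilon> * exit_rate \<gamma> * (t / sqrt t)"
      by simp
    also have "t / sqrt t = sqrt t" by (rule real_div_sqrt) (use t in simp)
    also have "sqrt t = (sqrt T / 2) * (1 / sqrt 2) ^ i"
      unfolding t_def by (simp add: real_sqrt_divide real_sqrt_power power_add power_one_over field_simps real_sqrt_mult)
    finally show ?thesis by (simp only: mult.assoc)
  qed
  have q: "0 \<le> 1 / sqrt 2" "1 / sqrt 2 < (1 :: real)" by auto
  have "emeasure M (\<Union>i. B i) \<le> (\<Sum>i. emeasure M (B i))"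
    using BM by (intro emeasure_subadditive_countably) auto
  also have "\<dots> \<le> (\<Sum>i. ennreal (escape_const * \<epsilon> * exit_rate \<gamma> * (sqrt T / 2) * (1 / sqrt 2) ^ i))"
    by (intro suminf_le Bi) auto
  also have "\<dots> = ennreal (escape_const * \<epsilon> * exit_rate \<gamma> * (sqrt T / 2) * (1 / (1 - 1 / sqrt 2)))"
  proof (rule suminf_ennreal_eq)
    show "0 \<le> escape_const * \<epsilon> * exit_rate \<gamma> * (sqrt T / 2) * (1 / sqrt 2) ^ i" for i
      using e0 eps R T by (intro mult_nonneg_nonneg) auto
    show "(\<lambda>i. escape_const * \<epsilon> * exit_rate \<gamma> * (sqrt T / 2) * (1 / sqrt 2) ^ i) sums
        (escape_const * \<epsilon> * exit_rate \<gamma> * (sqrt T / 2) * (1 / (1 - 1 / sqrt 2)))"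
      by (intro sums_mult geometric_sums) auto
  qed
  finally have S2: "emeasure M (\<Union>i. B i) \<le> ennreal (escape_const * \<epsilon> * exit_rate \<gamma> * (sqrt T / 2) * (1 / (1 - 1 / sqrt 2)))" .
  have sub: "SU - Stay T \<subseteq> S1 \<union> (\<Union>i. B i)"
  proof
    fix \<omega> assume w: "\<omega> \<in> SU - Stay T"
    then have sp: "\<omega> \<in> space M" by (simp add: SU_def)
    obtain u where u: "0 < u" "u < T" "W u \<omega> \<notin> D u" using w sp by (auto simp: Stay_def)
    show "\<omega> \<in> S1 \<union> (\<Union>i. B i)"
    proof (cases "\<exists>v\<in>{0<..T / 2}. W v \<omega> \<notin> D v")
      case True
      then show ?thesis using w by (auto simp: S1_def)
    next
      case early: False
      \<comment> \<open>The least such index locates the interval of the first exit; no exit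
        happened up to \<open>a i\<close>, so the path also lies in
        \<open>Stay (a i)\<close>.\<close>
      define P where "P i \<longleftrightarrow> (\<exists>v\<in>{0<..a (Suc i)}. W v \<omega> \<notin> D v)" for i
      have "(\<lambda>i. T / 2 ^ i) \<longlonglongrightarrow> 0" by (rule LIMSEQ_divide_realpow_zero) simp
      then have "eventually (\<lambda>i. T / 2 ^ i < T - u) sequentially" using u by (intro order_tendstoD(2)) auto
      then obtain n where "T / 2 ^ n < T - u" unfolding eventually_sequentially by blast
      moreover have "T / 2 ^ (n + 2) \<le> T / 2 ^ n" using T by (intro divide_left_mono power_increasing) auto
      ultimately have "u \<le> a (Suc n)" using a(6)[of n] by linarith
      then have Pn: "P n" using u by (auto simp: P_def)
      define i where "i = (LEAST i. P i)"
      have i: "P i" "\<And>k. k < i \<Longrightarrow> \<not> P k" unfolding i_def using Pn by (auto intro: LeastI dest: not_less_Least)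
      have none: "W v \<omega> \<in> D v" if v: "0 < v" "v \<le> a i" for v
      proof (cases i)
        case 0
        then have "v \<le> T / 2" using v by (simp add: a_def)
        then show ?thesis using early v by auto
      next
        case (Suc k)
        then show ?thesis using i(2)[of k] v by (auto simp: P_def)
      qed
      obtain v where v: "0 < v" "v \<le> a (Suc i)" "W v \<omega> \<notin> D v" using i(1) by (auto simp: P_def)
      then have "a i \<le> v" using none[of v] by (cases "v \<le> a i") auto
      then have "\<omega> \<in> Exit (a i) (a (Suc i))" using v sp by (auto simp: Exit_def)
      moreover have "\<omega> \<in> Stay (a i)" using none sp by (auto simp: Stay_def)
      ultimately show ?thesis using w by (auto simp: B_def)
    qed
  qed
  \<comment> \<open>\<open>Stay (T / 2)\<close> says nothing about the time \<open>T / 2\<close>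
    itself, so an exit exactly then is added separately.\<close>
  have S1m: "S1 \<in> sets M"
  proof -
    have "S1 = SU - Stay (T / 2) \<union> (SU \<inter> Exit (T / 2) (T / 2))"
    proof (intro set_eqI iffI)
      fix \<omega> assume "\<omega> \<in> S1"
      then obtain u where u: "\<omega> \<in> SU" "0 < u" "u \<le> T / 2" "W u \<omega> \<notin> D u" by (auto simp: S1_def)
      show "\<omega> \<in> SU - Stay (T / 2) \<union> (SU \<inter> Exit (T / 2) (T / 2))"
      proof (cases "u < T / 2")
        case True
        then show ?thesis using u by (auto simp: Stay_def)
      next
        case False
        then have "u = T / 2" using u(3) by simp
        from u(4) have "W (T / 2) \<omega> \<notin> D (T / 2)" unfolding \<open>u = T / 2\<close> .
        then show ?thesis using u(1) by (auto simp: Exit_def SU_def)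
      qed
    next
      fix \<omega> assume "\<omega> \<in> SU - Stay (T / 2) \<union> (SU \<inter> Exit (T / 2) (T / 2))"
      then consider "\<omega> \<in> SU" "\<omega> \<notin> Stay (T / 2)" | "\<omega> \<in> SU" "\<omega> \<in> Exit (T / 2) (T / 2)" by blast
      then show "\<omega> \<in> S1"
      proof cases
        case 1
        then obtain u where "0 < u" "u < T / 2" "W u \<omega> \<notin> D u" by (auto simp: Stay_def SU_def)
        then show ?thesis using 1 unfolding S1_def by (intro CollectI conjI bexI[of _ u]) auto
      next
        case 2
        then have "W (T / 2) \<omega> \<notin> D (T / 2)" by (simp add: Exit_def)
        then show ?thesis using 2 T unfolding S1_def by (intro CollectI conjI bexI[of _ "T / 2"]) auto
      qed
    qed
    moreover have "Stay (T / 2) \<in> sets M" using T by (intro Stay_M) auto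
    moreover have "Exit (T / 2) (T / 2) \<in> sets M" using T by (intro Exit_M) auto
    ultimately show ?thesis using SU by (metis sets.Diff sets.Int sets.Un)
  qed
  have "emeasure M (SU - Stay T) \<le> emeasure M (S1 \<union> (\<Union>i. B i))"
    using BM by (intro emeasure_mono[OF sub] sets.Un S1m sets.countable_UN) auto
  also have "\<dots> \<le> emeasure M S1 + emeasure M (\<Union>i. B i)"
    using BM by (intro emeasure_subadditive S1m sets.countable_UN) auto
  also have "\<dots> \<le> ennreal (escape_const * \<epsilon> / sqrt (T / 2)) + ennreal (escape_const * \<epsilon> * exit_rate \<gamma> * (sqrt T / 2) * (1 / (1 - 1 / sqrt 2)))"
    by (intro add_mono S1 S2)
  also have "\<dots> = ennreal (escape_const * \<epsilon> / sqrt (T / 2) + escape_const * \<epsilon> * exit_rate \<gamma> * (sqrt T / 2) * (1 / (1 - 1 / sqrt 2)))"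
    using e0 eps R T by (intro ennreal_plus [symmetric] mult_nonneg_nonneg divide_nonneg_nonneg) auto
  also have "escape_const * \<epsilon> / sqrt (T / 2) + escape_const * \<epsilon> * exit_rate \<gamma> * (sqrt T / 2) * (1 / (1 - 1 / sqrt 2)) = stay_const \<gamma> * \<epsilon>"
  proof -
    have "e * x / p + e * x * r * t * (1 / z) = (e / p + e * r * t / z) * x" for e x p r t z :: real
      by (simp add: distrib_right)
    then show ?thesis unfolding stay_const_def .
  qed
  finally show ?thesis by (simp only: SU_def)
qed

end

section \<open>Passing from the class of domains to staying probabilities\<close>

context std_brownian_motion
begin

text \<open>The larger domains carry no regularity of their sections, so the distance to the
  complement is taken in space-time, where openness alone makes it detect membership.\<close>

lemma stay_event_measurable:
  assumes G: "open G" "G \<subseteq> {0<..<T} \<times> UNIV" and T: "0 < T"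
  shows "{\<omega> \<in> space M. \<forall>t\<in>{0<..<T}. (t, W t \<omega>) \<in> G} \<in> sets M"
proof -
  have "(0, 0) \<notin> G" using G(2) by auto
  then have ne: "- G \<noteq> {}" by blast
  have cl: "closed (- G)" using G(1) by (simp add: closed_def)
  define r where "r n = T / real (n + 3)" for n :: nat
  have r: "0 < r n" "r n \<le> T - r n" "T - r n < T" for n
  proof -
    show "0 < r n" using T by (simp add: r_def)
    then show "T - r n < T" by simp
    have "2 * T \<le> T * real (n + 3)" using T by (simp add: algebra_simps)
    then show "r n \<le> T - r n" using T unfolding r_def by (simp add: field_simps)
  qed
  define E where "E n = {\<omega> \<in> space M. \<exists>u\<in>{r n..T - r n}. infdist (u, W u \<omega>) (- G) \<le> 0}" for n
  have "E n \<in> sets M" for n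
    unfolding E_def
  proof (rule measurable_Ex_le[OF r(2)])
    fix u assume "r n \<le> u"
    then have [measurable]: "W u \<in> borel_measurable M" using W_measurable r(1)[of n] by simp
    have "(\<lambda>p. infdist p (- G)) \<in> borel_measurable borel"
      by (intro borel_measurable_continuous_onI continuous_intros)
    then show "(\<lambda>\<omega>. infdist (u, W u \<omega>) (- G)) \<in> borel_measurable M"
      by (rule measurable_compose[rotated]) measurable
  next
    fix \<omega> assume "\<omega> \<in> space M"
    from continuous_on_subset[OF W_continuous[OF this], of "{r n..T - r n}"]
    have "continuous_on {r n..T - r n} (\<lambda>u. W u \<omega>)" using r(1)[of n] by auto
    then show "continuous_on {r n..T - r n} (\<lambda>u. infdist (u, W u \<omega>) (- G))"
      by (intro continuous_on_infdist continuous_on_Pair continuous_on_id)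
  qed
  then have "space M - (\<Union>n. E n) \<in> sets M" by (intro sets.Diff sets.top sets.countable_UN image_subsetI)
  also have "space M - (\<Union>n. E n) = {\<omega> \<in> space M. \<forall>t\<in>{0<..<T}. (t, W t \<omega>) \<in> G}"
  proof -
    have z: "infdist p (- G) \<le> 0 \<longleftrightarrow> p \<notin> G" for p
      using in_closed_iff_infdist_zero[OF cl ne, of p] infdist_nonneg[of p "- G"] by auto
    have cov: "(\<exists>n. u \<in> {r n..T - r n}) \<longleftrightarrow> u \<in> {0<..<T}" for u
    proof
      assume "\<exists>n. u \<in> {r n..T - r n}"
      then obtain n where n: "r n \<le> u" "u \<le> T - r n" by auto
      then show "u \<in> {0<..<T}" using r(1)[of n] by auto
    next
      assume u: "u \<in> {0<..<T}"
      have lim: "r \<longlonglongrightarrow> 0"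
        unfolding r_def by (rule LIMSEQ_ignore_initial_segment[OF lim_const_over_n])
      have "eventually (\<lambda>n. r n < u) sequentially" "eventually (\<lambda>n. r n < T - u) sequentially"
        using u by (auto intro!: order_tendstoD(2)[OF lim])
      then have "eventually (\<lambda>n. r n < u \<and> r n < T - u) sequentially" by (rule eventually_conj)
      then obtain n where n: "r n < u" "r n < T - u" unfolding eventually_sequentially by blast
      then have "u \<in> {r n..T - r n}" by simp
      then show "\<exists>n. u \<in> {r n..T - r n}" by blast
    qed
    have "\<omega> \<in> (\<Union>n. E n) \<longleftrightarrow> \<omega> \<in> space M \<and> (\<exists>u\<in>{0<..<T}. (u, W u \<omega>) \<notin> G)" for \<omega>
      unfolding E_def using z cov by blast
    then show ?thesis by blast
  qed
  finally show ?thesis .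
qed

end

lemma open_time_section:
  assumes "open H"
  shows "open (time_section H t)"
proof -
  have "time_section H t = Pair t -` H" by (auto simp: time_section_def)
  then show ?thesis using open_vimage[OF assms, of "Pair t"] by (simp add: continuous_on_Pair)
qed

text \<open>The class bounds the distance only for ordered times; the symmetry of
  \<open>hausdorff_h\<close> covers the reverse order.\<close>

lemma hausdorff_H_near:
  assumes "0 \<le> K"
    and HH: "\<And>s t. 0 < s \<Longrightarrow> s < t \<Longrightarrow> t < T \<Longrightarrow> hausdorff_H (A s) (A t) \<le> ereal (K * (t - s))"
    and st: "0 < s" "s < T" "0 < t" "t < T" and e: "K * \<bar>s - t\<bar> < e"
  shows "x \<in> A s \<Longrightarrow> \<exists>y\<in>A t. dist x y < e" and "x \<in> - A s \<Longrightarrow> \<exists>y\<in>- A t. dist x y < e"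
proof -
  consider "s < t" | "s = t" | "t < s" by linarith
  then have "(x \<in> A s \<longrightarrow> (\<exists>y\<in>A t. dist x y < e)) \<and> (x \<in> - A s \<longrightarrow> (\<exists>y\<in>- A t. dist x y < e))"
  proof cases
    case 1
    then have "hausdorff_h (A s) (A t) \<le> ereal (K * (t - s))" "hausdorff_h (- A s) (- A t) \<le> ereal (K * (t - s))"
      using HH[of s t] st by (auto simp: hausdorff_H_def)
    then show ?thesis using hausdorff_h_bound[of _ _ "K * (t - s)" x e] e 1 by auto
  next
    case 2
    then have "dist x x < e" using e by simp
    then show ?thesis using 2 by blast
  next
    case 3
    then have "hausdorff_h (A s) (A t) \<le> ereal (K * (s - t))" "hausdorff_h (- A s) (- A t) \<le> ereal (K * (s - t))"
      using HH[of t s] st hausdorff_h_sym[of "A s" "A t"] hausdorff_h_sym[of "- A s" "- A t"] by (auto simp: hausdorff_H_def)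
    then show ?thesis using hausdorff_h_bound[of _ _ "K * (s - t)" x e] e 3 by auto
  qed
  then show "x \<in> A s \<Longrightarrow> \<exists>y\<in>A t. dist x y < e" and "x \<in> - A s \<Longrightarrow> \<exists>y\<in>- A t. dist x y < e" by auto
qed

lemma (in std_brownian_motion) class_GK_regular_domain:
  assumes T: "0 < T" and K: "0 < K" and b: "0 < \<beta>" and g: "0 < \<gamma>" and G: "G \<in> class_GK M W T K \<beta> \<gamma>"
    and ne: "\<And>t. 0 < t \<Longrightarrow> t < T \<Longrightarrow> - time_section G t \<noteq> {}"
  shows "regular_domain M W T K \<beta> (time_section G)"
    and "regular_domain.boundary_regular M W T (time_section G) \<gamma>"
proof -
  note G' = G[unfolded class_GK_def class_G_def mem_Collect_eq]
  have op: "open G" using G' by blast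
  have HH: "hausdorff_H (time_section G s) (time_section G t) \<le> ereal (K * (t - s))" if "0 < s" "s < t" "t < T" for s t
    using G' that by blast
  note near = hausdorff_H_near[of K T "time_section G", OF less_imp_le[OF K] HH]
  show rd: "regular_domain M W T K \<beta> (time_section G)"
  proof unfold_locales
    show "\<exists>y\<in>time_section G t. dist x y < e" if "0 < s" "s < T" "0 < t" "t < T" "x \<in> time_section G s" "K * \<bar>s - t\<bar> < e" for s t x e
      using near(1)[of s t e x] that by blast
    show "\<exists>y. y \<notin> time_section G t \<and> dist x y < e" if "0 < s" "s < T" "0 < t" "t < T" "x \<notin> time_section G s" "K * \<bar>s - t\<bar> < e" for s t x e
      using near(2)[of s t e x] that by blast
    show "\<exists>y. ball y \<beta> \<inter> time_section G t = {} \<and> dist y gg = \<beta>" if gg: "0 < t" "t < T" "gg \<in> frontier (time_section G t)" for t gg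
    proof -
      have "t \<in> {0<..<T}" using gg by simp
      then obtain y where "ball y \<beta> \<subseteq> - time_section G t" "gg \<in> frontier (ball y \<beta>)" using G' gg(3) by blast
      then show ?thesis using b by (intro exI[of _ y]) (auto simp: frontier_ball)
    qed
  qed (use T K b ne open_time_section[OF op] in auto)
  interpret regular_domain M W T K \<beta> "time_section G" by (rule rd)
  show "boundary_regular \<gamma>"
    unfolding boundary_regular_def
  proof
    fix t assume t: "t \<in> {0<..<T}"
    then have tp: "0 < t" "t < T" by auto
    have [measurable]: "W t \<in> borel_measurable M" using W_measurable tp by simp
    have sd: "set_dist x (- time_section G t) = ereal (bdist t x)" for x
      using set_dist_eq_infdist[OF ne[OF tp], of x] by (simp add: bdist_def)
    obtain v0 where v0: "0 < v0" and v: "\<And>v. 0 < v \<Longrightarrow> v < v0 \<Longrightarrow>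
        (LINT \<omega>:{\<omega> \<in> space M. 0 < set_dist (W t \<omega>) (- time_section G t) \<and> set_dist (W t \<omega>) (- time_section G t) < ereal v}|M. 1 + norm (W t \<omega>)) < \<gamma> * v"
      using G' t by blast
    have "(\<integral>\<^sup>+ \<omega>. ennreal (1 + norm (W t \<omega>)) \<partial>M) = (\<integral>\<^sup>+ x. ennreal (1 + norm (x :: real ^ 'm)) \<partial>gauss_measure t)"
      unfolding distr_W[OF tp(1), symmetric] by (rule nn_integral_distr [symmetric]) measurable
    also have "\<dots> < \<infinity>" by (rule nn_integral_norm_gauss_finite[OF tp(1)])
    finally have int: "integrable M (\<lambda>\<omega>. 1 + norm (W t \<omega>))"
      by (intro integrableI_nonneg) auto
    have "(\<integral>\<^sup>+ \<omega>. indicator {\<omega>. 0 < bdist t (W t \<omega>) \<and> bdist t (W t \<omega>) < v} \<omega> * ennreal (1 + norm (W t \<omega>)) \<partial>M) \<le> ennreal (\<gamma> * v)"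
      if vv: "0 < v" "v < v0" for v
    proof -
      define A where "A = {\<omega> \<in> space M. 0 < bdist t (W t \<omega>) \<and> bdist t (W t \<omega>) < v}"
      have Am: "A \<in> sets M" unfolding A_def by measurable
      have eq: "{\<omega> \<in> space M. 0 < set_dist (W t \<omega>) (- time_section G t) \<and> set_dist (W t \<omega>) (- time_section G t) < ereal v} = A"
        by (simp add: sd A_def)
      have "(\<integral>\<^sup>+ \<omega>. indicator {\<omega>. 0 < bdist t (W t \<omega>) \<and> bdist t (W t \<omega>) < v} \<omega> * ennreal (1 + norm (W t \<omega>)) \<partial>M) =
          (\<integral>\<^sup>+ \<omega>. ennreal (indicator A \<omega> *\<^sub>R (1 + norm (W t \<omega>))) \<partial>M)"
        by (intro nn_integral_cong) (auto simp: A_def indicator_def)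
      also have "\<dots> = ennreal (LINT \<omega>:A|M. 1 + norm (W t \<omega>))"
        unfolding set_lebesgue_integral_def
        by (intro nn_integral_eq_integral integrable_mult_indicator[OF Am int]) auto
      also have "\<dots> \<le> ennreal (\<gamma> * v)"
        using v[OF vv] unfolding eq by (intro ennreal_leI) simp
      finally show ?thesis .
    qed
    then show "\<exists>v0>0. \<forall>v. 0 < v \<and> v < v0 \<longrightarrow>
     (\<integral>\<^sup>+ \<omega>. indicator {\<omega>. 0 < bdist t (W t \<omega>) \<and> bdist t (W t \<omega>) < v} \<omega> * ennreal (1 + norm (W t \<omega>)) \<partial>M) \<le> ennreal (\<gamma> * v)"
      using v0 by blast
  qed
qed

text \<open>Places the probability of any admissible larger domain in an interval of length
  \<open>stay_const \<gamma> * \<epsilon>\<close> above that of \<open>G\<close>, so two such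
  probabilities differ by no more than this length.\<close>

lemma (in regular_domain) stay_prob_difference:
  assumes D: "D = time_section G" and G: "G \<subseteq> G'" and G': "G' \<in> class_G T" "G' \<subseteq> space_nbhd T G \<epsilon>"
    and g: "0 < \<gamma>" and reg: "boundary_regular \<gamma>" and eps: "0 < \<epsilon>" "\<epsilon> \<le> \<beta> / 2"
  shows "stay_prob M W T G \<le> stay_prob M W T G'" and "stay_prob M W T G' \<le> stay_prob M W T G + stay_const \<gamma> * \<epsilon>"
proof -
  define SU where "SU = {\<omega> \<in> space M. \<forall>u\<in>{0<..<T}. W u \<omega> \<in> time_section G' u}"
  have oG: "open G'" "G' \<subseteq> {0<..<T} \<times> UNIV" using G'(1) by (auto simp: class_G_def)
  have SU: "SU \<in> sets M" using stay_event_measurable[OF oG T] by (simp only: SU_def time_section_def mem_Collect_eq)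
  have St: "Stay T \<in> sets M" using T by (intro Stay_M) auto
  have DG: "x \<in> D t \<longleftrightarrow> (t, x) \<in> G" for t x by (simp add: D time_section_def)
  have p: "stay_prob M W T G = measure M (Stay T)" "stay_prob M W T G' = measure M SU"
    by (simp_all only: stay_prob_def Stay_def SU_def DG time_section_def mem_Collect_eq)
  have sub: "Stay T \<subseteq> SU" using G by (auto simp: Stay_def SU_def DG time_section_def)
  show "stay_prob M W T G \<le> stay_prob M W T G'" unfolding p using sub SU by (rule finite_measure_mono)
  have "emeasure M (SU - Stay T) \<le> ennreal (stay_const \<gamma> * \<epsilon>)"
    unfolding SU_def
  proof (rule stay_difference_bound[OF g reg eps])
    fix t x assume "x \<in> time_section G' t"
    then have "(t, x) \<in> space_nbhd T G \<epsilon>" using G'(2) by (auto simp: time_section_def)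
    then show "\<exists>z\<in>D t. dist x z < \<epsilon>"
      by (auto simp: space_nbhd_def nbhd_def set_dist_def INF_less_iff D)
  next
    show "time_section G' t \<in> sets borel" for t using open_time_section[OF oG(1)] by simp
    show "{\<omega> \<in> space M. \<forall>u\<in>{0<..<T}. W u \<omega> \<in> time_section G' u} \<in> sets M" using SU by (simp only: SU_def)
  qed
  then have "measure M (SU - Stay T) \<le> stay_const \<gamma> * \<epsilon>"
    using stay_const_nonneg[OF g] eps by (simp add: emeasure_eq_measure)
  then show "stay_prob M W T G' \<le> stay_prob M W T G + stay_const \<gamma> * \<epsilon>"
    unfolding p using finite_measure_Diff[OF SU St sub] by simp
qed

theorem corollary2:
  fixes M :: "'w measure" and W :: "real \<Rightarrow> 'w \<Rightarrow> real ^ 'm"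
    and T K \<beta> \<gamma> :: real
  assumes "std_brownian_motion M W"
    and "0 < T" and "0 < K" and "0 < \<beta>" and "0 < \<gamma>"
  shows "\<exists>c::real. \<forall>G \<in> class_GK M W T K \<beta> \<gamma>. \<forall>\<epsilon>>0.
           \<forall>G' \<in> class_G T. \<forall>G'' \<in> class_G T.
             G \<subseteq> G' \<and> G' \<subseteq> space_nbhd T G \<epsilon> \<and> G \<subseteq> G'' \<and> G'' \<subseteq> space_nbhd T G \<epsilon> \<longrightarrow>
             \<bar>stay_prob M W T G' - stay_prob M W T G''\<bar> < c * \<epsilon>"
proof -
  interpret std_brownian_motion M W by (rule assms(1))
  note T = \<open>0 < T\<close> and K = \<open>0 < K\<close> and b = \<open>0 < \<beta>\<close> and g = \<open>0 < \<gamma>\<close>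
  \<comment> \<open>Outside the locale the constant takes the dimension and the parameters as its
    only arguments, which is the asserted independence of \<open>G\<close>.\<close>
  define C where "C = regular_domain.stay_const TYPE('m) T K \<beta> \<gamma>"
  show ?thesis
  \<comment> \<open>The summand \<open>2 / \<beta>\<close> handles \<epsilon> above
    \<open>\<beta> / 2\<close>, where the difference of probabilities is trivially at most 1; the
    last 1 makes the inequality strict.\<close>
  proof (intro exI[of _ "\<bar>C\<bar> + 2 / \<beta> + 1"] ballI allI impI)
    fix G \<epsilon> G' G''
    assume G: "G \<in> class_GK M W T K \<beta> \<gamma>" and eps: "0 < \<epsilon>" and G': "G' \<in> class_G T" and G'': "G'' \<in> class_G T"
      and H: "G \<subseteq> G' \<and> G' \<subseteq> space_nbhd T G \<epsilon> \<and> G \<subseteq> G'' \<and> G'' \<subseteq> space_nbhd T G \<epsilon>"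
    have bnd: "0 \<le> \<bar>C\<bar> * \<epsilon>" "0 \<le> 2 / \<beta> * \<epsilon>" using eps b by auto
    have "\<bar>stay_prob M W T G' - stay_prob M W T G''\<bar> \<le> \<bar>C\<bar> * \<epsilon> + 2 / \<beta> * \<epsilon>"
    proof (cases "\<epsilon> \<le> \<beta> / 2")
      case False
      then have "1 \<le> 2 / \<beta> * \<epsilon>" using b by (simp add: field_simps)
      moreover have "\<bar>stay_prob M W T G' - stay_prob M W T G''\<bar> \<le> 1"
        unfolding stay_prob_def abs_le_iff
        by (smt (verit) measure_nonneg prob_le_1)
      ultimately show ?thesis using bnd(1) by linarith
    next
      case small: True
      show ?thesis
      \<comment> \<open>One full section forces all sections to be full: complements at different
        times have points within a finite distance of each other, so they are empty together. Then
        every path stays and both probabilities coincide.\<close>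
      proof (cases "\<exists>t. 0 < t \<and> t < T \<and> - time_section G t = {}")
        case True
        then obtain t where t: "0 < t" "t < T" "- time_section G t = {}" by blast
        have HH: "hausdorff_H (time_section G s) (time_section G t) \<le> ereal (K * (t - s))" if "0 < s" "s < t" "t < T" for s t
          using G that unfolding class_GK_def by blast
        have sec: "(s, x) \<in> G" if "0 < s" "s < T" for s x
        proof (rule ccontr)
          assume "(s, x) \<notin> G"
          then have "x \<in> - time_section G s" by (simp add: time_section_def)
          moreover have "K * \<bar>s - t\<bar> < K * \<bar>s - t\<bar> + 1" by simp
          ultimately show False
            using hausdorff_H_near(2)[of K T "time_section G" s t "K * \<bar>s - t\<bar> + 1" x] K HH that t by auto
        qed
        have "stay_prob M W T G' = measure M (space M)" "stay_prob M W T G'' = measure M (space M)"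
          unfolding stay_prob_def using H sec by (auto intro!: arg_cong[where f = "measure M"])
        then show ?thesis using bnd by simp
      next
        case False
        then have ne: "\<And>t. 0 < t \<Longrightarrow> t < T \<Longrightarrow> - time_section G t \<noteq> {}" by blast
        interpret R: regular_domain M W T K \<beta> "time_section G"
          by (rule class_GK_regular_domain(1)[OF T K b g G ne])
        have reg: "R.boundary_regular \<gamma>" by (rule class_GK_regular_domain(2)[OF T K b g G ne])
        note d' = R.stay_prob_difference[OF refl _ G' _ g reg eps small, folded C_def]
        note d'' = R.stay_prob_difference[OF refl _ G'' _ g reg eps small, folded C_def]
        have "C * \<epsilon> \<le> \<bar>C\<bar> * \<epsilon>" using eps by (intro mult_right_mono) auto
        then show ?thesis using d' d'' H bnd(2) by (simp add: abs_le_iff)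
      qed
    qed
    also have "\<dots> < (\<bar>C\<bar> + 2 / \<beta> + 1) * \<epsilon>" using eps by (simp add: distrib_right)
    finally show "\<bar>stay_prob M W T G' - stay_prob M W T G''\<bar> < (\<bar>C\<bar> + 2 / \<beta> + 1) * \<epsilon>" .
  qed
qed

end
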